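(* Let $\alpha>1$, $\beta>0$ and $\gamma$ be real numbers. Then each of the classes $\mathfrak G(\alpha)$, $\mathfrak G(\alpha,\beta)$, $\mathfrak G(\alpha,\beta,\gamma)$, $\mathfrak G_{\mathrm{asy}}(\alpha,\beta,\gamma)$ and $\mathfrak G_{\mathrm{asy}}(\alpha,\beta)$ is closed under the operations (i) addition $f(x)+g(x)$, (ii) multiplication $f(x)g(x)$, (iii) composition $g(f(x))$, where $f(x)=x+\mathrm O(x^2)$, (iv) complex powers $f(x)^r$, where $f(x)=1+\mathrm O(x)$, and (v) functional inverse $f^{-1}(x)$, where $f(x)=x+\mathrm O(x^2)$. Moreover, in the cases of $\mathfrak G_{\mathrm{asy}}(\alpha,\beta,\gamma)$ and $\mathfrak G_{\mathrm{asy}}(\alpha,\beta)$, the asymptotic expansion to any fixed order of the result of the operation depends only on the asymptotic expansions to the same order and on a bounded number of initial values of the Taylor coefficients of the input function or functions.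
   Context: All series are formal power series $\sum_{n\ge0}a_nx^n$ with complex coefficients. For real numbers $\alpha>0$, $\beta>0$ and $\gamma$: $\mathfrak G(\alpha,\beta,\gamma)$ is the class of power series with $a_n=\mathrm O(n!^\alpha\beta^nn^\gamma)$; $\mathfrak G(\alpha,\beta)=\bigcup_\gamma\mathfrak G(\alpha,\beta,\gamma)$; $\mathfrak G(\alpha)=\bigcup_\beta\mathfrak G(\alpha,\beta)$. $\mathfrak G_{\mathrm{asy}}(\alpha,\beta,\gamma)$ is the class of those series for which there are constants $A_0,A_1,\dots$ with $a_n\sim n!^\alpha\beta^nn^\gamma\bigl(A_0+\frac{A_1}n+\frac{A_2}{n^2}+\cdots\bigr)$, meaning that $a_n/(n!^\alpha\beta^nn^\gamma)=A_0+\cdots+A_{r-1}n^{-r+1}+\mathrm O(n^{-r})$ as $n\to\infty$ for every fixed $r>0$ (the series in $1/n$ may be divergent). $\mathfrak G_{\mathrm{asy}}(\alpha,\beta)$ is the class of those series for which there are real exponents $\gamma_0>\gamma_1>\gamma_2>\cdots$, $\gamma_i\to-\infty$, and constants $A_i$ with $a_n\sim n!^\alpha\beta^n\bigl(A_0n^{\gamma_0}+A_1n^{\gamma_1}+A_2n^{\gamma_2}+\cdots\bigr)$ in the analogous sense. The coefficients $A_i$ (including $A_0$) are allowed to vanish.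
   Formalization: For 𝔊_asy(α,β,γ), closure under (ii)–(v) is claimed only for integer α (it fails otherwise, e.g. multiplying by 1+x); for 𝔊_asy(α,β), "order" is an exponent cutoff ρ and the bounded number of initial values may depend on ρ and on a bound for the leading exponents. *)

theory Defs
  imports "HOL-Analysis.Analysis" "HOL-Computational_Algebra.Formal_Power_Series"
    "HOL-Library.Landau_Symbols" "HOL-Real_Asymp.Real_Asymp"
begin

section \<open>Gevrey classes of formal power series\<close>

definition gevrey_scale :: "real \<Rightarrow> real \<Rightarrow> real \<Rightarrow> nat \<Rightarrow> real" where
  "gevrey_scale \<alpha> \<beta> \<gamma> n = (fact n) powr \<alpha> * \<beta> ^ n * (real n) powr \<gamma>"

text \<open>The number in the name of a class is its number of parameters.\<close>

definition gevrey3 :: "real \<Rightarrow> real \<Rightarrow> real \<Rightarrow> complex fps set" where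
  "gevrey3 \<alpha> \<beta> \<gamma> = {f. fps_nth f \<in> O(\<lambda>n. of_real (gevrey_scale \<alpha> \<beta> \<gamma> n))}"

definition gevrey2 :: "real \<Rightarrow> real \<Rightarrow> complex fps set" where
  "gevrey2 \<alpha> \<beta> = (\<Union>\<gamma>. gevrey3 \<alpha> \<beta> \<gamma>)"

definition gevrey1 :: "real \<Rightarrow> complex fps set" where
  "gevrey1 \<alpha> = (\<Union>\<beta>\<in>{0<..}. gevrey2 \<alpha> \<beta>)"

definition has_asy3 :: "real \<Rightarrow> real \<Rightarrow> real \<Rightarrow> complex fps \<Rightarrow> (nat \<Rightarrow> complex) \<Rightarrow> bool" where
  "has_asy3 \<alpha> \<beta> \<gamma> f A \<longleftrightarrow>
     (\<forall>r>0. (\<lambda>n. fps_nth f n / of_real (gevrey_scale \<alpha> \<beta> \<gamma> n) - (\<Sum>i<r. A i / of_nat n ^ i))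
            \<in> O(\<lambda>n. 1 / of_nat n ^ r))"

definition gevrey_asy3 :: "real \<Rightarrow> real \<Rightarrow> real \<Rightarrow> complex fps set" where
  "gevrey_asy3 \<alpha> \<beta> \<gamma> = {f. \<exists>A. has_asy3 \<alpha> \<beta> \<gamma> f A}"

definition has_asy2 ::
    "real \<Rightarrow> real \<Rightarrow> complex fps \<Rightarrow> (nat \<Rightarrow> real) \<Rightarrow> (nat \<Rightarrow> complex) \<Rightarrow> bool" where
  "has_asy2 \<alpha> \<beta> f e A \<longleftrightarrow>
     (\<forall>i. e (Suc i) < e i) \<and> filterlim e at_bot sequentially \<and>
     (\<forall>r>0. (\<lambda>n. fps_nth f n / of_real ((fact n) powr \<alpha> * \<beta> ^ n)
                 - (\<Sum>i<r. A i * of_real (real n powr e i)))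
            \<in> O(\<lambda>n. of_real (real n powr e r)))"

definition gevrey_asy2 :: "real \<Rightarrow> real \<Rightarrow> complex fps set" where
  "gevrey_asy2 \<alpha> \<beta> = {f. \<exists>e A. has_asy2 \<alpha> \<beta> f e A}"


section \<open>The operations\<close>

text \<open>
  The complex power of a series with constant term 1, as the binomial series
  \<open>\<Sum>k. (s gchoose k) * (f - 1) ^ k\<close>.
\<close>

definition fps_cpow :: "complex fps \<Rightarrow> complex \<Rightarrow> complex fps" where
  "fps_cpow f s = fps_compose (fps_binomial s) (f - 1)"

definition closed_under_series_ops :: "complex fps set \<Rightarrow> bool" where
  "closed_under_series_ops C \<longleftrightarrow>
     (\<forall>f\<in>C. \<forall>g\<in>C. f + g \<in> C) \<and>
     (\<forall>f\<in>C. \<forall>g\<in>C. f * g \<in> C) \<and>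
     (\<forall>f\<in>C. \<forall>g\<in>C. fps_nth f 0 = 0 \<and> fps_nth f 1 = 1 \<longrightarrow> fps_compose g f \<in> C) \<and>
     (\<forall>f\<in>C. \<forall>s. fps_nth f 0 = 1 \<longrightarrow> fps_cpow f s \<in> C) \<and>
     (\<forall>f\<in>C. fps_nth f 0 = 0 \<and> fps_nth f 1 = 1 \<longrightarrow> fps_inv f \<in> C)"

text \<open>
  Whenever the operations are applied to two tuples of inputs that are related by \<open>P\<close>,
  the two results are related by \<open>Q\<close>.
\<close>

definition series_ops_respect ::
    "(complex fps \<Rightarrow> complex fps \<Rightarrow> bool) \<Rightarrow> (complex fps \<Rightarrow> complex fps \<Rightarrow> bool) \<Rightarrow> bool" where
  "series_ops_respect P Q \<longleftrightarrow>
     (\<forall>f f' g g'. P f f' \<and> P g g' \<longrightarrow> Q (f + g) (f' + g')) \<and>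
     (\<forall>f f' g g'. P f f' \<and> P g g' \<longrightarrow> Q (f * g) (f' * g')) \<and>
     (\<forall>f f' g g'. P f f' \<and> P g g' \<and> fps_nth f 0 = 0 \<and> fps_nth f 1 = 1 \<and>
        fps_nth f' 0 = 0 \<and> fps_nth f' 1 = 1 \<longrightarrow> Q (fps_compose g f) (fps_compose g' f')) \<and>
     (\<forall>f f' s. P f f' \<and> fps_nth f 0 = 1 \<and> fps_nth f' 0 = 1 \<longrightarrow> Q (fps_cpow f s) (fps_cpow f' s)) \<and>
     (\<forall>f f'. P f f' \<and> fps_nth f 0 = 0 \<and> fps_nth f 1 = 1 \<and>
        fps_nth f' 0 = 0 \<and> fps_nth f' 1 = 1 \<longrightarrow> Q (fps_inv f) (fps_inv f'))"


section \<open>Dependence of the expansion of the result\<close>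

definition same_initial :: "nat \<Rightarrow> complex fps \<Rightarrow> complex fps \<Rightarrow> bool" where
  "same_initial N f f' \<longleftrightarrow> (\<forall>i<N. fps_nth f i = fps_nth f' i)"

text \<open>
  Order \<open>r\<close>: the expansion up to \<open>O(n^-r)\<close>, that is, the coefficients \<open>A i\<close> with \<open>i < r\<close>.
\<close>

definition same_asy3 ::
    "real \<Rightarrow> real \<Rightarrow> real \<Rightarrow> nat \<Rightarrow> complex fps \<Rightarrow> complex fps \<Rightarrow> bool" where
  "same_asy3 \<alpha> \<beta> \<gamma> r f f' \<longleftrightarrow>
     (\<forall>A A'. has_asy3 \<alpha> \<beta> \<gamma> f A \<and> has_asy3 \<alpha> \<beta> \<gamma> f' A' \<longrightarrow> (\<forall>i<r. A i = A' i))"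

definition asy3_determined :: "real \<Rightarrow> real \<Rightarrow> real \<Rightarrow> bool" where
  "asy3_determined \<alpha> \<beta> \<gamma> \<longleftrightarrow>
     (\<forall>r. \<exists>N. series_ops_respect
        (\<lambda>f f'. f \<in> gevrey_asy3 \<alpha> \<beta> \<gamma> \<and> f' \<in> gevrey_asy3 \<alpha> \<beta> \<gamma> \<and>
                same_asy3 \<alpha> \<beta> \<gamma> r f f' \<and> same_initial N f f')
        (same_asy3 \<alpha> \<beta> \<gamma> r))"

text \<open>
  Different series may come with different exponent sequences, and coefficients may vanish. So
  the order is given here by a real exponent \<open>\<rho>\<close>: the expansion up to \<open>O(n powr \<rho>)\<close> is the
  set of its nonzero terms with exponent above \<open>\<rho>\<close>.
\<close>

definition terms_above :: "real \<Rightarrow> (nat \<Rightarrow> real) \<Rightarrow> (nat \<Rightarrow> complex) \<Rightarrow> (real \<times> complex) set" where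
  "terms_above \<rho> e A = {(e i, A i) | i. \<rho> < e i \<and> A i \<noteq> 0}"

definition same_asy2 :: "real \<Rightarrow> real \<Rightarrow> real \<Rightarrow> complex fps \<Rightarrow> complex fps \<Rightarrow> bool" where
  "same_asy2 \<alpha> \<beta> \<rho> f f' \<longleftrightarrow>
     (\<forall>e A e' A'. has_asy2 \<alpha> \<beta> f e A \<and> has_asy2 \<alpha> \<beta> f' e' A' \<longrightarrow>
        terms_above \<rho> e A = terms_above \<rho> e' A')"

text \<open>
  The required number \<open>N\<close> of initial coefficients depends on how far \<open>\<rho>\<close> lies below the leading
  exponents of the inputs, which are unbounded on \<open>gevrey_asy2 \<alpha> \<beta>\<close>; hence the bound \<open>\<Gamma>\<close>.
  Every member of \<open>gevrey_asy2 \<alpha> \<beta>\<close> belongs to \<open>gevrey3 \<alpha> \<beta> \<Gamma>\<close> for all large \<open>\<Gamma>\<close>.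
\<close>

definition asy2_determined :: "real \<Rightarrow> real \<Rightarrow> bool" where
  "asy2_determined \<alpha> \<beta> \<longleftrightarrow>
     (\<forall>\<Gamma> \<rho>. \<exists>N. series_ops_respect
        (\<lambda>f f'. f \<in> gevrey_asy2 \<alpha> \<beta> \<inter> gevrey3 \<alpha> \<beta> \<Gamma> \<and> f' \<in> gevrey_asy2 \<alpha> \<beta> \<inter> gevrey3 \<alpha> \<beta> \<Gamma> \<and>
                same_asy2 \<alpha> \<beta> \<rho> f f' \<and> same_initial N f f')
        (same_asy2 \<alpha> \<beta> \<rho>))"


section \<open>Nonintegral \<open>\<alpha>\<close>\<close>

text \<open>
  The term \<open>a (n-1) * b 1\<close> of a product has relative size \<open>n powr -\<alpha>\<close>, which no expansion in
  powers of \<open>1/n\<close> can represent unless \<open>\<alpha>\<close> is an integer. The product below has one factor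
  with coefficients \<open>gevrey_scale \<alpha> \<beta> \<gamma> n\<close> and the other equal to \<open>1 + fps_X\<close>.
\<close>

lemma gevrey_asy3_not_closed:
  fixes \<alpha> \<beta> \<gamma> :: real
  assumes "\<alpha> > 1" "\<beta> > 0" "\<alpha> \<notin> \<int>"
  shows "\<exists>f\<in>gevrey_asy3 \<alpha> \<beta> \<gamma>. \<exists>g\<in>gevrey_asy3 \<alpha> \<beta> \<gamma>. f * g \<notin> gevrey_asy3 \<alpha> \<beta> \<gamma>"
proof -
  define s where "s = gevrey_scale \<alpha> \<beta> \<gamma>"
  define f :: "complex fps" where "f = Abs_fps (\<lambda>n. of_real (s n))"
  define g :: "complex fps" where "g = 1 + fps_X"
  have s_pos: "s n > 0" if "n > 0" for n
    using that assms by (simp add: s_def gevrey_scale_def)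
  have "has_asy3 \<alpha> \<beta> \<gamma> f (\<lambda>i. if i = 0 then 1 else 0)"
    unfolding has_asy3_def
  proof (intro allI impI)
    fix r :: nat assume r: "r > 0"
    have "(\<Sum>i<r. (if i = 0 then 1 else 0) / complex_of_nat n ^ i) = 1" for n
    proof -
      have "(\<Sum>i<r. (if i = 0 then 1 else 0) / complex_of_nat n ^ i) = (\<Sum>i<r. if i = 0 then 1 else 0)"
        by (intro sum.cong) auto
      with r show ?thesis by simp
    qed
    then have "\<forall>\<^sub>F n in sequentially. fps_nth f n / of_real (gevrey_scale \<alpha> \<beta> \<gamma> n) -
        (\<Sum>i<r. (if i = 0 then 1 else 0) / complex_of_nat n ^ i) = 0"
      using s_pos by (intro eventually_mono[OF eventually_gt_at_top[of 0]])
        (simp add: f_def flip: s_def, metis less_irrefl)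
    from landau_o.big.in_cong[OF this] show "(\<lambda>n. fps_nth f n / of_real (gevrey_scale \<alpha> \<beta> \<gamma> n) -
        (\<Sum>i<r. (if i = 0 then 1 else 0) / complex_of_nat n ^ i)) \<in> O(\<lambda>n. 1 / of_nat n ^ r)"
      by simp
  qed
  then have f: "f \<in> gevrey_asy3 \<alpha> \<beta> \<gamma>" by (auto simp: gevrey_asy3_def)
  have "has_asy3 \<alpha> \<beta> \<gamma> g (\<lambda>i. 0)"
    unfolding has_asy3_def
  proof (intro allI impI)
    fix r :: nat
    have "\<forall>\<^sub>F n in sequentially. fps_nth g n / of_real (gevrey_scale \<alpha> \<beta> \<gamma> n) -
        (\<Sum>i<r. 0 / complex_of_nat n ^ i) = 0"
      by (intro eventually_mono[OF eventually_gt_at_top[of 1]]) (auto simp: g_def)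
    from landau_o.big.in_cong[OF this] show "(\<lambda>n. fps_nth g n / of_real (gevrey_scale \<alpha> \<beta> \<gamma> n) -
        (\<Sum>i<r. 0 / complex_of_nat n ^ i)) \<in> O(\<lambda>n. 1 / of_nat n ^ r)"
      by simp
  qed
  then have g: "g \<in> gevrey_asy3 \<alpha> \<beta> \<gamma>" by (auto simp: gevrey_asy3_def)
  define u where "u n = (real n - 1) powr \<gamma> * real n powr (- \<gamma>) * real n powr (-\<alpha>) / \<beta>" for n
  have ratio: "fps_nth (f * g) n / of_real (gevrey_scale \<alpha> \<beta> \<gamma> n) = 1 + of_real (u n)" if n0: "n > 0" for n
  proof -
    obtain m where m: "n = Suc m" using n0 by (cases n) auto
    have "fps_nth (f * g) n = of_real (s n + s m)"
      by (simp add: g_def distrib_left m f_def)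
    moreover have "s m / s n = u n"
    proof -
      have "(fact n :: real) = real n * fact m" by (simp add: m)
      then have "s n = (real n powr \<alpha> * fact m powr \<alpha>) * (\<beta> * \<beta> ^ m) * real n powr \<gamma>"
        by (simp add: s_def gevrey_scale_def powr_mult m)
      moreover have "s m = fact m powr \<alpha> * \<beta> ^ m * (real n - 1) powr \<gamma>"
        by (simp add: s_def gevrey_scale_def m)
      ultimately show ?thesis
        using assms(2) n0 by (simp add: u_def powr_minus field_simps)
    qed
    then have "(s n + s m) / s n = 1 + u n"
      using s_pos[OF n0] by (simp add: field_simps)
    then have "complex_of_real (s n + s m) / of_real (s n) = 1 + of_real (u n)"
      by (metis of_real_1 of_real_add of_real_divide)
    ultimately show ?thesis by (simp flip: s_def)
  qed
  have "\<not> has_asy3 \<alpha> \<beta> \<gamma> (f * g) A" for A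
  proof
    assume A: "has_asy3 \<alpha> \<beta> \<gamma> (f * g) A"
    define R where "R r n = 1 + complex_of_real (u n) - (\<Sum>i<r. A i / of_nat n ^ i)" for r n
    have R: "R r \<in> O(\<lambda>n. 1 / of_nat n ^ r)" if "r > 0" for r
    proof -
      have "\<forall>\<^sub>F n in sequentially. fps_nth (f * g) n / of_real (gevrey_scale \<alpha> \<beta> \<gamma> n) -
          (\<Sum>i<r. A i / of_nat n ^ i) = R r n"
        by (intro eventually_mono[OF eventually_gt_at_top[of 0]]) (simp add: ratio R_def)
      moreover have "(\<lambda>n. fps_nth (f * g) n / of_real (gevrey_scale \<alpha> \<beta> \<gamma> n) -
          (\<Sum>i<r. A i / of_nat n ^ i)) \<in> O(\<lambda>n. 1 / of_nat n ^ r)"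
        using A that unfolding has_asy3_def by blast
      ultimately show ?thesis by (rule landau_o.big.in_cong[THEN iffD1])
    qed
    have sum_eq: "(\<Sum>i<r. A i / complex_of_nat n ^ i) = 1"
      if "\<And>i. i < r \<Longrightarrow> A i = (if i = 0 then 1 else 0)" "r > 0" for r n
    proof -
      have "(\<Sum>i<r. A i / complex_of_nat n ^ i) = (\<Sum>i<r. if i = 0 then 1 else 0)"
        using that by (intro sum.cong) auto
      with that(2) show ?thesis by simp
    qed
    have coeffs: "real k < \<alpha> \<longrightarrow> A k = (if k = 0 then 1 else 0)" for k
    proof (induction k rule: less_induct)
      case (less k)
      show ?case
      proof
        assume k: "real k < \<alpha>"
        have "(\<lambda>n. of_nat n ^ k * R (Suc k) n) \<in> O(\<lambda>n. of_nat n ^ k * (1 / of_nat n ^ Suc k))"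
          by (intro landau_o.big.mult R) auto
        also have "(\<lambda>n. complex_of_nat n ^ k * (1 / of_nat n ^ Suc k)) \<in> o(\<lambda>_. 1)"
        proof -
          have "(\<lambda>n. real n ^ k * (1 / real n ^ Suc k)) \<longlonglongrightarrow> 0" by real_asymp
          then have "(\<lambda>n. complex_of_real (real n ^ k * (1 / real n ^ Suc k))) \<longlonglongrightarrow> of_real 0"
            by (rule tendsto_of_real)
          then show ?thesis
            by (intro smalloI_tendsto) (simp_all only: of_real_mult of_real_divide of_real_power
                of_real_of_nat_eq of_real_1 of_real_0 div_by_1, simp)
        qed
        finally have lim1: "(\<lambda>n. of_nat n ^ k * R (Suc k) n) \<longlonglongrightarrow> 0"
          using smalloD_tendsto by fastforce
        have "(\<lambda>n. real n ^ k * u n) \<longlonglongrightarrow> 0"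
          unfolding u_def using k assms by real_asymp
        then have lim2: "(\<lambda>n. complex_of_real (real n ^ k * u n)) \<longlonglongrightarrow> 0"
          using tendsto_of_real by fastforce
        have eq: "of_nat n ^ k * R (Suc k) n - complex_of_real (real n ^ k * u n)
            = (if k = 0 then 1 else 0) - A k" if "n > 0" for n
        proof (cases "k = 0")
          case True then show ?thesis by (simp add: R_def)
        next
          case False
          have "(\<Sum>i<k. A i / complex_of_nat n ^ i) = 1"
            using less k False by (intro sum_eq) auto
          then have "R (Suc k) n = of_real (u n) - A k / of_nat n ^ k"
            by (simp add: R_def)
          then show ?thesis using that False by (simp add: field_simps)
        qed
        have "(\<lambda>n. of_nat n ^ k * R (Suc k) n - complex_of_real (real n ^ k * u n)) \<longlonglongrightarrow> 0 - 0"
          by (intro tendsto_diff lim1 lim2)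
        moreover have "\<forall>\<^sub>F n in sequentially. of_nat n ^ k * R (Suc k) n - complex_of_real (real n ^ k * u n)
            = (if k = 0 then 1 else 0) - A k"
          by (intro eventually_mono[OF eventually_gt_at_top[of 0]] eq)
        ultimately have "(\<lambda>n::nat. (if k = 0 then 1 else 0) - A k) \<longlonglongrightarrow> 0"
          by (simp only: tendsto_cong diff_0_right)
        then show "A k = (if k = 0 then 1 else 0)"
          by (simp add: LIMSEQ_const_iff)
      qed
    qed
    define r where "r = nat \<lceil>\<alpha>\<rceil>"
    have r: "real r > \<alpha>" "r > 0" "\<And>i. i < r \<Longrightarrow> real i < \<alpha>"
    proof -
      have "\<alpha> \<noteq> of_int \<lceil>\<alpha>\<rceil>" using assms(3) by (metis Ints_of_int)
      then show "real r > \<alpha>" using assms(1) le_of_int_ceiling[of \<alpha>] unfolding r_def by linarith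
      then show "r > 0" using assms(1) by linarith
      show "real i < \<alpha>" if "i < r" for i using that unfolding r_def by linarith
    qed
    have "(\<Sum>i<r. A i / complex_of_nat n ^ i) = 1" for n
    proof (rule sum_eq)
      show "A i = (if i = 0 then 1 else 0)" if "i < r" for i
        using coeffs[of i] r(3)[OF that] by blast
    qed (rule r(2))
    then have "R r = (\<lambda>n. of_real (u n))"
      by (simp add: R_def fun_eq_iff)
    with R[OF r(2)] have "(\<lambda>n. complex_of_real (u n)) \<in> O(\<lambda>n. 1 / of_nat n ^ r)" by simp
    then have "(\<lambda>n. norm (complex_of_real (u n))) \<in> O(\<lambda>n. norm (1 / complex_of_nat n ^ r))"
      by (subst landau_o.big.norm_iff)
    then have "u \<in> O(\<lambda>n. 1 / real n ^ r)"
      by (simp add: norm_divide norm_power)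
    moreover have "(\<lambda>n. 1 / real n ^ r) \<in> o(u)"
      unfolding u_def using r(1) assms by real_asymp
    ultimately have "(\<lambda>n. 1 / real n ^ r) \<in> o(\<lambda>n. 1 / real n ^ r)"
      using landau_o.small_big_trans by blast
    then have "\<forall>\<^sub>F n in sequentially. 1 / real n ^ r = 0"
      by (simp add: landau_o.small_refl_iff)
    then have "\<forall>\<^sub>F n::nat in sequentially. False"
      by (rule eventually_rev_mp) (intro eventually_mono[OF eventually_gt_at_top[of 0]], auto)
    then show False by simp
  qed
  then have "f * g \<notin> gevrey_asy3 \<alpha> \<beta> \<gamma>" by (auto simp: gevrey_asy3_def)
  with f g show ?thesis by blast
qed

end

(*
  The scale n!^alpha beta^n n^gamma grows so fast that in the coefficient of x^n of f g only the
  terms with a bounded index in one of the factors matter, and in the coefficient of x^n of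
  g(f(x)) = sum_k g_k f(x)^k only those with k bounded or n - k bounded; since alpha > 1, all others
  together are smaller than any prescribed n!^alpha beta^n n^rho. The terms with k = n - j involve
  only g_(n-j) times a polynomial in n of degree at most j, that is, g under the operators f -> x f
  and f -> x^2 f'. So a linear class of series is closed under products and compositions as soon as
  it is stable under these two operators and complete for the filtration by rho. Powers reduce to
  composition with the binomial series; for inverses, Lagrange inversion gives a crude bound, and
  composing f with the inverse of a polynomial truncation refines it. The truncated class
  n!^alpha beta^n n^rho is itself such a class, which shows that changing the input by O(n^rho)
  and only in high coefficients changes the result by O(n^rho).
*)
theory Submission
  imports Defs
begin

section \<open>Factorial estimates\<close>

text \<open>An exponent \<gamma> is traded for an integer shift g of the factorial, n!^\<alpha>
  n^\<gamma> <= (n+g)!^\<alpha>, so that convolutions become sums of products of factorials whose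
  arguments have a fixed sum N. If both arguments are at least K, such a product is at most N!
  divided by the binomial coefficient N choose K; for large K this beats every polynomial loss. In a
  composition the coefficients of f^k bring a binomial coefficient k choose i, which one full factor
  N! has to absorb. Only the power \<alpha> - 1 is left for the gain, whence the need for \<alpha> >
  1. The number K is chosen from the exponents alone, not from the series, and this uniformity
  yields the bounded number of initial coefficients. The inverse is the obstacle: its coefficients
  come from powers with exponent -n, and the bound obtained does not preserve \<gamma>. It still
  serves as an a priori bound, because the remainder estimates accept any finite exponent.\<close>

text \<open>Each \<open>x i powr \<alpha>\<close> is at most \<open>x i\<close> times the total to
  the power \<open>\<alpha> - 1\<close>. This moves the exponent outside a convolution sum, so that
  only an estimate for natural numbers remains.\<close>

lemma sum_powr_le_powr_sum:
  fixes x :: "'a \<Rightarrow> real"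
  assumes "\<alpha> \<ge> 1" and nonneg: "\<And>i. i \<in> A \<Longrightarrow> x i \<ge> 0"
  shows "(\<Sum>i\<in>A. x i powr \<alpha>) \<le> (\<Sum>i\<in>A. x i) powr \<alpha>"
proof (cases "finite A")
  case True
  define S where "S = (\<Sum>i\<in>A. x i)"
  have S: "S \<ge> 0" using nonneg by (auto simp: S_def intro: sum_nonneg)
  have split: "y powr \<alpha> = y * y powr (\<alpha> - 1)" if "y \<ge> 0" for y :: real
    using that powr_add[of y 1 "\<alpha> - 1"] by simp
  have "(\<Sum>i\<in>A. x i powr \<alpha>) \<le> (\<Sum>i\<in>A. x i * S powr (\<alpha> - 1))"
  proof (intro sum_mono)
    fix i assume i: "i \<in> A"
    have "x i \<le> S" unfolding S_def using i nonneg True by (intro member_le_sum) auto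
    then show "x i powr \<alpha> \<le> x i * S powr (\<alpha> - 1)"
      using nonneg[OF i] assms(1) by (subst split) (auto intro!: mult_left_mono powr_mono2)
  qed
  also have "\<dots> = S powr \<alpha>"
    by (subst split[OF S]) (simp add: S_def sum_distrib_right)
  finally show ?thesis by (simp add: S_def)
qed auto

text \<open>Row a + b of Pascal's triangle increases towards its middle; the mirror image b replaces
  a when a lies beyond the middle.\<close>

lemma choose_mono_inner:
  fixes p a b :: nat
  assumes "p \<le> a" "p \<le> b"
  shows "(a + b) choose p \<le> (a + b) choose a"
proof (cases "2 * a \<le> a + b")
  case True then show ?thesis using assms by (intro binomial_mono) auto
next
  case False
  have "(a + b) choose p \<le> (a + b) choose b"
    using assms False by (intro binomial_mono) auto
  also have "(a + b) choose b = (a + b) choose a"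
    using binomial_symmetric[of b "a + b"] by simp
  finally show ?thesis .
qed

text \<open>The product of factorials is \<open>fact (a + b)\<close> over the binomial coefficient
  at \<open>a\<close>, which is at least the one at \<open>K\<close>. The factor
  \<open>(a + b) choose K\<close> is the source of the gain in the remainder estimates.\<close>

lemma fact_mult_choose_le:
  fixes a b K :: nat
  assumes "K \<le> a" "K \<le> b"
  shows "fact a * fact b * ((a + b) choose K) \<le> (fact (a + b) :: nat)"
proof -
  have "fact a * fact b * ((a + b) choose K) \<le> fact a * fact b * ((a + b) choose a)"
    using choose_mono_inner[OF assms] by (intro mult_left_mono) auto
  also have "\<dots> = fact (a + b)" using binomial_fact_lemma[of a "a + b"] by simp
  finally show ?thesis .
qed

text \<open>Log-convexity of the factorial: for a fixed sum of the arguments the product grows as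
  they move apart.\<close>

lemma fact_mult_fact_le:
  fixes p q a b :: nat
  assumes "a + b = p + q" "p \<le> a" "p \<le> b"
  shows "fact a * fact b \<le> (fact p * fact q :: nat)"
proof -
  have "fact a * fact b * ((a + b) choose p) \<le> (fact (p + q) :: nat)"
    using fact_mult_choose_le[OF assms(2,3)] assms(1) by simp
  also have "\<dots> = fact p * fact q * ((p + q) choose p)"
    using binomial_fact_lemma[of p "p + q"] by simp
  finally show ?thesis using assms(1) by (simp add: mult_le_cancel2 zero_less_binomial)
qed

text \<open>Only the two end terms are large, each equal to \<open>E\<close>. The inner terms are at
  most \<open>I\<close> each, and \<open>M\<close> of them are harmless since M (M-1+g)! <= (M+g)!.
  The constant does not depend on \<open>M\<close>, which makes an induction over powers of a series
  possible.\<close>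

lemma sum_fact_mult_fact_le:
  fixes g M :: nat
  shows "(\<Sum>a=1..M. fact (a + g) * fact (M + 1 - a + g)) \<le>
           (2 * fact (1 + g) + fact (2 + g)) * (fact (M + g) :: nat)"
proof -
  define E :: nat where "E = fact (1 + g) * fact (M + g)"
  define I :: nat where "I = fact (2 + g) * fact (M - 1 + g)"
  have "fact (a + g) * fact (M + 1 - a + g) \<le> (if a = 1 then E else 0) + (if a = M then E else 0) + I"
    if a: "a \<in> {1..M}" for a
  proof -
    consider "a = 1" | "a = M" | "2 \<le> a" "a \<le> M - 1" using a by fastforce
    then show ?thesis
    proof cases
      case 3
      then have "fact (a + g) * fact (M + 1 - a + g) \<le> I"
        unfolding I_def by (intro fact_mult_fact_le) auto
      then show ?thesis by simp
    qed (auto simp: E_def)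
  qed
  then have "(\<Sum>a=1..M. fact (a + g) * fact (M + 1 - a + g)) \<le>
      (\<Sum>a=1..M. (if a = 1 then E else 0) + (if a = M then E else 0) + I)"
    by (intro sum_mono)
  also have "\<dots> \<le> E + E + M * I" by (simp add: sum.distrib)
  also have "M * I \<le> fact (2 + g) * fact (M + g)"
  proof (cases M)
    case (Suc m)
    have "M * fact (M - 1 + g) \<le> (fact (M + g) :: nat)" using Suc by simp
    then have "fact (2 + g) * (M * fact (M - 1 + g)) \<le> fact (2 + g) * (fact (M + g) :: nat)"
      by (intro mult_left_mono) auto
    then show ?thesis by (simp add: I_def algebra_simps)
  qed simp
  finally show ?thesis by (simp add: E_def algebra_simps)
qed

text \<open>Together with the next lemma: powers of \<open>n\<close> and integer shifts of the
  factorial are interchangeable up to constants.\<close>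

lemma fact_add_le: "(fact (n + g) :: nat) \<le> fact n * (n + g) ^ g"
proof (induction g)
  case (Suc g)
  have "(fact (n + Suc g) :: nat) = (n + Suc g) * fact (n + g)" by simp
  also have "\<dots> \<le> (n + Suc g) * (fact n * (n + g) ^ g)" using Suc by (intro mult_left_mono) auto
  also have "\<dots> \<le> (n + Suc g) * (fact n * (n + Suc g) ^ g)"
    by (intro mult_left_mono power_mono) auto
  finally show ?case by (simp add: algebra_simps)
qed simp

lemma fact_mult_power_le: "(fact n :: nat) * (n + 1) ^ g \<le> fact (n + g)"
proof (induction g)
  case (Suc g)
  have "(fact n :: nat) * (n + 1) ^ Suc g = (n + 1) * (fact n * (n + 1) ^ g)"
    by (simp add: algebra_simps)
  also have "\<dots> \<le> (n + 1 + g) * fact (n + g)" using Suc by (intro mult_mono) auto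
  finally show ?case by simp
qed simp

lemma sum_exp_terms_le:
  fixes x :: real
  assumes "finite A" "x \<ge> 0"
  shows "(\<Sum>i\<in>A. x ^ i / fact i) \<le> exp x"
proof -
  have "(\<lambda>k. x ^ k /\<^sub>R fact k) sums exp x" by (rule exp_converges)
  then have sums: "(\<lambda>k. x ^ k / fact k) sums exp x" by (simp add: field_simps)
  then have "(\<Sum>i\<in>A. x ^ i / fact i) \<le> (\<Sum>k. x ^ k / fact k)"
    using assms by (intro sum_le_suminf) (auto simp: sums_iff)
  then show ?thesis using sums by (simp add: sums_iff)
qed

text \<open>Combines (n/i)^i <= n choose i with i^i <= e^i i!. In the estimate of the inverse it
  lets a factorial with reduced argument absorb the power of n that stems from the exponent
  -n.\<close>

lemma power_mult_fact_diff_le: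
  assumes "i \<le> n"
  shows "real n ^ i * fact (n - i) \<le> exp 1 ^ i * fact n"
proof (cases "i = 0")
  case False
  have "(real n / real i) ^ i \<le> real (n choose i)"
    by (rule binomial_ge_n_over_k_pow_k) (use assms in auto)
  then have "real n ^ i \<le> real i ^ i * real (n choose i)"
    using False by (simp add: power_divide field_simps)
  moreover have "real i ^ i \<le> exp 1 ^ i * fact i"
  proof -
    have "real i ^ i / fact i \<le> exp (real i)"
      using sum_exp_terms_le[of "{i}" "real i"] by simp
    then show ?thesis by (simp add: field_simps flip: exp_of_nat_mult)
  qed
  ultimately have "real n ^ i \<le> exp 1 ^ i * fact i * real (n choose i)"
    by (smt (verit, best) mult_right_mono of_nat_0_le_iff)
  then have "real n ^ i * fact (n - i) \<le> exp 1 ^ i * fact i * real (n choose i) * fact (n - i)"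
    by (intro mult_right_mono) auto
  also have "\<dots> = exp 1 ^ i * fact n"
    using binomial_fact_lemma[OF assms] by (metis (no_types, lifting) mult.assoc mult.commute of_nat_fact of_nat_mult)
  finally show ?thesis .
qed simp


section \<open>Bounds for the Gevrey classes\<close>

lemma gevrey_scale_pos: "\<beta> > 0 \<Longrightarrow> n > 0 \<Longrightarrow> gevrey_scale \<alpha> \<beta> \<gamma> n > 0"
  by (simp add: gevrey_scale_def)

text \<open>The finitely many exceptional indices are absorbed into the constant. Index 0 is left
  out because \<open>0 powr \<gamma>\<close> is 0.\<close>

lemma gevrey3_iff:
  assumes "\<beta> > 0"
  shows "f \<in> gevrey3 \<alpha> \<beta> \<gamma> \<longleftrightarrow>
    (\<exists>C>0. \<forall>n>0. cmod (fps_nth f n) \<le> C * gevrey_scale \<alpha> \<beta> \<gamma> n)"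
proof
  let ?s = "gevrey_scale \<alpha> \<beta> \<gamma>"
  assume "f \<in> gevrey3 \<alpha> \<beta> \<gamma>"
  then have "fps_nth f \<in> O(\<lambda>n. of_real (?s n))" by (simp add: gevrey3_def)
  then obtain c where c: "c > 0" "eventually (\<lambda>n. cmod (fps_nth f n) \<le> c * cmod (of_real (?s n))) sequentially"
    by (rule landau_o.bigE)
  then obtain N where N: "\<And>n. n \<ge> N \<Longrightarrow> cmod (fps_nth f n) \<le> c * cmod (of_real (?s n))"
    by (auto simp: eventually_at_top_linorder)
  define C where "C = c + (\<Sum>n\<in>{1..N}. cmod (fps_nth f n) / ?s n)"
  have "C \<ge> c"
    unfolding C_def using gevrey_scale_pos[OF assms]
    by (auto intro!: sum_nonneg divide_nonneg_pos)
  moreover have "cmod (fps_nth f n) \<le> C * ?s n" if n: "n > 0" for n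
  proof (cases "n \<ge> N")
    case True
    have "cmod (fps_nth f n) \<le> c * ?s n"
      using N[OF True] gevrey_scale_pos[OF assms n, of \<alpha> \<gamma>] by simp
    also have "\<dots> \<le> C * ?s n"
      using \<open>C \<ge> c\<close> gevrey_scale_pos[OF assms n, of \<alpha> \<gamma>] by (intro mult_right_mono) auto
    finally show ?thesis .
  next
    case False
    have "cmod (fps_nth f n) / ?s n \<le> (\<Sum>n\<in>{1..N}. cmod (fps_nth f n) / ?s n)"
      using False n gevrey_scale_pos[OF assms]
      by (intro member_le_sum) (auto intro!: divide_nonneg_pos)
    also have "\<dots> \<le> C" using c by (simp add: C_def)
    finally show ?thesis using gevrey_scale_pos[OF assms n, of \<alpha> \<gamma>] by (simp add: field_simps)
  qed
  ultimately show "\<exists>C>0. \<forall>n>0. cmod (fps_nth f n) \<le> C * ?s n" using c(1) by (intro exI[of _ C]) auto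
next
  assume "\<exists>C>0. \<forall>n>0. cmod (fps_nth f n) \<le> C * gevrey_scale \<alpha> \<beta> \<gamma> n"
  then obtain C where C: "C > 0" "\<And>n. n > 0 \<Longrightarrow> cmod (fps_nth f n) \<le> C * gevrey_scale \<alpha> \<beta> \<gamma> n"
    by blast
  have "fps_nth f \<in> O(\<lambda>n. of_real (gevrey_scale \<alpha> \<beta> \<gamma> n))"
    using C gevrey_scale_pos[OF assms]
    by (intro bigoI[of _ C] eventually_mono[OF eventually_gt_at_top[of 0]]) (auto simp: less_imp_le)
  then show "f \<in> gevrey3 \<alpha> \<beta> \<gamma>" by (simp add: gevrey3_def)
qed

lemma gevrey3I_eventually:
  assumes "\<beta> > 0"
    and "eventually (\<lambda>n. cmod (fps_nth f n) \<le> C * gevrey_scale \<alpha> \<beta> \<gamma> n) sequentially"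
  shows "f \<in> gevrey3 \<alpha> \<beta> \<gamma>"
proof -
  have "eventually (\<lambda>n. cmod (fps_nth f n) \<le> C * cmod (of_real (gevrey_scale \<alpha> \<beta> \<gamma> n))) sequentially"
    using assms(2) eventually_gt_at_top[of 0]
    by eventually_elim (use gevrey_scale_pos[OF assms(1), of _ \<alpha> \<gamma>] in \<open>simp add: less_imp_le\<close>)
  then have "fps_nth f \<in> O(\<lambda>n. of_real (gevrey_scale \<alpha> \<beta> \<gamma> n))"
    by (rule bigoI)
  then show ?thesis by (simp add: gevrey3_def)
qed

text \<open>The power of n is hidden in the shift \<open>g\<close>, via n^g <= ((n+1)^g)^\<alpha>
  and \<open>fact_mult_power_le\<close>. In this form products of bounds are products of factorials,
  and index 0 is covered as well.\<close>

lemma gevrey3_bound: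
  assumes "\<alpha> \<ge> 1" "\<beta> > 0" "f \<in> gevrey3 \<alpha> \<beta> \<Gamma>" "g \<ge> nat \<lceil>\<Gamma>\<rceil>"
  shows "\<exists>C>0. \<forall>n. cmod (fps_nth f n) \<le> C * fact (n + g) powr \<alpha> * \<beta> ^ n"
proof -
  obtain C where C: "C > 0" "\<And>n. n > 0 \<Longrightarrow> cmod (fps_nth f n) \<le> C * gevrey_scale \<alpha> \<beta> \<Gamma> n"
    using assms gevrey3_iff by metis
  have scale: "gevrey_scale \<alpha> \<beta> \<Gamma> n \<le> fact (n + g) powr \<alpha> * \<beta> ^ n" if "n > 0" for n
  proof -
    have "real n powr \<Gamma> \<le> real n powr real g" using that assms(4) by (intro powr_mono) linarith+
    also have "\<dots> \<le> (real n + 1) powr real g" using that by (intro powr_mono2) auto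
    also have "\<dots> \<le> ((real n + 1) powr real g) powr \<alpha>"
      using assms(1) powr_mono[of 1 \<alpha> "(real n + 1) powr real g"] by (auto simp: ge_one_powr_ge_zero)
    finally have "fact n powr \<alpha> * real n powr \<Gamma> \<le> fact n powr \<alpha> * ((real n + 1) powr real g) powr \<alpha>"
      by (intro mult_left_mono) auto
    also have "\<dots> = (fact n * (real n + 1) ^ g) powr \<alpha>"
      by (simp add: powr_mult powr_realpow)
    also have "\<dots> \<le> fact (n + g) powr \<alpha>"
    proof -
      have "real (fact n * (n + 1) ^ g) \<le> real (fact (n + g))"
        using fact_mult_power_le[of n g] by (rule of_nat_mono)
      then show ?thesis using assms(1) by (intro powr_mono2) (auto simp: add.commute)
    qed
    finally show ?thesis
      using assms(2) by (auto simp: gevrey_scale_def mult.assoc mult.commute[of "\<beta> ^ n"] mult.left_commute[of "\<beta> ^ n"] intro!: mult_left_mono)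
  qed
  define D where "D = C + cmod (fps_nth f 0)"
  have "cmod (fps_nth f n) \<le> D * fact (n + g) powr \<alpha> * \<beta> ^ n" for n
  proof (cases "n = 0")
    case True
    have "1 \<le> (fact g :: real) powr \<alpha>" using assms(1) by (intro ge_one_powr_ge_zero fact_ge_1) auto
    then have "D * 1 \<le> D * fact g powr \<alpha>" using C(1) by (intro mult_left_mono) (auto simp: D_def)
    with True C(1) show ?thesis by (simp add: D_def)
  next
    case False
    then have "cmod (fps_nth f n) \<le> C * (fact (n + g) powr \<alpha> * \<beta> ^ n)"
      using C(2)[of n] scale[of n] C(1) by (smt (verit) mult_left_mono gr0I)
    also have "\<dots> \<le> D * (fact (n + g) powr \<alpha> * \<beta> ^ n)"
      using assms(2) by (intro mult_right_mono) (auto simp: D_def)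
    finally show ?thesis by (simp add: mult.assoc)
  qed
  moreover have "D > 0" using C(1) by (simp add: D_def add_pos_nonneg)
  ultimately show ?thesis by blast
qed

text \<open>
  The binomial coefficient in the denominator gains the factor \<open>n powr - (K * \<epsilon>)\<close>, which beats
  any polynomial loss when \<open>K\<close> is large.
\<close>

lemma gevrey3I_choose:
  assumes "\<alpha> \<ge> 1" "\<beta> > 0" "\<epsilon> > 0" "C \<ge> 0" "1 + real g * \<alpha> - real K * \<epsilon> \<le> \<rho>"
    and bound: "eventually (\<lambda>n. cmod (fps_nth f n) \<le>
      C * real n * fact (n + g) powr \<alpha> / real ((n + g) choose K) powr \<epsilon> * \<beta> ^ n) sequentially"
  shows "f \<in> gevrey3 \<alpha> \<beta> \<rho>"
proof -
  \<comment> \<open>The factor \<open>2 ^ g\<close> comes from n + g <= 2n, the last one from the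
    lower bound (n/K)^K for the binomial coefficient; \<open>max K 1\<close> avoids a division by
    zero for \<open>K = 0\<close>.\<close>
  define B where "B = C * (2 ^ g) powr \<alpha> * (real (max K 1) ^ K) powr \<epsilon>"
  have "eventually (\<lambda>n. cmod (fps_nth f n) \<le> B * gevrey_scale \<alpha> \<beta> \<rho> n) sequentially"
    using bound eventually_ge_at_top[of "max 1 (max g K)"]
  proof eventually_elim
    case (elim n)
    then have n: "n \<ge> 1" "n \<ge> g" "n \<ge> K" by auto
    have "real (fact (n + g)) \<le> real (fact n * (n + g) ^ g)"
      using fact_add_le[of n g] by (rule of_nat_mono)
    also have "\<dots> = fact n * (real n + real g) ^ g" by simp
    also have "\<dots> \<le> fact n * (2 * real n) ^ g" using n by (intro mult_left_mono power_mono) auto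
    finally have "fact (n + g) powr \<alpha> \<le> (fact n * (2 * real n) ^ g) powr \<alpha>"
      using assms(1) by (intro powr_mono2) auto
    also have "\<dots> = fact n powr \<alpha> * (2 ^ g) powr \<alpha> * real n powr (real g * \<alpha>)"
      using n by (simp add: powr_mult power_mult_distrib powr_powr flip: powr_realpow)
    finally have 1: "fact (n + g) powr \<alpha> \<le> fact n powr \<alpha> * (2 ^ g) powr \<alpha> * real n powr (real g * \<alpha>)" .
    have "(real n / real (max K 1)) ^ K \<le> real ((n + g) choose K)"
    proof (cases "K = 0")
      case False
      have "(real n / real (max K 1)) ^ K \<le> (real (n + g) / real K) ^ K"
        using False by (intro power_mono) (auto simp: divide_right_mono)
      also have "\<dots> \<le> real ((n + g) choose K)"
        using n False by (intro binomial_ge_n_over_k_pow_k) auto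
      finally show ?thesis .
    qed simp
    then have "((real n / real (max K 1)) ^ K) powr \<epsilon> \<le> real ((n + g) choose K) powr \<epsilon>"
      using assms(3) by (intro powr_mono2) auto
    moreover have "((real n / real (max K 1)) ^ K) powr \<epsilon> =
        real n powr (real K * \<epsilon>) / (real (max K 1) ^ K) powr \<epsilon>"
      using n by (simp add: power_divide powr_divide powr_powr flip: powr_realpow)
    ultimately have 2: "real n powr (real K * \<epsilon>) / (real (max K 1) ^ K) powr \<epsilon> \<le> real ((n + g) choose K) powr \<epsilon>"
      by simp
    have pos: "real n powr (real K * \<epsilon>) / (real (max K 1) ^ K) powr \<epsilon> > 0"
      using n by simp
    have "C * real n * fact (n + g) powr \<alpha> / real ((n + g) choose K) powr \<epsilon> \<le>
       C * real n * (fact n powr \<alpha> * (2 ^ g) powr \<alpha> * real n powr (real g * \<alpha>)) /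
       (real n powr (real K * \<epsilon>) / (real (max K 1) ^ K) powr \<epsilon>)"
      using assms(4) 1 2 pos by (intro frac_le mult_left_mono) auto
    also have "\<dots> = B * fact n powr \<alpha> * (real n powr 1 * real n powr (real g * \<alpha>) * real n powr (- (real K * \<epsilon>)))"
      using n by (simp add: B_def powr_minus field_simps)
    also have "real n powr 1 * real n powr (real g * \<alpha>) * real n powr (- (real K * \<epsilon>)) =
        real n powr (1 + real g * \<alpha> - real K * \<epsilon>)"
      by (simp add: powr_add powr_diff powr_minus divide_inverse)
    also have "B * fact n powr \<alpha> * real n powr (1 + real g * \<alpha> - real K * \<epsilon>) \<le> B * fact n powr \<alpha> * real n powr \<rho>"
      using n assms(4,5) by (intro mult_left_mono powr_mono) (auto simp: B_def)
    finally have "C * real n * fact (n + g) powr \<alpha> / real ((n + g) choose K) powr \<epsilon> * \<beta> ^ n \<le>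
        B * fact n powr \<alpha> * real n powr \<rho> * \<beta> ^ n"
      using assms(2) by (intro mult_right_mono) auto
    also have "\<dots> = B * gevrey_scale \<alpha> \<beta> \<rho> n" by (simp add: gevrey_scale_def)
    finally show ?case using elim(1) by linarith
  qed
  then show ?thesis by (intro gevrey3I_eventually assms)
qed

lemma gevrey2I_bound:
  assumes "\<alpha> \<ge> 1" "\<beta> > 0" "C \<ge> 0"
    and "eventually (\<lambda>n. cmod (fps_nth f n) \<le> C * real n * fact (n + g) powr \<alpha> * \<beta> ^ n) sequentially"
  shows "f \<in> gevrey2 \<alpha> \<beta>"
proof -
  have "f \<in> gevrey3 \<alpha> \<beta> (1 + real g * \<alpha>)"
    using assms by (intro gevrey3I_choose[where \<epsilon> = 1 and K = 0 and C = C and g = g]) auto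
  then show ?thesis by (auto simp: gevrey2_def)
qed

text \<open>Since v starts with x, v^i starts with x^i, and the argument of the factorial drops by i
  - 1. The induction multiplies by one more v and bounds the convolution by
  \<open>sum_fact_mult_fact_le\<close>. The constant \<open>E\<close> serves all i and m, so that
  later sums over i are dominated by an exponential series.\<close>

lemma fps_power_coeff_bound:
  fixes v :: "complex fps"
  assumes "\<alpha> \<ge> 1" "\<beta> > 0" "C > 0" "fps_nth v 0 = 0"
    and v: "\<And>m. m > 0 \<Longrightarrow> cmod (fps_nth v m) \<le> C * fact (m + g) powr \<alpha> * \<beta> ^ m"
  shows "\<exists>E>0. \<forall>i m. 0 < i \<and> i \<le> m \<longrightarrow>
    cmod (fps_nth (v ^ i) m) \<le> E ^ i * fact (m - i + 1 + g) powr \<alpha> * \<beta> ^ m"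
proof -
  \<comment> \<open>\<open>D\<close> is the constant of one convolution; \<open>E\<close> has to
    dominate \<open>C\<close> for the first power and \<open>real D powr \<alpha> * C\<close> for
    each further multiplication.\<close>
  define D where "D = (2 * fact (1 + g) + fact (2 + g) :: nat)"
  define E where "E = max 1 (real D powr \<alpha>) * max 1 C"
  have E: "E \<ge> C" "E \<ge> real D powr \<alpha> * C" "E > 0"
  proof -
    have "1 * C \<le> max 1 (real D powr \<alpha>) * max 1 C" using assms(3) by (intro mult_mono) auto
    then show "E \<ge> C" by (simp add: E_def)
    show "E \<ge> real D powr \<alpha> * C" unfolding E_def using assms(3) by (intro mult_mono) auto
    show "E > 0" using \<open>E \<ge> C\<close> assms(3) by linarith
  qed
  have "cmod (fps_nth (v ^ Suc j) m) \<le> E ^ Suc j * fact (m - j + g) powr \<alpha> * \<beta> ^ m" if "Suc j \<le> m" for j m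
    using that
  proof (induction j arbitrary: m)
    case 0
    have "C * fact (m + g) powr \<alpha> * \<beta> ^ m \<le> E * fact (m + g) powr \<alpha> * \<beta> ^ m"
      using E assms(2) by (intro mult_right_mono) auto
    with v[of m] 0 show ?case by (simp only: power_Suc0_right power_one_right diff_zero flip: One_nat_def) linarith
  next
    case (Suc j m)
    define M where "M = m - Suc j"
    have "fps_nth (v ^ Suc (Suc j)) m = (\<Sum>a=0..m. fps_nth v a * fps_nth (v ^ Suc j) (m - a))"
      by (simp add: fps_mult_nth)
    \<comment> \<open>The term at 0 vanishes because v has no constant term, those beyond
      \<open>M\<close> because \<open>v ^ Suc j\<close> begins at index
      \<open>Suc j\<close>.\<close>
    also have "\<dots> = (\<Sum>a=1..M. fps_nth v a * fps_nth (v ^ Suc j) (m - a))"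
    proof (rule sum.mono_neutral_right)
      show "\<forall>a\<in>{0..m} - {1..M}. fps_nth v a * fps_nth (v ^ Suc j) (m - a) = 0"
      proof
        fix a assume "a \<in> {0..m} - {1..M}"
        then consider "a = 0" | "m - a < Suc j" using Suc.prems by (fastforce simp: M_def)
        then show "fps_nth v a * fps_nth (v ^ Suc j) (m - a) = 0"
          using assms(4) startsby_zero_power_prefix[OF assms(4), of "Suc j"] by cases auto
      qed
    qed (auto simp: M_def)
    finally have "cmod (fps_nth (v ^ Suc (Suc j)) m) \<le> (\<Sum>a=1..M. cmod (fps_nth v a) * cmod (fps_nth (v ^ Suc j) (m - a)))"
      by (metis (no_types, lifting) norm_mult sum.cong sum_norm_le order_refl)
    also have "\<dots> \<le> (\<Sum>a=1..M. (C * fact (a + g) powr \<alpha> * \<beta> ^ a) *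
                         (E ^ Suc j * fact (m - a - j + g) powr \<alpha> * \<beta> ^ (m - a)))"
    proof (intro sum_mono mult_mono)
      fix a assume a: "a \<in> {1..M}"
      show "cmod (fps_nth v a) \<le> C * fact (a + g) powr \<alpha> * \<beta> ^ a" using v a by auto
      show "cmod (fps_nth (v ^ Suc j) (m - a)) \<le> E ^ Suc j * fact (m - a - j + g) powr \<alpha> * \<beta> ^ (m - a)"
        using a Suc.prems by (intro Suc.IH) (auto simp: M_def)
    qed (use assms in auto)
    also have "\<dots> = (\<Sum>a=1..M. C * E ^ Suc j * \<beta> ^ m * real (fact (a + g) * fact (M + 1 - a + g)) powr \<alpha>)"
    proof (intro sum.cong refl)
      fix a assume a: "a \<in> {1..M}"
      have e: "m - a - j + g = M + 1 - a + g" "\<beta> ^ m = \<beta> ^ a * \<beta> ^ (m - a)"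
        using a Suc.prems by (auto simp: M_def simp flip: power_add)
      show "(C * fact (a + g) powr \<alpha> * \<beta> ^ a) * (E ^ Suc j * fact (m - a - j + g) powr \<alpha> * \<beta> ^ (m - a)) =
          C * E ^ Suc j * \<beta> ^ m * real (fact (a + g) * fact (M + 1 - a + g)) powr \<alpha>"
        unfolding e by (simp add: powr_mult)
    qed
    also have "\<dots> \<le> C * E ^ Suc j * \<beta> ^ m * (real D powr \<alpha> * fact (M + g) powr \<alpha>)"
    proof -
      have "(\<Sum>a=1..M. real (fact (a + g) * fact (M + 1 - a + g)) powr \<alpha>) \<le>
          (\<Sum>a=1..M. real (fact (a + g) * fact (M + 1 - a + g))) powr \<alpha>"
        using assms(1) by (intro sum_powr_le_powr_sum) auto
      also have "\<dots> = real (\<Sum>a=1..M. fact (a + g) * fact (M + 1 - a + g)) powr \<alpha>" by simp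
      also have "\<dots> \<le> real (D * fact (M + g)) powr \<alpha>"
        using sum_fact_mult_fact_le[of g M] assms(1) unfolding D_def
        by (intro powr_mono2 of_nat_mono of_nat_0_le_iff) simp_all
      finally show ?thesis
        using assms E(3) by (auto simp: powr_mult simp flip: sum_distrib_left intro!: mult_left_mono)
    qed
    also have "\<dots> = (real D powr \<alpha> * C) * (E ^ Suc j * \<beta> ^ m * fact (M + g) powr \<alpha>)" by simp
    also have "\<dots> \<le> E * (E ^ Suc j * \<beta> ^ m * fact (M + g) powr \<alpha>)"
      using E assms(2) by (intro mult_right_mono) auto
    finally show ?case by (simp add: M_def mult_ac)
  qed
  note * = this
  have "cmod (fps_nth (v ^ i) m) \<le> E ^ i * fact (m - i + 1 + g) powr \<alpha> * \<beta> ^ m" if "0 < i" "i \<le> m" for i m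
    using *[of "i - 1" m] that by (simp add: Suc_diff_le)
  then show ?thesis using E(3) by blast
qed

section \<open>Remainder estimates\<close>

text \<open>When both factors vanish below \<open>K\<close>, every nonzero term of the convolution
  has both indices at least \<open>K\<close> and gains the binomial coefficient to the power
  \<alpha>. This outweighs the number of terms and the loss from the shift 2h.\<close>

lemma gevrey3_mult_remainder:
  assumes "\<alpha> \<ge> 1" "\<beta> > 0"
  shows "\<exists>K. \<forall>f\<in>gevrey3 \<alpha> \<beta> \<Gamma>. \<forall>g\<in>gevrey3 \<alpha> \<beta> \<Gamma>.
    (\<forall>i<K. fps_nth f i = 0) \<longrightarrow> (\<forall>i<K. fps_nth g i = 0) \<longrightarrow> f * g \<in> gevrey3 \<alpha> \<beta> \<rho>"
proof -
  define h where "h = nat \<lceil>\<Gamma>\<rceil>"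
  \<comment> \<open>Solves the condition of \<open>gevrey3I_choose\<close> with
    \<open>\<epsilon> = \<alpha>\<close>; neither factor enters.\<close>
  define K where "K = nat \<lceil>(1 + real (2 * h) * \<alpha> - \<rho>) / \<alpha>\<rceil>"
  have "(1 + real (2 * h) * \<alpha> - \<rho>) / \<alpha> \<le> real K" unfolding K_def by linarith
  then have K: "1 + real (2 * h) * \<alpha> - real K * \<alpha> \<le> \<rho>"
    using assms(1) by (simp add: field_simps)
  have "f * g \<in> gevrey3 \<alpha> \<beta> \<rho>"
    if fg: "f \<in> gevrey3 \<alpha> \<beta> \<Gamma>" "g \<in> gevrey3 \<alpha> \<beta> \<Gamma>"
      and f0: "\<And>i. i < K \<Longrightarrow> fps_nth f i = 0" and g0: "\<And>i. i < K \<Longrightarrow> fps_nth g i = 0" for f g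
  proof -
    obtain C where C: "C > 0" "\<And>n. cmod (fps_nth f n) \<le> C * fact (n + h) powr \<alpha> * \<beta> ^ n"
      using gevrey3_bound[OF assms fg(1), of h] by (auto simp: h_def)
    obtain D where D: "D > 0" "\<And>n. cmod (fps_nth g n) \<le> D * fact (n + h) powr \<alpha> * \<beta> ^ n"
      using gevrey3_bound[OF assms fg(2), of h] by (auto simp: h_def)
    have "cmod (fps_nth (f * g) n) \<le> 2 * C * D * real n * fact (n + 2 * h) powr \<alpha> /
        real ((n + 2 * h) choose K) powr \<alpha> * \<beta> ^ n" if n: "n \<ge> max 1 K" for n
    proof -
      define X where "X = (fact (n + 2 * h) / real ((n + 2 * h) choose K)) powr \<alpha>"
      have ch: "real ((n + 2 * h) choose K) > 0" using n by (simp add: zero_less_binomial)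
      have "cmod (fps_nth f k * fps_nth g (n - k)) \<le> C * D * X * \<beta> ^ n" if "k \<in> {0..n}" for k
      proof (cases "k < K \<or> n - k < K")
        case True
        then show ?thesis using f0 g0 C D assms by (auto simp: X_def)
      next
        case False
        have eq: "k + h + (n - k + h) = n + 2 * h" using that by auto
        have "real (fact (k + h) * fact (n - k + h) * ((k + h + (n - k + h)) choose K)) \<le> real (fact (k + h + (n - k + h)))"
          using False by (intro of_nat_mono fact_mult_choose_le) auto
        then have le: "fact (k + h) * fact (n - k + h) \<le> (fact (n + 2 * h) / real ((n + 2 * h) choose K))"
          unfolding eq using ch by (simp add: pos_le_divide_eq)
        have "cmod (fps_nth f k * fps_nth g (n - k)) \<le>
            (C * fact (k + h) powr \<alpha> * \<beta> ^ k) * (D * fact (n - k + h) powr \<alpha> * \<beta> ^ (n - k))"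
          unfolding norm_mult using C D assms by (intro mult_mono) auto
        also have "\<dots> = C * D * (fact (k + h) * fact (n - k + h)) powr \<alpha> * (\<beta> ^ k * \<beta> ^ (n - k))"
          by (simp add: powr_mult)
        also have "\<beta> ^ k * \<beta> ^ (n - k) = \<beta> ^ n" using that by (simp flip: power_add)
        also have "C * D * (fact (k + h) * fact (n - k + h)) powr \<alpha> * \<beta> ^ n \<le> C * D * X * \<beta> ^ n"
          unfolding X_def using C D assms le
          by (intro mult_right_mono mult_left_mono powr_mono2) auto
        finally show ?thesis .
      qed
      then have "cmod (fps_nth (f * g) n) \<le> (\<Sum>k\<in>{0..n}. C * D * X * \<beta> ^ n)"
        unfolding fps_mult_nth by (intro order_trans[OF norm_sum] sum_mono) auto
      also have "\<dots> = (real n + 1) * (C * D * X * \<beta> ^ n)" by simp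
      also have "\<dots> \<le> (2 * real n) * (C * D * X * \<beta> ^ n)"
        using n C D assms by (intro mult_right_mono) (auto simp: X_def)
      finally show ?thesis using ch by (simp add: X_def powr_divide mult_ac)
    qed
    then have "eventually (\<lambda>n. cmod (fps_nth (f * g) n) \<le> 2 * C * D * real n * fact (n + 2 * h) powr \<alpha> /
        real ((n + 2 * h) choose K) powr \<alpha> * \<beta> ^ n) sequentially"
      using eventually_ge_at_top[of "max 1 K"] by (rule eventually_mono[rotated])
    then show ?thesis
      using K C D assms by (intro gevrey3I_choose[where \<epsilon> = \<alpha> and g = "2 * h" and K = K and C = "2 * C * D"]) auto
  qed
  then show ?thesis by blast
qed

section \<open>Powers and compositions of normalized series\<close>

text \<open>The binomial theorem, summed up to m instead of k: \<open>v ^ i\<close> has no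
  coefficient at m for i > m. The coefficient is thus a polynomial in k of degree at most m.\<close>

lemma one_plus_power_nth:
  fixes v :: "complex fps"
  assumes "fps_nth v 0 = 0"
  shows "fps_nth ((1 + v) ^ k) m = (\<Sum>i\<le>m. of_nat (k choose i) * fps_nth (v ^ i) m)"
proof -
  have "(1 + v) ^ k = (\<Sum>i\<le>k. of_nat (k choose i) * v ^ i)"
    using binomial_ring[of v 1 k] by (simp add: add.commute)
  then have "fps_nth ((1 + v) ^ k) m = (\<Sum>i\<le>k. of_nat (k choose i) * fps_nth (v ^ i) m)"
    by (simp add: fps_sum_nth fps_mult_of_nat_nth)
  also have "\<dots> = (\<Sum>i\<le>max k m. of_nat (k choose i) * fps_nth (v ^ i) m)"
    by (intro sum.mono_neutral_left) auto
  also have "\<dots> = (\<Sum>i\<le>m. of_nat (k choose i) * fps_nth (v ^ i) m)"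
    using startsby_zero_power_prefix[OF assms] by (intro sum.mono_neutral_right) auto
  finally show ?thesis .
qed

lemma normalized_series_eq:
  fixes f :: "complex fps"
  assumes "fps_nth f 0 = 0"
  shows "f = fps_X * (1 + (fps_shift 1 f - 1))"
  using assms by (intro fps_ext) (auto simp: fps_X_mult_nth)

text \<open>With f = x (1 + v), the coefficient at n is that of (1 + v)^k at n - k. For k = n - j it
  is a polynomial in n of degree at most j that involves v only up to index j.\<close>

lemma normalized_power_nth:
  fixes f :: "complex fps"
  assumes "fps_nth f 0 = 0" "fps_nth f 1 = 1"
  shows "fps_nth (f ^ k) n = (if k \<le> n then
    (\<Sum>i\<le>n - k. of_nat (k choose i) * fps_nth ((fps_shift 1 f - 1) ^ i) (n - k)) else 0)"
proof -
  have "f ^ k = fps_X ^ k * (1 + (fps_shift 1 f - 1)) ^ k"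
    using normalized_series_eq[OF assms(1)] by (metis power_mult_distrib)
  then have "fps_nth (f ^ k) n = (if k \<le> n then fps_nth ((1 + (fps_shift 1 f - 1)) ^ k) (n - k) else 0)"
    by (simp add: fps_X_power_mult_nth)
  then show ?thesis using assms by (subst (asm) one_plus_power_nth) auto
qed

text \<open>The terms of \<open>g oo f\<close> whose outer index is n - j with j < K; the expression
  is linear in g. The test \<open>j \<le> n\<close> keeps truncated subtraction from counting outer
  index 0 repeatedly.\<close>

definition comp_top :: "nat \<Rightarrow> complex fps \<Rightarrow> complex fps \<Rightarrow> complex fps" where
  "comp_top K f g = Abs_fps (\<lambda>n. \<Sum>j<K. if j \<le> n then fps_nth g (n - j) * fps_nth (f ^ (n - j)) n else 0)"

lemma compose_minus_comp_top_nth: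
  assumes "K > 0" "K \<le> n"
  shows "fps_nth ((g oo f) - comp_top K f g) n = (\<Sum>k=0..n - K. fps_nth g k * fps_nth (f ^ k) n)"
proof -
  have "{0..n} = {0..n - K} \<union> {n - K<..n}" by auto
  then have "fps_nth (g oo f) n = (\<Sum>k\<in>{0..n - K} \<union> {n - K<..n}. fps_nth g k * fps_nth (f ^ k) n)"
    by (simp add: fps_compose_nth)
  also have "\<dots> = (\<Sum>k=0..n - K. fps_nth g k * fps_nth (f ^ k) n) + (\<Sum>k\<in>{n - K<..n}. fps_nth g k * fps_nth (f ^ k) n)"
    by (intro sum.union_disjoint) auto
  also have "(\<Sum>k\<in>{n - K<..n}. fps_nth g k * fps_nth (f ^ k) n) =
      (\<Sum>j<K. if j \<le> n then fps_nth g (n - j) * fps_nth (f ^ (n - j)) n else 0)"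
    using assms by (intro sum.reindex_bij_witness[where i = "\<lambda>j. n - j" and j = "\<lambda>k. n - k"]) auto
  finally show "fps_nth ((g oo f) - comp_top K f g) n = (\<Sum>k=0..n - K. fps_nth g k * fps_nth (f ^ k) n)"
    unfolding fps_sub_nth comp_top_def fps_nth_Abs_fps by (simp only: add_diff_cancel_right')
qed

text \<open>The power \<alpha> of \<open>fact a * fact b\<close> is split into 1 and \<alpha> - 1.
  The first part absorbs \<open>k choose i\<close>, the second part gains the binomial coefficient.
  The shift is such that a + b + i = N.\<close>

lemma composition_term_bound:
  fixes k i g n K :: nat and \<alpha> :: real
  assumes "\<alpha> \<ge> 1" "K \<le> k" "k + K \<le> n" "i \<le> n - k"
  defines "N \<equiv> n + (1 + 2 * g)"
  shows "real (k choose i) * fact (n - k - i + 1 + g) powr \<alpha> * fact (k + g) powr \<alpha> \<le>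
    fact N powr \<alpha> / real (N choose K) powr (\<alpha> - 1) / fact i"
proof -
  define a b where "a = k + g" and "b = n - k - i + 1 + g"
  have N: "a + (b + i) = N" "a + i + b = N" using assms by (auto simp: N_def a_def b_def)
  have ch: "real (N choose K) > 0" using assms by (simp add: zero_less_binomial)
  \<comment> \<open>Both \<open>a\<close> and \<open>b + i\<close> are at least \<open>K\<close>, so
    raising \<open>b\<close> to \<open>b + i\<close> makes the gain available.\<close>
  have "real (fact a * fact b * (N choose K)) \<le> real (fact a * fact (b + i) * ((a + (b + i)) choose K))"
    unfolding N by (intro of_nat_mono mult_mono fact_mono_nat) auto
  also have "\<dots> \<le> real (fact (a + (b + i)))"
    using assms by (intro of_nat_mono fact_mult_choose_le) (auto simp: a_def b_def)
  finally have "fact a * fact b \<le> fact N / real (N choose K)"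
    using ch by (simp add: N field_simps)
  then have 1: "(fact a * fact b) powr (\<alpha> - 1) \<le> (fact N / real (N choose K)) powr (\<alpha> - 1)"
    using assms(1) by (intro powr_mono2) auto
  \<comment> \<open>At most k^i, which raises \<open>fact a\<close> to at most
    \<open>fact (a + i)\<close>. The extra \<open>fact i\<close> becomes the denominator that makes
    the sum over i an exponential series.\<close>
  have "(k choose i) * fact i \<le> k ^ i"
    using binomial_fact_pow by (simp add: mult.commute)
  also have "k ^ i \<le> (a + 1) ^ i" by (intro power_mono) (auto simp: a_def)
  finally have "(k choose i) * fact i * fact a \<le> (a + 1) ^ i * fact a" by (rule mult_right_mono) auto
  also have "\<dots> \<le> fact (a + i)" using fact_mult_power_le[of a i] by (simp add: mult.commute)
  finally have "(k choose i) * fact i * fact a * fact b \<le> fact (a + i) * fact b" by (rule mult_right_mono) auto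
  also have "\<dots> \<le> fact 0 * fact N" by (intro fact_mult_fact_le) (auto simp: N)
  finally have "real ((k choose i) * fact i * fact a * fact b) \<le> real (fact N)"
    by (intro of_nat_mono) simp
  then have 2: "real (k choose i) * (fact a * fact b) \<le> fact N / fact i"
    by (simp add: field_simps)
  have split: "x powr \<alpha> = x * x powr (\<alpha> - 1)" if "x \<ge> 0" for x :: real
    using that powr_add[of x 1 "\<alpha> - 1"] by simp
  have "real (k choose i) * fact b powr \<alpha> * fact a powr \<alpha> =
      real (k choose i) * (fact a * fact b) * (fact a * fact b) powr (\<alpha> - 1)"
    using split[of "fact a * fact b"] by (simp add: powr_mult mult_ac)
  also have "\<dots> \<le> fact N / fact i * (fact N / real (N choose K)) powr (\<alpha> - 1)"
    using 1 2 by (intro mult_mono) auto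
  also have "\<dots> = fact N powr \<alpha> / real (N choose K) powr (\<alpha> - 1) / fact i"
    using split[of "fact N"] by (simp add: powr_divide)
  finally show ?thesis by (simp add: a_def b_def)
qed

text \<open>Outside \<open>comp_top\<close>, and for vanishing initial coefficients of g, both k and
  n - k are at least \<open>K\<close>, so \<open>composition_term_bound\<close> applies to each term
  of f^k expanded in powers of v. The sum over i is at most \<open>exp E\<close>, the sum over k
  costs a factor 2n.\<close>

lemma gevrey3_compose_remainder:
  assumes "\<alpha> > 1" "\<beta> > 0"
  shows "\<exists>K>0. \<forall>f\<in>gevrey3 \<alpha> \<beta> \<Gamma>. \<forall>g\<in>gevrey3 \<alpha> \<beta> \<Gamma>.
    fps_nth f 0 = 0 \<longrightarrow> fps_nth f 1 = 1 \<longrightarrow> (\<forall>i<K. fps_nth g i = 0) \<longrightarrow>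
    (g oo f) - comp_top K f g \<in> gevrey3 \<alpha> \<beta> \<rho>"
proof -
  define h where "h = nat \<lceil>\<Gamma>\<rceil>"
  \<comment> \<open>The coefficient of v at m is that of f at m + 1, which raises the shift by one.
    \<open>L\<close> is the shift of \<open>composition_term_bound\<close>, and \<open>K\<close>
    solves the condition of \<open>gevrey3I_choose\<close> with
    \<open>\<epsilon> = \<alpha> - 1\<close>; \<open>Suc\<close> makes it positive.\<close>
  define H where "H = h + 1"
  define L where "L = 1 + 2 * H"
  define K where "K = Suc (nat \<lceil>(1 + real L * \<alpha> - \<rho>) / (\<alpha> - 1)\<rceil>)"
  have "(1 + real L * \<alpha> - \<rho>) / (\<alpha> - 1) \<le> real K" unfolding K_def by linarith
  then have K: "1 + real L * \<alpha> - real K * (\<alpha> - 1) \<le> \<rho>"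
    using assms(1) by (simp add: field_simps)
  have \<alpha>: "\<alpha> \<ge> 1" using assms by simp
  have "(g oo f) - comp_top K f g \<in> gevrey3 \<alpha> \<beta> \<rho>"
    if fg: "f \<in> gevrey3 \<alpha> \<beta> \<Gamma>" "g \<in> gevrey3 \<alpha> \<beta> \<Gamma>" and f: "fps_nth f 0 = 0" "fps_nth f 1 = 1"
      and g0: "\<And>i. i < K \<Longrightarrow> fps_nth g i = 0" for f g
  proof -
    obtain C where C: "C > 0" "\<And>n. cmod (fps_nth f n) \<le> C * fact (n + h) powr \<alpha> * \<beta> ^ n"
      using gevrey3_bound[OF \<alpha> assms(2) fg(1), of h] by (auto simp: h_def)
    obtain D where D: "D > 0" "\<And>n. cmod (fps_nth g n) \<le> D * fact (n + H) powr \<alpha> * \<beta> ^ n"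
    proof -
      have "nat \<lceil>\<Gamma>\<rceil> \<le> H" unfolding H_def h_def by (rule le_add1)
      from gevrey3_bound[OF \<alpha> assms(2) fg(2) this]
      obtain D where "D > 0" "\<forall>n. cmod (fps_nth g n) \<le> D * fact (n + H) powr \<alpha> * \<beta> ^ n" by blast
      then show ?thesis by (intro that[of D]) auto
    qed
    define v where "v = fps_shift 1 f - 1"
    have v0: "fps_nth v 0 = 0" using f by (simp add: v_def)
    have "cmod (fps_nth v m) \<le> (C * \<beta>) * fact (m + H) powr \<alpha> * \<beta> ^ m" if "m > 0" for m
      using C(2)[of "Suc m"] that by (simp add: v_def H_def mult_ac)
    then obtain E where E: "E > 0" "\<And>i m. 0 < i \<Longrightarrow> i \<le> m \<Longrightarrow>
        cmod (fps_nth (v ^ i) m) \<le> E ^ i * fact (m - i + 1 + H) powr \<alpha> * \<beta> ^ m"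
      using fps_power_coeff_bound[OF \<alpha> assms(2) _ v0, of "C * \<beta>" H] C assms by auto
    have "cmod (fps_nth ((g oo f) - comp_top K f g) n) \<le> 2 * D * exp E * real n * fact (n + L) powr \<alpha> /
        real ((n + L) choose K) powr (\<alpha> - 1) * \<beta> ^ n" if n: "n \<ge> K" for n
    proof -
      define X where "X = fact (n + L) powr \<alpha> / real ((n + L) choose K) powr (\<alpha> - 1)"
      have "cmod (fps_nth g k * fps_nth (f ^ k) n) \<le> D * X * \<beta> ^ n * exp E" if k: "k \<in> {0..n - K}" for k
      proof (cases "k < K")
        case True
        then show ?thesis using g0 D assms by (auto simp: X_def)
      next
        case False
        \<comment> \<open>The bound on powers of v starts at i = 1; for i = 0 the term vanishes
          because the series 1 has no coefficient at n - k > 0.\<close>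
        have m: "n - k > 0" using k n by (auto simp: K_def)
        have "cmod (of_nat (k choose i) * fps_nth (v ^ i) (n - k)) * (D * fact (k + H) powr \<alpha> * \<beta> ^ k)
            \<le> D * X * \<beta> ^ n * (E ^ i / fact i)" if i: "i \<le> n - k" for i
        proof (cases "i = 0")
          case True
          then show ?thesis using m D assms by (simp add: X_def)
        next
          case i0: False
          have "cmod (of_nat (k choose i) * fps_nth (v ^ i) (n - k)) * (D * fact (k + H) powr \<alpha> * \<beta> ^ k) \<le>
              real (k choose i) * (E ^ i * fact (n - k - i + 1 + H) powr \<alpha> * \<beta> ^ (n - k)) * (D * fact (k + H) powr \<alpha> * \<beta> ^ k)"
            unfolding norm_mult norm_of_nat using i i0 D(1) assms E(2)[of i "n - k"]
            by (intro mult_right_mono mult_left_mono) auto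
          also have "\<dots> = D * E ^ i * (\<beta> ^ (n - k) * \<beta> ^ k) *
              (real (k choose i) * fact (n - k - i + 1 + H) powr \<alpha> * fact (k + H) powr \<alpha>)"
            by (simp only: mult_ac)
          also have "\<beta> ^ (n - k) * \<beta> ^ k = \<beta> ^ n" using k by (simp flip: power_add)
          also have "D * E ^ i * \<beta> ^ n * (real (k choose i) * fact (n - k - i + 1 + H) powr \<alpha> * fact (k + H) powr \<alpha>)
              \<le> D * E ^ i * \<beta> ^ n * (X / fact i)"
            unfolding X_def L_def using i k n False D E assms
            by (intro mult_left_mono composition_term_bound) auto
          finally show ?thesis by (simp add: mult_ac)
        qed
        then have "(\<Sum>i\<le>n - k. cmod (of_nat (k choose i) * fps_nth (v ^ i) (n - k)) * (D * fact (k + H) powr \<alpha> * \<beta> ^ k))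
            \<le> (\<Sum>i\<le>n - k. D * X * \<beta> ^ n * (E ^ i / fact i))" by (intro sum_mono) auto
        also have "\<dots> = D * X * \<beta> ^ n * (\<Sum>i\<le>n - k. E ^ i / fact i)" by (simp add: sum_distrib_left)
        also have "\<dots> \<le> D * X * \<beta> ^ n * exp E"
          using D E assms by (intro mult_left_mono sum_exp_terms_le) (auto simp: X_def)
        finally have le: "(\<Sum>i\<le>n - k. cmod (of_nat (k choose i) * fps_nth (v ^ i) (n - k))) * (D * fact (k + H) powr \<alpha> * \<beta> ^ k)
            \<le> D * X * \<beta> ^ n * exp E" by (simp add: sum_distrib_right)
        have "fps_nth (f ^ k) n = (\<Sum>i\<le>n - k. of_nat (k choose i) * fps_nth (v ^ i) (n - k))"
          using normalized_power_nth[OF f, of k n] k by (simp add: v_def)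
        then have "cmod (fps_nth (f ^ k) n) \<le> (\<Sum>i\<le>n - k. cmod (of_nat (k choose i) * fps_nth (v ^ i) (n - k)))"
          by (simp only: norm_sum)
        then have "cmod (fps_nth g k * fps_nth (f ^ k) n) \<le> (D * fact (k + H) powr \<alpha> * \<beta> ^ k) *
            (\<Sum>i\<le>n - k. cmod (of_nat (k choose i) * fps_nth (v ^ i) (n - k)))"
          unfolding norm_mult using D assms by (intro mult_mono) auto
        then show ?thesis using le by (simp add: mult.commute)
      qed
      then have "(\<Sum>k=0..n - K. cmod (fps_nth g k * fps_nth (f ^ k) n)) \<le> (\<Sum>k=0..n - K. D * X * \<beta> ^ n * exp E)"
        by (intro sum_mono) auto
      also have "\<dots> = (real (n - K) + 1) * (D * X * \<beta> ^ n * exp E)" by simp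
      also have "\<dots> \<le> (2 * real n) * (D * X * \<beta> ^ n * exp E)"
        using n D assms by (intro mult_right_mono) (auto simp: X_def K_def)
      finally have le: "(\<Sum>k=0..n - K. cmod (fps_nth g k * fps_nth (f ^ k) n)) \<le> (2 * real n) * (D * X * \<beta> ^ n * exp E)" .
      have "fps_nth ((g oo f) - comp_top K f g) n = (\<Sum>k=0..n - K. fps_nth g k * fps_nth (f ^ k) n)"
        using n by (intro compose_minus_comp_top_nth) (auto simp: K_def)
      then have "cmod (fps_nth ((g oo f) - comp_top K f g) n) \<le> (\<Sum>k=0..n - K. cmod (fps_nth g k * fps_nth (f ^ k) n))"
        by (simp only: norm_sum)
      with le show ?thesis by (simp add: X_def mult_ac)
    qed
    then have "eventually (\<lambda>n. cmod (fps_nth ((g oo f) - comp_top K f g) n) \<le>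
        (2 * D * exp E) * real n * fact (n + L) powr \<alpha> / real ((n + L) choose K) powr (\<alpha> - 1) * \<beta> ^ n) sequentially"
      using eventually_ge_at_top[of K] by (rule eventually_mono[rotated])
    then show ?thesis
      using D assms by (intro gevrey3I_choose[OF \<alpha> assms(2) _ _ K, where C = "2 * D * exp E"]) auto
  qed
  note * = this
  show ?thesis
  proof (intro exI[of _ K] conjI ballI impI)
    show "K > 0" by (simp add: K_def)
    fix f g
    assume "f \<in> gevrey3 \<alpha> \<beta> \<Gamma>" "g \<in> gevrey3 \<alpha> \<beta> \<Gamma>" "fps_nth f 0 = 0" "fps_nth f 1 = 1"
      and "\<forall>i<K. fps_nth g i = 0"
    then show "(g oo f) - comp_top K f g \<in> gevrey3 \<alpha> \<beta> \<rho>" by (intro *) simp_all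
  qed
qed


section \<open>Lagrange inversion and the growth of the functional inverse\<close>

text \<open>Because \<open>f ^ k\<close> starts at index k, all inner sums can be extended to k <=
  m; then the order of summation is exchanged.\<close>

lemma mult_compose_nth:
  fixes A g f :: "complex fps"
  assumes "fps_nth f 0 = 0"
  shows "fps_nth (A * (g oo f)) m = (\<Sum>k\<le>m. fps_nth g k * fps_nth (A * f ^ k) m)"
proof -
  have low: "fps_nth (f ^ k) i = 0" if "i < k" for i k
    using startsby_zero_power_prefix[OF assms] that by blast
  have "fps_nth (A * (g oo f)) m = (\<Sum>i=0..m. fps_nth A i * (\<Sum>k\<le>m. fps_nth g k * fps_nth (f ^ k) (m - i)))"
    unfolding fps_mult_nth fps_compose_nth
    by (intro sum.cong refl arg_cong2[where f = "(*)"] sum.mono_neutral_left) (auto simp: low)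
  also have "\<dots> = (\<Sum>k\<le>m. \<Sum>i=0..m. fps_nth A i * (fps_nth g k * fps_nth (f ^ k) (m - i)))"
    by (simp only: sum_distrib_left) (rule sum.swap)
  also have "\<dots> = (\<Sum>k\<le>m. fps_nth g k * fps_nth (A * f ^ k) m)"
    by (simp add: fps_mult_nth sum_distrib_left mult_ac)
  finally show ?thesis .
qed

text \<open>Multiplying (y' oo f) f' = 1 by u^(-n) and comparing coefficients at n - 1 leaves the
  following to show: for m = n - 1 - k, the coefficient of u^(-m-1) f' at m is 1 if m = 0 and 0
  otherwise. It is the residue of f^(-m-1) f', which is a derivative for m > 0.\<close>

lemma fps_lagrange_inversion:
  fixes u :: "complex fps"
  assumes u0: "fps_nth u 0 = 1" and n: "n > 0"
  shows "of_nat n * fps_nth (fps_inv (fps_X * u)) n = fps_nth (inverse (u ^ n)) (n - 1)"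
proof -
  define f where "f = fps_X * u"
  define y where "y = fps_inv f"
  define U where "U = inverse u"
  have f0: "fps_nth f 0 = 0" and f1: "fps_nth f 1 = 1" by (simp_all add: f_def u0 fps_X_mult_nth)
  have uU: "u * U = 1" unfolding U_def using u0 by (intro inverse_mult_eq_1') simp
  have "y oo f = fps_X" unfolding y_def using f0 f1 by (intro fps_inv) auto
  then have "fps_deriv (y oo f) = 1" by simp
  then have deriv: "(fps_deriv y oo f) * fps_deriv f = 1"
    by (simp only: fps_compose_deriv[OF f0])
  have derivf: "fps_deriv f = u + fps_X * fps_deriv u" by (simp add: f_def add.commute)
  have derivU: "fps_deriv U = - fps_deriv u * U ^ 2"
    unfolding U_def using u0 by (intro fps_inverse_deriv) simp
  define A where "A = U ^ n * fps_deriv f"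
  have "U ^ n = A * (fps_deriv y oo f)" unfolding A_def using deriv by (simp add: mult_ac)
  then have "fps_nth (U ^ n) (n - 1) = (\<Sum>k\<le>n - 1. fps_nth (fps_deriv y) k * fps_nth (A * f ^ k) (n - 1))"
    by (simp add: mult_compose_nth[OF f0])
  also have "\<dots> = (\<Sum>k\<le>n - 1. if k = n - 1 then fps_nth (fps_deriv y) k else 0)"
  proof (intro sum.cong refl)
    fix k assume k: "k \<in> {..n - 1}"
    define m where "m = n - 1 - k"
    have nm: "n = Suc (m + k)" using k n by (auto simp: m_def)
    have "U ^ n * u ^ k = U ^ Suc m * (u * U) ^ k" by (simp add: nm power_add power_mult_distrib mult_ac)
    then have Uu: "U ^ n * u ^ k = U ^ Suc m" by (simp add: uU)
    have "A * f ^ k = fps_X ^ k * (U ^ n * u ^ k * fps_deriv f)"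
      by (simp add: A_def f_def power_mult_distrib mult_ac)
    also have "\<dots> = fps_X ^ k * (U ^ Suc m * fps_deriv f)" by (simp only: Uu)
    finally have "fps_nth (A * f ^ k) (n - 1) = fps_nth (U ^ Suc m * fps_deriv f) m"
      using k by (simp only: fps_X_power_mult_nth) (auto simp: m_def)
    \<comment> \<open>Since (U^m)' = - m U^(m+1) u', the second summand is - (x/m) (U^m)' for m > 0,
      and its coefficient at m cancels that of \<open>U ^ m\<close>.\<close>
    also have "U ^ Suc m * fps_deriv f = U ^ m * (u * U) + fps_X * (U ^ Suc m * fps_deriv u)"
      by (simp add: derivf algebra_simps)
    also have "fps_nth \<dots> m = (if m = 0 then 1 else 0)"
    proof (cases "m = 0")
      case True then show ?thesis by (simp add: uU)
    next
      case False
      have "fps_deriv (U ^ m) = - (of_nat m * (U ^ Suc m * fps_deriv u))"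
      proof -
        obtain l where l: "m = Suc l" using False by (cases m) auto
        show ?thesis
          unfolding l fps_deriv_power' derivU diff_Suc_1 by (simp only: power_Suc power2_eq_square mult_ac mult_minus_left mult_minus_right)
      qed
      then have "fps_nth (fps_deriv (U ^ m)) (m - 1) = - (of_nat m * fps_nth (U ^ Suc m * fps_deriv u) (m - 1))"
        by (simp add: fps_mult_of_nat_nth)
      then have "of_nat m * fps_nth (U ^ m) m = - (of_nat m * fps_nth (U ^ Suc m * fps_deriv u) (m - 1))"
        using False by simp
      then have "fps_nth (U ^ m) m = - fps_nth (U ^ Suc m * fps_deriv u) (m - 1)"
        using False by (metis mult_minus_right mult_left_cancel of_nat_eq_0_iff)
      then show ?thesis using False by (simp add: uU fps_X_mult_nth)
    qed
    finally show "fps_nth (fps_deriv y) k * fps_nth (A * f ^ k) (n - 1) =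
        (if k = n - 1 then fps_nth (fps_deriv y) k else 0)" using k by (auto simp: m_def)
  qed
  also have "\<dots> = of_nat n * fps_nth y n" using n by simp
  finally show ?thesis by (simp add: y_def f_def U_def fps_inverse_power)
qed

lemma norm_neg_gbinomial_le:
  assumes "i \<le> n"
  shows "cmod ((- of_nat n) gchoose i) \<le> (2 * real n) ^ i / fact i"
proof -
  have "cmod (\<Prod>l=0..<i. - of_nat n - of_nat l) \<le> (\<Prod>l=0..<i. 2 * real n)"
  proof (subst prod_norm[symmetric], intro prod_mono conjI)
    fix l assume "l \<in> {0..<i}"
    have "cmod (- of_nat n - of_nat l) = cmod (of_nat (n + l))"
      by (metis minus_add_distrib norm_minus_cancel of_nat_add uminus_add_conv_diff add.commute diff_conv_add_uminus)
    also have "\<dots> = real (n + l)" by (rule norm_of_nat)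
    finally show "cmod (- of_nat n - of_nat l) \<le> 2 * real n" using \<open>l \<in> _\<close> assms by auto
  qed auto
  then show ?thesis by (simp add: gbinomial_prod_rev norm_divide divide_right_mono)
qed

text \<open>Lagrange inversion expands the coefficient at n in terms (-n choose i) times the
  coefficient of v^i at n - 1. The first is at most (2n)^i / i!, and (n-i+g)!, coming from the
  second, absorbs n^i at the cost e^i. The exponent of n is not preserved, hence only membership in
  \<open>gevrey2\<close>. Allowing every \<alpha> >= 1 lets the lemma be applied below the given
  \<alpha> too.\<close>

lemma gevrey2_inverse:
  assumes "\<alpha> \<ge> 1" "\<beta> > 0" "f \<in> gevrey2 \<alpha> \<beta>" and f: "fps_nth f 0 = 0" "fps_nth f 1 = 1"
  shows "fps_inv f \<in> gevrey2 \<alpha> \<beta>"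
proof -
  obtain \<Gamma> where \<Gamma>: "f \<in> gevrey3 \<alpha> \<beta> \<Gamma>" using assms by (auto simp: gevrey2_def)
  define h where "h = nat \<lceil>\<Gamma>\<rceil>"
  define g where "g = h + 1"
  obtain C where C: "C > 0" "\<And>n. cmod (fps_nth f n) \<le> C * fact (n + h) powr \<alpha> * \<beta> ^ n"
    using gevrey3_bound[OF assms(1,2) \<Gamma>, of h] by (auto simp: h_def)
  define v where "v = fps_shift 1 f - 1"
  have v0: "fps_nth v 0 = 0" using f by (simp add: v_def)
  have "cmod (fps_nth v m) \<le> (C * \<beta>) * fact (m + g) powr \<alpha> * \<beta> ^ m" if "m > 0" for m
    using C(2)[of "Suc m"] that by (simp add: v_def g_def mult_ac)
  then obtain E where E: "E > 0" "\<And>i m. 0 < i \<Longrightarrow> i \<le> m \<Longrightarrow>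
      cmod (fps_nth (v ^ i) m) \<le> E ^ i * fact (m - i + 1 + g) powr \<alpha> * \<beta> ^ m"
    using fps_power_coeff_bound[OF assms(1,2) _ v0, of "C * \<beta>" g] C assms by auto
  \<comment> \<open>\<open>c\<close> remains when (n-i+g)^g is bounded by ((n+1)(g+1))^g. In
    \<open>B\<close>, the factor 2 comes from the generalized binomial coefficient,
    \<open>exp 1\<close> from absorbing n^i, and \<open>E\<close> from the powers of v.\<close>
  define c where "c = real ((g + 1) ^ g)"
  define B where "B = c * exp (2 * exp 1 * E)"
  have "cmod (fps_nth (fps_inv f) n) \<le> (B / \<beta>) * real n * fact (n + g) powr \<alpha> * \<beta> ^ n" if n: "n > 1" for n
  proof -
    define m where "m = n - 1"
    have m: "m > 0" "n = Suc m" using n by (auto simp: m_def)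
    have "inverse ((1 + v) ^ n) = inverse ((1 + fps_X) ^ n) oo v"
    proof -
      have "inverse ((1 + fps_X) ^ n) oo v = inverse ((1 + fps_X) ^ n oo v)"
        using v0 by (intro fps_inverse_compose) auto
      also have "(1 + fps_X) ^ n oo v = ((1 + fps_X) oo v) ^ n"
        using v0 by (rule fps_compose_power[symmetric])
      also have "(1 + fps_X) oo v = 1 + v"
        using v0 by (simp add: fps_compose_add_distrib)
      finally show ?thesis ..
    qed
    then have inv: "inverse ((1 + v) ^ n) = fps_binomial (- of_nat n) oo v"
      by (simp add: fps_binomial_minus_of_nat)
    have summand: "cmod ((- of_nat n gchoose i) * fps_nth (v ^ i) m) \<le>
        (c * fact (n + g) powr \<alpha> * \<beta> ^ m) * ((2 * exp 1 * E) ^ i / fact i)" if i: "i \<in> {0..m}" for i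
    proof (cases "i = 0")
      case True
      then show ?thesis using m assms by (simp add: c_def)
    next
      case False
      have mi: "m - i + 1 + g = n - i + g" using i m by simp
      have split: "x powr \<alpha> = x * x powr (\<alpha> - 1)" if "x \<ge> 0" for x :: real
        using that powr_add[of x 1 "\<alpha> - 1"] by simp
      have "real (fact (n - i + g)) \<le> real (fact (n - i) * (n - i + g) ^ g)"
        by (intro of_nat_mono fact_add_le)
      also have "\<dots> \<le> real (fact (n - i) * ((n + 1) * (g + 1)) ^ g)"
        by (intro of_nat_mono mult_left_mono power_mono) auto
      finally have "fact (n - i + g) \<le> fact (n - i) * (real (n + 1) ^ g * c)"
        by (simp only: c_def of_nat_mult of_nat_power power_mult_distrib of_nat_fact)
      then have "real n ^ i * fact (n - i + g) \<le> (real n ^ i * fact (n - i)) * (real (n + 1) ^ g * c)"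
        by (simp add: mult.assoc mult_left_mono)
      also have "\<dots> \<le> (exp 1 ^ i * fact n) * (real (n + 1) ^ g * c)"
        using i m power_mult_fact_diff_le[of i n] by (intro mult_right_mono) (auto simp: c_def)
      also have "\<dots> = exp 1 ^ i * c * real (fact n * (n + 1) ^ g)" by simp
      also have "\<dots> \<le> exp 1 ^ i * c * real (fact (n + g))"
        by (intro mult_left_mono of_nat_mono fact_mult_power_le) (auto simp: c_def)
      finally have 1: "real n ^ i * fact (n - i + g) \<le> exp 1 ^ i * c * fact (n + g)" by simp
      have "real n ^ i * fact (n - i + g) powr \<alpha> = real n ^ i * fact (n - i + g) * fact (n - i + g) powr (\<alpha> - 1)"
        by (subst split) auto
      also have "\<dots> \<le> (exp 1 ^ i * c * fact (n + g)) * fact (n + g) powr (\<alpha> - 1)"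
        by (rule mult_mono[OF 1 powr_mono2]) (use assms(1) in \<open>auto simp: c_def intro: fact_mono\<close>)
      also have "\<dots> = exp 1 ^ i * c * fact (n + g) powr \<alpha>"
        using split[of "fact (n + g)"] by simp
      finally have 2: "real n ^ i * fact (n - i + g) powr \<alpha> \<le> exp 1 ^ i * c * fact (n + g) powr \<alpha>" .
      have "cmod ((- of_nat n gchoose i) * fps_nth (v ^ i) m) \<le>
          ((2 * real n) ^ i / fact i) * (E ^ i * fact (n - i + g) powr \<alpha> * \<beta> ^ m)"
        unfolding norm_mult
      proof (rule mult_mono)
        show "cmod (fps_nth (v ^ i) m) \<le> E ^ i * fact (n - i + g) powr \<alpha> * \<beta> ^ m"
          using E(2)[of i m] False i unfolding mi by auto
        show "cmod (- of_nat n gchoose i) \<le> (2 * real n) ^ i / fact i"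
          using i m by (intro norm_neg_gbinomial_le) auto
      qed auto
      also have "\<dots> = (real n ^ i * fact (n - i + g) powr \<alpha>) * (\<beta> ^ m * (2 * E) ^ i / fact i)"
        by (simp add: power_mult_distrib)
      also have "\<dots> \<le> (exp 1 ^ i * c * fact (n + g) powr \<alpha>) * (\<beta> ^ m * (2 * E) ^ i / fact i)"
        using 2 E(1) assms(2) by (intro mult_right_mono) auto
      finally show ?thesis by (simp add: power_mult_distrib mult_ac)
    qed
    have "f = fps_X * (1 + v)" unfolding v_def by (rule normalized_series_eq[OF f(1)])
    then have "of_nat n * fps_nth (fps_inv f) n = fps_nth (inverse ((1 + v) ^ n)) m"
      using fps_lagrange_inversion[of "1 + v" n] v0 n by (simp add: m_def)
    then have "real n * cmod (fps_nth (fps_inv f) n) = cmod (fps_nth (inverse ((1 + v) ^ n)) m)"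
      by (metis norm_mult norm_of_nat)
    also have "\<dots> = cmod (\<Sum>i=0..m. (- of_nat n gchoose i) * fps_nth (v ^ i) m)"
      by (simp add: inv fps_compose_nth)
    also have "\<dots> \<le> (\<Sum>i=0..m. (c * fact (n + g) powr \<alpha> * \<beta> ^ m) * ((2 * exp 1 * E) ^ i / fact i))"
      using summand by (intro order_trans[OF norm_sum] sum_mono)
    also have "\<dots> = (c * fact (n + g) powr \<alpha> * \<beta> ^ m) * (\<Sum>i=0..m. (2 * exp 1 * E) ^ i / fact i)"
      by (simp add: sum_distrib_left)
    also have "\<dots> \<le> (c * fact (n + g) powr \<alpha> * \<beta> ^ m) * exp (2 * exp 1 * E)"
      using E assms by (intro mult_left_mono sum_exp_terms_le) (auto simp: c_def)
    also have "\<dots> = (B / \<beta>) * fact (n + g) powr \<alpha> * \<beta> ^ n" using assms(2) by (simp add: B_def m)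
    finally have le: "real n * cmod (fps_nth (fps_inv f) n) \<le> (B / \<beta>) * fact (n + g) powr \<alpha> * \<beta> ^ n" .
    \<comment> \<open>A factor n is discarded on the left and inserted on the right, to fit
      \<open>gevrey2I_bound\<close>.\<close>
    have "1 * cmod (fps_nth (fps_inv f) n) \<le> real n * cmod (fps_nth (fps_inv f) n)"
      using n by (intro mult_right_mono) auto
    also note le
    also have "1 * ((B / \<beta>) * fact (n + g) powr \<alpha> * \<beta> ^ n) \<le> real n * ((B / \<beta>) * fact (n + g) powr \<alpha> * \<beta> ^ n)"
      using n assms(2) by (intro mult_right_mono) (auto simp: B_def c_def)
    finally show ?thesis by (simp add: mult_ac)
  qed
  then have "eventually (\<lambda>n. cmod (fps_nth (fps_inv f) n) \<le> (B / \<beta>) * real n * fact (n + g) powr \<alpha> * \<beta> ^ n) sequentially"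
    by (intro eventually_mono[OF eventually_gt_at_top[of 1]])
  then show ?thesis
    using assms(1,2) by (intro gevrey2I_bound[where C = "B / \<beta>"]) (auto simp: B_def c_def)
qed

section \<open>Inclusions between the Gevrey classes\<close>

lemma gevrey3_mono:
  assumes "\<beta> > 0" "\<gamma> \<le> \<gamma>'"
  shows "gevrey3 \<alpha> \<beta> \<gamma> \<subseteq> gevrey3 \<alpha> \<beta> \<gamma>'"
proof
  fix f assume "f \<in> gevrey3 \<alpha> \<beta> \<gamma>"
  then obtain C where C: "C > 0" "\<And>n. n > 0 \<Longrightarrow> cmod (fps_nth f n) \<le> C * gevrey_scale \<alpha> \<beta> \<gamma> n"
    using gevrey3_iff[OF assms(1)] by metis
  have "cmod (fps_nth f n) \<le> C * gevrey_scale \<alpha> \<beta> \<gamma>' n" if "n > 0" for n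
  proof -
    have "gevrey_scale \<alpha> \<beta> \<gamma> n \<le> gevrey_scale \<alpha> \<beta> \<gamma>' n"
      unfolding gevrey_scale_def using that assms by (intro mult_left_mono powr_mono) auto
    then show ?thesis using C(2)[OF that] C(1) by (meson mult_left_mono less_imp_le order_trans)
  qed
  then show "f \<in> gevrey3 \<alpha> \<beta> \<gamma>'" using gevrey3_iff[OF assms(1)] C(1) by blast
qed

lemma gevrey2_common:
  assumes "\<beta> > 0" "f \<in> gevrey2 \<alpha> \<beta>" "g \<in> gevrey2 \<alpha> \<beta>"
  obtains \<Gamma> where "f \<in> gevrey3 \<alpha> \<beta> \<Gamma>" "g \<in> gevrey3 \<alpha> \<beta> \<Gamma>"
proof -
  obtain \<gamma>1 \<gamma>2 where "f \<in> gevrey3 \<alpha> \<beta> \<gamma>1" "g \<in> gevrey3 \<alpha> \<beta> \<gamma>2"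
    using assms by (auto simp: gevrey2_def)
  then show ?thesis
    using gevrey3_mono[OF assms(1), of \<gamma>1 "max \<gamma>1 \<gamma>2" \<alpha>] gevrey3_mono[OF assms(1), of \<gamma>2 "max \<gamma>1 \<gamma>2" \<alpha>]
    by (intro that[of "max \<gamma>1 \<gamma>2"]) auto
qed

lemma gevrey2_mono:
  assumes "\<beta> > 0" "\<beta> \<le> \<beta>'"
  shows "gevrey2 \<alpha> \<beta> \<subseteq> gevrey2 \<alpha> \<beta>'"
proof
  fix f assume "f \<in> gevrey2 \<alpha> \<beta>"
  then obtain \<gamma> where "f \<in> gevrey3 \<alpha> \<beta> \<gamma>" by (auto simp: gevrey2_def)
  then obtain C where C: "C > 0" "\<And>n. n > 0 \<Longrightarrow> cmod (fps_nth f n) \<le> C * gevrey_scale \<alpha> \<beta> \<gamma> n"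
    using gevrey3_iff[OF assms(1)] by metis
  have "cmod (fps_nth f n) \<le> C * gevrey_scale \<alpha> \<beta>' \<gamma> n" if "n > 0" for n
  proof -
    have "gevrey_scale \<alpha> \<beta> \<gamma> n \<le> gevrey_scale \<alpha> \<beta>' \<gamma> n"
      unfolding gevrey_scale_def using that assms by (intro mult_right_mono mult_left_mono power_mono) auto
    then show ?thesis using C(2)[OF that] C(1) by (meson mult_left_mono less_imp_le order_trans)
  qed
  then have "f \<in> gevrey3 \<alpha> \<beta>' \<gamma>" using gevrey3_iff[of \<beta>'] C(1) assms by (meson less_le_trans)
  then show "f \<in> gevrey2 \<alpha> \<beta>'" by (auto simp: gevrey2_def)
qed

text \<open>By n^n <= e^n n!, the quotient n!^(\<alpha> - \<alpha>') outgrows every exponential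
  times a power of n.\<close>

lemma gevrey_scale_smaller:
  assumes "\<alpha>' < \<alpha>" "\<beta> > 0" "\<beta>' > 0"
  shows "eventually (\<lambda>n. gevrey_scale \<alpha>' \<beta>' \<gamma>' n \<le> gevrey_scale \<alpha> \<beta> \<gamma> n) sequentially"
proof -
  define \<delta> where "\<delta> = \<alpha> - \<alpha>'"
  define l where "l = ln (\<beta>' / \<beta>)"
  have \<delta>: "\<delta> > 0" using assms by (simp add: \<delta>_def)
  \<comment> \<open>Positive upper bounds for \<open>l\<close> and
    \<open>\<gamma>' - \<gamma>\<close>, so that the asymptotic comparison does not depend on their
    signs.\<close>
  define L c where "L = \<bar>l\<bar> + 1" and "c = \<bar>\<gamma>' - \<gamma>\<bar> + 1"
  have Lc: "L > 0" "c > 0" "l \<le> L" "\<gamma>' - \<gamma> \<le> c" by (auto simp: L_def c_def)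
  have "eventually (\<lambda>n::nat. exp (real n * L) * real n powr c \<le> (real n / exp 1) powr (real n * \<delta>)) sequentially"
    using \<delta> Lc(1,2) by real_asymp
  then have "eventually (\<lambda>n::nat. exp (real n * l) * real n powr (\<gamma>' - \<gamma>) \<le> (real n / exp 1) powr (real n * \<delta>)) sequentially"
    using eventually_gt_at_top[of 0]
  proof eventually_elim
    case (elim n)
    have "exp (real n * l) * real n powr (\<gamma>' - \<gamma>) \<le> exp (real n * L) * real n powr c"
      using elim Lc by (intro mult_mono powr_mono) auto
    with elim show ?case by linarith
  qed
  then show ?thesis using eventually_gt_at_top[of 0]
  proof eventually_elim
    case (elim n)
    have "real n ^ n \<le> exp 1 ^ n * fact n" using power_mult_fact_diff_le[of n n] by simp
    then have "(real n / exp 1) ^ n \<le> fact n" by (simp add: power_divide field_simps)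
    then have "((real n / exp 1) ^ n) powr \<delta> \<le> fact n powr \<delta>" using \<delta> by (intro powr_mono2) auto
    moreover have "((real n / exp 1) ^ n) powr \<delta> = (real n / exp 1) powr (real n * \<delta>)"
      using elim by (simp add: powr_powr flip: powr_realpow)
    ultimately have "exp (real n * l) * real n powr (\<gamma>' - \<gamma>) \<le> fact n powr \<delta>" using elim by simp
    moreover have "exp (real n * l) = \<beta>' ^ n / \<beta> ^ n"
      using assms by (simp add: l_def exp_of_nat_mult power_divide)
    ultimately have "\<beta>' ^ n / \<beta> ^ n * (real n powr \<gamma>' / real n powr \<gamma>) \<le> fact n powr \<alpha> / fact n powr \<alpha>'"
      by (simp add: powr_diff \<delta>_def)
    then show ?case using elim assms by (simp add: gevrey_scale_def field_simps)
  qed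
qed

lemma gevrey3_smaller:
  assumes "\<alpha>' < \<alpha>" "\<beta> > 0" "\<beta>' > 0"
  shows "gevrey3 \<alpha>' \<beta>' \<gamma>' \<subseteq> gevrey3 \<alpha> \<beta> \<gamma>"
proof
  fix f assume "f \<in> gevrey3 \<alpha>' \<beta>' \<gamma>'"
  then obtain C where C: "C > 0" "\<And>n. n > 0 \<Longrightarrow> cmod (fps_nth f n) \<le> C * gevrey_scale \<alpha>' \<beta>' \<gamma>' n"
    using gevrey3_iff[OF assms(3)] by metis
  have "eventually (\<lambda>n. cmod (fps_nth f n) \<le> C * gevrey_scale \<alpha> \<beta> \<gamma> n) sequentially"
    using gevrey_scale_smaller[OF assms, of \<gamma>' \<gamma>] eventually_gt_at_top[of 0]
    by eventually_elim (use C in \<open>meson mult_left_mono less_imp_le order_trans\<close>)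
  then show "f \<in> gevrey3 \<alpha> \<beta> \<gamma>" by (intro gevrey3I_eventually assms)
qed

lemma gevrey3I_exponential:
  assumes "\<alpha> > 0" "\<beta> > 0" "R > 0" "\<And>n. n > 0 \<Longrightarrow> cmod (fps_nth f n) \<le> R ^ n"
  shows "f \<in> gevrey3 \<alpha> \<beta> \<gamma>"
proof -
  have "f \<in> gevrey3 0 R 0"
    using assms gevrey3_iff[OF assms(3), of f 0 0] by (auto simp: gevrey_scale_def intro!: exI[of _ 1])
  then show ?thesis using gevrey3_smaller[OF assms(1,2,3)] by blast
qed

lemma gevrey3I_finite:
  assumes "\<beta> > 0" "\<And>n. n \<ge> N \<Longrightarrow> fps_nth f n = 0"
  shows "f \<in> gevrey3 \<alpha> \<beta> \<gamma>"
  using assms by (intro gevrey3I_eventually[where C = 0] eventually_mono[OF eventually_ge_at_top[of N]]) auto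

text \<open>The factors of numerator and factorial are paired: |s - l| <= (|s| + 1) (l + 1).\<close>

lemma norm_gbinomial_le: "cmod (s gchoose n) \<le> (cmod s + 1) ^ n"
proof -
  have "(fact n :: real) = (\<Prod>l=0..<n. real (Suc l))" by (simp add: fact_prod_Suc)
  moreover have "cmod (s gchoose n) = (\<Prod>l=0..<n. cmod (s - of_nat l)) / fact n"
    by (simp add: gbinomial_prod_rev norm_divide flip: prod_norm)
  ultimately have "cmod (s gchoose n) = (\<Prod>l=0..<n. cmod (s - of_nat l) / real (Suc l))"
    by (simp only: prod_dividef)
  also have "\<dots> \<le> (\<Prod>l=0..<n. cmod s + 1)"
  proof (intro prod_mono conjI)
    fix l
    have "cmod (s - of_nat l) \<le> cmod s + cmod (of_nat l)" by (rule norm_triangle_ineq4)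
    also have "cmod (of_nat l) = real l" by (rule norm_of_nat)
    also have "cmod s + real l \<le> (cmod s + 1) * real (Suc l)" by (simp add: algebra_simps)
    finally show "cmod (s - of_nat l) / real (Suc l) \<le> cmod s + 1" by (simp add: divide_le_eq)
  qed auto
  finally show ?thesis by simp
qed

text \<open>The outer series used for complex powers: its coefficients grow at most exponentially
  and so lie below every scale with \<alpha> > 0.\<close>

lemma fps_binomial_scaled_in_gevrey3:
  assumes "\<alpha> > 0" "\<beta> > 0"
  shows "fps_binomial s oo (fps_const c * fps_X) \<in> gevrey3 \<alpha> \<beta> \<gamma>"
proof (rule gevrey3I_exponential[OF assms])
  show "(cmod c + 1) * (cmod s + 1) > 0" by (simp add: add_nonneg_pos)
  fix n :: nat
  have "cmod (c ^ n * (s gchoose n)) \<le> (cmod c + 1) ^ n * (cmod s + 1) ^ n"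
    unfolding norm_mult norm_power by (intro mult_mono power_mono norm_gbinomial_le) auto
  then show "cmod (fps_nth (fps_binomial s oo (fps_const c * fps_X)) n) \<le> ((cmod c + 1) * (cmod s + 1)) ^ n"
    by (simp add: fps_compose_linear power_mult_distrib)
qed

lemma fps_binomial_in_gevrey3:
  assumes "\<alpha> > 0" "\<beta> > 0"
  shows "fps_binomial s \<in> gevrey3 \<alpha> \<beta> \<gamma>"
  using fps_binomial_scaled_in_gevrey3[OF assms, of s 1] by simp


section \<open>Formal power series lemmas\<close>

lemma fps_cutoff_conv_sum:
  "fps_cutoff K p = (\<Sum>k<K. fps_const (fps_nth p k) * fps_X ^ k)"
  by (rule fps_ext) (simp add: fps_sum_nth fps_X_power_nth if_distrib cong: if_cong)

lemma fps_cutoff_compose: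
  fixes p f :: "complex fps"
  assumes "fps_nth f 0 = 0"
  shows "fps_cutoff K p oo f = (\<Sum>k<K. fps_const (fps_nth p k) * f ^ k)"
  by (simp add: fps_cutoff_conv_sum fps_compose_sum_distrib fps_compose_mult_distrib[OF assms]
      assms flip: fps_compose_power[OF assms])

lemma compose_nth_eq_0:
  fixes d y :: "complex fps"
  assumes "fps_nth y 0 = 0" "\<And>i. i < N \<Longrightarrow> fps_nth d i = 0" "i < N"
  shows "fps_nth (d oo y) i = 0"
  using assms by (auto simp: fps_compose_nth intro!: sum.neutral)

lemma same_initial_mult:
  assumes "same_initial N f f'" "same_initial N g g'"
  shows "same_initial N (f * g) (f' * g')"
  using assms by (auto simp: same_initial_def fps_mult_nth intro!: sum.cong)

lemma same_initial_power: "same_initial N f f' \<Longrightarrow> same_initial N (f ^ k) (f' ^ k)"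
  by (induction k) (auto intro: same_initial_mult, simp add: same_initial_def)

text \<open>Powers of v = f/x - 1 enter only up to index K - 1, that is, f up to index K; hence
  \<open>Suc K\<close> coefficients.\<close>

lemma comp_top_cong:
  assumes "same_initial (Suc K) f f'" "fps_nth f 0 = 0" "fps_nth f 1 = 1" "fps_nth f' 0 = 0" "fps_nth f' 1 = 1"
  shows "comp_top K f g = comp_top K f' g"
proof -
  have "same_initial K (fps_shift 1 f - 1) (fps_shift 1 f' - 1)"
    using assms(1) by (auto simp: same_initial_def)
  then have v: "fps_nth ((fps_shift 1 f - 1) ^ i) j = fps_nth ((fps_shift 1 f' - 1) ^ i) j" if "j < K" for i j
    using same_initial_power[of K _ _ i] that by (simp add: same_initial_def)
  have "fps_nth (f ^ (n - j)) n = fps_nth (f' ^ (n - j)) n" if "j < K" "j \<le> n" for j n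
  proof -
    have "n - (n - j) = j" using that by simp
    then show ?thesis
      unfolding normalized_power_nth[OF assms(2,3)] normalized_power_nth[OF assms(4,5)]
      using v[OF that(1)] by simp
  qed
  then show ?thesis unfolding comp_top_def by (intro fps_ext) (auto intro!: sum.cong)
qed

lemma comp_top_X: "K > 0 \<Longrightarrow> comp_top K fps_X g = g"
proof (rule fps_ext)
  fix n assume "K > 0"
  have "fps_nth (comp_top K fps_X g) n = (\<Sum>j<K. if j = 0 then fps_nth g n else 0)"
    unfolding comp_top_def fps_nth_Abs_fps by (intro sum.cong refl) (auto simp: fps_X_power_nth)
  then show "fps_nth (comp_top K fps_X g) n = fps_nth g n" using \<open>K > 0\<close> by simp
qed

section \<open>Complex powers through their differential equation\<close>

lemma fps_cpow_0: "fps_nth (fps_cpow f s) 0 = 1"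
  by (simp add: fps_cpow_def)

text \<open>The equation (1 + x) B' = s B of the binomial series, composed with f - 1. With constant
  term 1 it characterizes the power and gives multiplicativity without binomial sums.\<close>

lemma fps_cpow_ODE:
  assumes "fps_nth f 0 = 1"
  shows "f * fps_deriv (fps_cpow f s) = fps_const s * fps_deriv f * fps_cpow f s"
proof -
  have u0: "fps_nth (f - 1) 0 = 0" using assms by simp
  have "(1 + fps_X) * fps_deriv (fps_binomial s) = fps_const s * fps_binomial s"
  proof -
    have "fps_deriv (fps_binomial s) = fps_const s * fps_binomial s * inverse (1 + fps_X)"
      by (simp add: fps_binomial_deriv fps_divide_unit)
    moreover have "(1 + fps_X) * inverse (1 + fps_X :: complex fps) = 1"
      by (rule inverse_mult_eq_1') simp
    ultimately show ?thesis by (simp add: mult_ac)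
  qed
  then have "((1 + fps_X) * fps_deriv (fps_binomial s)) oo (f - 1) = (fps_const s * fps_binomial s) oo (f - 1)"
    by simp
  then have "f * (fps_deriv (fps_binomial s) oo (f - 1)) = fps_const s * fps_cpow f s"
    using u0 by (simp add: fps_compose_mult_distrib fps_compose_add_distrib fps_cpow_def)
  then show ?thesis
    using u0 by (simp add: fps_cpow_def fps_compose_deriv mult_ac)
qed

text \<open>The quotient h / k has derivative 0 and constant term 1.\<close>

lemma fps_cpow_unique:
  fixes h k f :: "complex fps"
  assumes "f \<noteq> 0" "fps_nth h 0 = 1" "fps_nth k 0 = 1"
    and "f * fps_deriv h = fps_const s * fps_deriv f * h"
    and "f * fps_deriv k = fps_const s * fps_deriv f * k"
  shows "h = k"
proof -
  define w where "w = inverse k"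
  have kw: "k * w = 1" unfolding w_def using assms by (intro inverse_mult_eq_1') simp
  have w': "fps_deriv w = - fps_deriv k * w ^ 2"
    unfolding w_def using assms by (intro fps_inverse_deriv) simp
  have "f * (fps_deriv h * k) = f * (h * fps_deriv k)"
  proof -
    have "f * (fps_deriv h * k) = (f * fps_deriv h) * k" by (simp only: mult.assoc)
    also have "\<dots> = h * (f * fps_deriv k)" unfolding assms(4,5) by (simp only: mult_ac)
    finally show ?thesis by (simp only: mult_ac)
  qed
  then have eq: "fps_deriv h * k = h * fps_deriv k" using assms(1) by simp
  have "fps_deriv (h * w) = fps_deriv h * w * 1 - h * fps_deriv k * w ^ 2"
    by (simp add: w' algebra_simps)
  also have "\<dots> = fps_deriv h * w * (k * w) - h * fps_deriv k * w ^ 2" by (simp only: kw)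
  also have "\<dots> = (fps_deriv h * k - h * fps_deriv k) * w ^ 2" by (simp add: algebra_simps power2_eq_square)
  finally have "fps_deriv (h * w) = 0" by (simp add: eq)
  then have "h * w = fps_const (fps_nth (h * w) 0)" using fps_deriv_eq_0_iff by blast
  also have "fps_nth (h * w) 0 = 1" using assms by (simp add: w_def)
  finally have "h * (w * k) = k" by (simp flip: mult.assoc)
  then show ?thesis using kw by (simp add: mult.commute)
qed

text \<open>By the product rule the right-hand side solves the equation of \<open>f * g\<close>, so
  uniqueness applies.\<close>

lemma fps_cpow_mult:
  assumes "fps_nth f 0 = 1" "fps_nth g 0 = 1"
  shows "fps_cpow (f * g) s = fps_cpow f s * fps_cpow g s"
proof (rule fps_cpow_unique)
  show "f * g \<noteq> 0" using assms by auto
  show "f * g * fps_deriv (fps_cpow (f * g) s) = fps_const s * fps_deriv (f * g) * fps_cpow (f * g) s"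
    using assms by (intro fps_cpow_ODE) simp
  have "f * g * fps_deriv (fps_cpow f s * fps_cpow g s) =
      (f * fps_deriv (fps_cpow f s)) * g * fps_cpow g s + (g * fps_deriv (fps_cpow g s)) * f * fps_cpow f s"
    by (simp add: algebra_simps)
  also have "\<dots> = fps_const s * fps_deriv (f * g) * (fps_cpow f s * fps_cpow g s)"
    unfolding fps_cpow_ODE[OF assms(1)] fps_cpow_ODE[OF assms(2)] by (simp add: algebra_simps)
  finally show "f * g * fps_deriv (fps_cpow f s * fps_cpow g s) =
    fps_const s * fps_deriv (f * g) * (fps_cpow f s * fps_cpow g s)" .
qed (use fps_cpow_0 in auto)

text \<open>Composition is controlled for inner series x + O(x^2), while f - 1 starts with c x.
  Dividing by c normalizes it, and the outer series compensates.\<close>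

lemma fps_cpow_conv_normalized:
  assumes "fps_nth f 0 = 1" "fps_nth f 1 = c" "c \<noteq> 0"
  shows "fps_cpow f s = (fps_binomial s oo (fps_const c * fps_X)) oo (fps_const (1 / c) * (f - 1))"
proof -
  have "(fps_const c * fps_X) oo (fps_const (1 / c) * (f - 1)) = f - 1"
    using assms by (simp add: fps_compose_mult_distrib flip: mult.assoc)
  then show ?thesis
    unfolding fps_cpow_def using assms by (subst fps_compose_assoc[symmetric]) auto
qed

text \<open>Reduces a vanishing linear coefficient to the previous lemma.\<close>

lemma fps_cpow_conv_mult_one_plus_X:
  assumes "fps_nth f 0 = 1"
  shows "fps_cpow f s = fps_cpow (f * (1 + fps_X)) s * fps_binomial (- s)"
proof -
  have "fps_cpow (f * (1 + fps_X)) s = fps_cpow f s * fps_binomial s"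
    using assms by (subst fps_cpow_mult) (auto simp: fps_cpow_def)
  moreover have "fps_binomial s * fps_binomial (- s) = 1"
    by (simp flip: fps_binomial_add_mult)
  ultimately show ?thesis by (simp add: mult.assoc)
qed

section \<open>Closure of complete classes\<close>

text \<open>On coefficients, \<open>X_mult\<close> and \<open>X2_deriv\<close> replace a_n by
  a_(n-1) and (n-1) a_(n-1). Taking 0 as the approximant in \<open>complete\<close> shows that C
  contains every series below all orders, in particular all polynomials.
  \<open>subset_gevrey2\<close> supplies the exponent from which the remainder estimates
  start.\<close>

locale gevrey_class =
  fixes \<alpha> \<beta> :: real and C :: "complex fps set"
  assumes \<alpha>: "\<alpha> > 1" and \<beta>: "\<beta> > 0"
    and subset_gevrey2: "C \<subseteq> gevrey2 \<alpha> \<beta>"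
    and zero: "0 \<in> C"
    and add: "\<And>f g. f \<in> C \<Longrightarrow> g \<in> C \<Longrightarrow> f + g \<in> C"
    and scale: "\<And>c f. f \<in> C \<Longrightarrow> fps_const c * f \<in> C"
    and X_mult: "\<And>f. f \<in> C \<Longrightarrow> fps_X * f \<in> C"
    and X2_deriv: "\<And>f. f \<in> C \<Longrightarrow> fps_X ^ 2 * fps_deriv f \<in> C"
    and complete: "\<And>f. (\<And>\<rho>. \<exists>v\<in>C. f - v \<in> gevrey3 \<alpha> \<beta> \<rho>) \<Longrightarrow> f \<in> C"

text \<open>An index shift divides the scale by about \<beta> n^\<alpha>, which leaves room for the
  factor n of \<open>X2_deriv\<close>. Completeness is its own instance at order \<gamma>.\<close>

lemma gevrey_class_gevrey3:
  assumes "\<alpha> > 1" "\<beta> > 0"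
  shows "gevrey_class \<alpha> \<beta> (gevrey3 \<alpha> \<beta> \<gamma>)"
proof
  have add: "f + g \<in> gevrey3 \<alpha> \<beta> \<gamma>" if "f \<in> gevrey3 \<alpha> \<beta> \<gamma>" "g \<in> gevrey3 \<alpha> \<beta> \<gamma>" for f g
  proof -
    have "(\<lambda>n. fps_nth f n + fps_nth g n) \<in> O(\<lambda>n. of_real (gevrey_scale \<alpha> \<beta> \<gamma> n))"
      using that by (intro sum_in_bigo) (auto simp: gevrey3_def)
    moreover have "fps_nth (f + g) = (\<lambda>n. fps_nth f n + fps_nth g n)" by auto
    ultimately show ?thesis by (simp add: gevrey3_def)
  qed
  \<comment> \<open>For n >= 2 one has n/2 <= n - 1 <= n, so (n-1)^\<gamma> is at most 2^|\<gamma>|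
    n^\<gamma> for either sign of \<gamma>.\<close>
  define B where "B = 2 powr \<bar>\<gamma>\<bar> / \<beta>"
  have scale_pred: "real n * gevrey_scale \<alpha> \<beta> \<gamma> (n - 1) \<le> B * gevrey_scale \<alpha> \<beta> \<gamma> n" if n: "n \<ge> 2" for n
  proof -
    obtain m where m: "n = Suc m" "m \<ge> 1" using n by (cases n) auto
    have "real m powr \<gamma> \<le> 2 powr \<bar>\<gamma>\<bar> * real n powr \<gamma>"
    proof (cases "\<gamma> \<ge> 0")
      case True
      have "real m powr \<gamma> \<le> real n powr \<gamma>" using True m by (intro powr_mono2) auto
      also have "1 * real n powr \<gamma> \<le> 2 powr \<bar>\<gamma>\<bar> * real n powr \<gamma>"
        by (intro mult_right_mono) (auto intro: ge_one_powr_ge_zero)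
      finally show ?thesis by simp
    next
      case False
      have "real m powr \<gamma> \<le> (real n / 2) powr \<gamma>" using False m by (intro powr_mono2') auto
      also have "\<dots> = 2 powr \<bar>\<gamma>\<bar> * real n powr \<gamma>"
        using False m by (simp add: powr_divide powr_minus field_simps)
      finally show ?thesis .
    qed
    moreover have "fact n powr \<alpha> = real n powr \<alpha> * fact m powr \<alpha>" by (simp add: m powr_mult)
    moreover have "real n powr \<alpha> \<ge> real n powr 1" using n assms by (intro powr_mono) auto
    then have "real n \<le> real n powr \<alpha>" using n by simp
    ultimately have "real n * fact m powr \<alpha> * real m powr \<gamma> \<le> fact n powr \<alpha> * (2 powr \<bar>\<gamma>\<bar> * real n powr \<gamma>)"
      by (auto intro!: mult_mono)
    then have "\<beta> ^ m * (real n * fact m powr \<alpha> * real m powr \<gamma>) \<le> \<beta> ^ m * (fact n powr \<alpha> * (2 powr \<bar>\<gamma>\<bar> * real n powr \<gamma>))"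
      using assms by (intro mult_left_mono) auto
    then show ?thesis using assms by (simp add: m gevrey_scale_def B_def mult_ac)
  qed
  have pred: "h \<in> gevrey3 \<alpha> \<beta> \<gamma>"
    if f: "f \<in> gevrey3 \<alpha> \<beta> \<gamma>" and h: "\<And>n. n \<ge> 2 \<Longrightarrow> cmod (fps_nth h n) \<le> real n * cmod (fps_nth f (n - 1))" for f h
  proof -
    obtain C where C: "C > 0" "\<And>n. n > 0 \<Longrightarrow> cmod (fps_nth f n) \<le> C * gevrey_scale \<alpha> \<beta> \<gamma> n"
      using f gevrey3_iff[OF assms(2)] by metis
    have "cmod (fps_nth h n) \<le> (C * B) * gevrey_scale \<alpha> \<beta> \<gamma> n" if n: "n \<ge> 2" for n
    proof -
      have "cmod (fps_nth h n) \<le> real n * (C * gevrey_scale \<alpha> \<beta> \<gamma> (n - 1))"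
        using h[OF n] C(2)[of "n - 1"] n by (meson diff_is_0_eq' mult_left_mono not_le of_nat_0_le_iff order_trans
            less_le_trans one_less_numeral_iff semiring_norm(76) zero_less_diff)
      also have "\<dots> \<le> (C * B) * gevrey_scale \<alpha> \<beta> \<gamma> n"
        using mult_left_mono[OF scale_pred[OF n], of C] C(1) by (simp add: mult_ac)
      finally show ?thesis .
    qed
    then show ?thesis
      by (intro gevrey3I_eventually[OF assms(2)] eventually_mono[OF eventually_ge_at_top[of 2]])
  qed
  show "gevrey3 \<alpha> \<beta> \<gamma> \<subseteq> gevrey2 \<alpha> \<beta>" by (auto simp: gevrey2_def)
  show "0 \<in> gevrey3 \<alpha> \<beta> \<gamma>" by (rule gevrey3I_finite[OF assms(2), of 0]) simp
  fix f g :: "complex fps" and c :: complex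
  show "f + g \<in> gevrey3 \<alpha> \<beta> \<gamma>" if "f \<in> gevrey3 \<alpha> \<beta> \<gamma>" "g \<in> gevrey3 \<alpha> \<beta> \<gamma>" by (rule add[OF that])
  show "fps_const c * f \<in> gevrey3 \<alpha> \<beta> \<gamma>" if "f \<in> gevrey3 \<alpha> \<beta> \<gamma>"
  proof -
    have "(\<lambda>n. c * fps_nth f n) \<in> O(\<lambda>n. of_real (gevrey_scale \<alpha> \<beta> \<gamma> n))"
      using that by (cases "c = 0") (auto simp: gevrey3_def)
    moreover have "fps_nth (fps_const c * f) = (\<lambda>n. c * fps_nth f n)" by auto
    ultimately show ?thesis by (simp add: gevrey3_def)
  qed
  show "fps_X * f \<in> gevrey3 \<alpha> \<beta> \<gamma>" if "f \<in> gevrey3 \<alpha> \<beta> \<gamma>"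
  proof (rule pred[OF that])
    fix n :: nat assume "n \<ge> 2"
    then have "1 * cmod (fps_nth f (n - 1)) \<le> real n * cmod (fps_nth f (n - 1))"
      by (intro mult_right_mono) auto
    then show "cmod (fps_nth (fps_X * f) n) \<le> real n * cmod (fps_nth f (n - 1))"
      using \<open>n \<ge> 2\<close> by (simp add: fps_X_mult_nth)
  qed
  show "fps_X ^ 2 * fps_deriv f \<in> gevrey3 \<alpha> \<beta> \<gamma>" if "f \<in> gevrey3 \<alpha> \<beta> \<gamma>"
  proof (rule pred[OF that])
    fix n :: nat assume n: "n \<ge> 2"
    then have *: "n - 2 + 1 = n - 1" by simp
    have "cmod (fps_nth (fps_X ^ 2 * fps_deriv f) n) = real (n - 1) * cmod (fps_nth f (n - 1))"
      using n * by (simp add: fps_X_power_mult_nth norm_mult del: of_nat_diff of_nat_add of_nat_Suc)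
    also have "\<dots> \<le> real n * cmod (fps_nth f (n - 1))" by (intro mult_right_mono) auto
    finally show "cmod (fps_nth (fps_X ^ 2 * fps_deriv f) n) \<le> real n * cmod (fps_nth f (n - 1))" .
  qed
  show "f \<in> gevrey3 \<alpha> \<beta> \<gamma>" if "\<And>\<rho>. \<exists>v\<in>gevrey3 \<alpha> \<beta> \<gamma>. f - v \<in> gevrey3 \<alpha> \<beta> \<rho>"
    using that[of \<gamma>] add by (metis diff_add_cancel)
qed (use assms in auto)

context gevrey_class
begin

lemma \<alpha>_ge: "\<alpha> \<ge> 1" and \<alpha>_pos: "\<alpha> > 0"
  using \<alpha> by auto

lemma diff: "f \<in> C \<Longrightarrow> g \<in> C \<Longrightarrow> f - g \<in> C"
  using add[OF _ scale[of g "-1"], of f] by (simp flip: fps_const_neg)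

lemma sum: "(\<And>i. i \<in> A \<Longrightarrow> F i \<in> C) \<Longrightarrow> (\<Sum>i\<in>A. F i) \<in> C"
  by (induction A rule: infinite_finite_induct) (auto simp: zero add)

lemma flat: "(\<And>\<rho>. f \<in> gevrey3 \<alpha> \<beta> \<rho>) \<Longrightarrow> f \<in> C"
  by (intro complete bexI[OF _ zero]) auto

lemma cutoff: "fps_cutoff K f \<in> C"
  by (rule flat, rule gevrey3I_finite[OF \<beta>, of K]) simp

lemma one: "1 \<in> C"
  by (rule flat, rule gevrey3I_finite[OF \<beta>, of 1]) simp

lemma X: "fps_X \<in> C"
  using X_mult[OF one] by simp

lemma X_power_mult: "f \<in> C \<Longrightarrow> fps_X ^ k * f \<in> C"
  by (induction k) (auto simp: mult.assoc X_mult)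

lemma cutoff_mult: "f \<in> C \<Longrightarrow> fps_cutoff K p * f \<in> C"
  by (auto simp: fps_cutoff_conv_sum sum_distrib_right mult.assoc intro!: sum scale X_power_mult)

lemma mult:
  assumes f: "f \<in> C" and g: "g \<in> C"
  shows "f * g \<in> C"
proof (rule complete)
  fix \<rho>
  obtain \<Gamma> where \<Gamma>: "f \<in> gevrey3 \<alpha> \<beta> \<Gamma>" "g \<in> gevrey3 \<alpha> \<beta> \<Gamma>"
    using gevrey2_common[OF \<beta>] f g subset_gevrey2 by blast
  interpret G: gevrey_class \<alpha> \<beta> "gevrey3 \<alpha> \<beta> \<Gamma>" by (rule gevrey_class_gevrey3[OF \<alpha> \<beta>])
  interpret R: gevrey_class \<alpha> \<beta> "gevrey3 \<alpha> \<beta> \<rho>" by (rule gevrey_class_gevrey3[OF \<alpha> \<beta>])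
  obtain K where K: "\<forall>f\<in>gevrey3 \<alpha> \<beta> \<Gamma>. \<forall>g\<in>gevrey3 \<alpha> \<beta> \<Gamma>.
    (\<forall>i<K. fps_nth f i = 0) \<longrightarrow> (\<forall>i<K. fps_nth g i = 0) \<longrightarrow> f * g \<in> gevrey3 \<alpha> \<beta> \<rho>"
    using gevrey3_mult_remainder[OF \<alpha>_ge \<beta>] by blast
  define p q where "p = fps_cutoff K f" and "q = fps_cutoff K g"
  have "(f - p) * (g - q) \<in> gevrey3 \<alpha> \<beta> \<rho>"
    using \<Gamma> by (intro K[rule_format] G.diff G.cutoff) (auto simp: p_def q_def intro: G.cutoff G.diff)
  moreover have "p * q \<in> gevrey3 \<alpha> \<beta> \<rho>"
    unfolding p_def q_def by (intro R.cutoff_mult R.cutoff)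
  ultimately have "(f - p) * (g - q) - p * q \<in> gevrey3 \<alpha> \<beta> \<rho>" by (rule R.diff)
  \<comment> \<open>The approximant counts \<open>p * q\<close> twice; that product is a polynomial,
    hence negligible at every order.\<close>
  moreover have "f * g - (p * g + q * f) = (f - p) * (g - q) - p * q" by (simp add: algebra_simps)
  moreover have "p * g + q * f \<in> C" unfolding p_def q_def using f g by (intro add cutoff_mult)
  ultimately show "\<exists>v\<in>C. f * g - v \<in> gevrey3 \<alpha> \<beta> \<rho>" by metis
qed

lemma power: "f \<in> C \<Longrightarrow> f ^ k \<in> C"
  by (induction k) (auto simp: one mult)

text \<open>
  Shifting by at least \<open>i\<close> compensates multiplication by a polynomial of degree \<open>i\<close> because
  \<open>\<alpha> > 1\<close>.
\<close>

lemma choose_shift: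
  assumes f: "f \<in> C" and "i \<le> j"
  shows "Abs_fps (\<lambda>n. if j \<le> n then of_nat ((n - j) choose i) * fps_nth f (n - j) else 0) \<in> C"
proof -
  define U where "U i = Abs_fps (\<lambda>n. if i \<le> n then of_nat ((n - i) choose i) * fps_nth f (n - i) else 0)" for i
  have U: "U i \<in> C"
  proof (induction i)
    case 0
    have "U 0 = f" by (rule fps_ext) (simp add: U_def)
    then show ?case using f by simp
  next
    case (Suc i)
    \<comment> \<open>At index m + 1 the bracket is m - 2i times the coefficient of
      \<open>U i\<close> at m, and (m-2i) (m-i choose i) = (i+1) (m-i choose i+1).\<close>
    have "U (Suc i) = fps_const (1 / of_nat (Suc i)) *
        (fps_X ^ 2 * fps_deriv (U i) - fps_const (of_nat (2 * i)) * (fps_X * U i))"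
    proof (rule fps_ext)
      fix n
      show "fps_nth (U (Suc i)) n = fps_nth (fps_const (1 / of_nat (Suc i)) *
        (fps_X ^ 2 * fps_deriv (U i) - fps_const (of_nat (2 * i)) * (fps_X * U i))) n"
      proof (cases n)
        case 0
        then show ?thesis by (simp add: U_def fps_X_power_mult_nth)
      next
        case (Suc m)
        have X2: "fps_nth (fps_X ^ 2 * fps_deriv (U i)) (Suc m) = of_nat m * fps_nth (U i) m"
          by (cases m) (simp_all add: fps_X_power_mult_nth)
        have "fps_nth (fps_const (1 / of_nat (Suc i)) *
            (fps_X ^ 2 * fps_deriv (U i) - fps_const (of_nat (2 * i)) * (fps_X * U i))) n =
            (of_nat m - of_nat (2 * i)) * fps_nth (U i) m / of_nat (Suc i)"
          unfolding Suc fps_mult_left_const_nth fps_sub_nth X2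
          by (simp add: fps_X_mult_nth left_diff_distrib del: of_nat_Suc of_nat_mult)
        also have "\<dots> = fps_nth (U (Suc i)) n"
        proof (cases "i \<le> m")
          case True
          define k where "k = m - i"
          have m: "m = k + i" using True by (simp add: k_def)
          have "of_nat (Suc i) * complex_of_nat (k choose Suc i) = (of_nat k - of_nat i) * of_nat (k choose i)"
          proof (cases "i \<le> k")
            case True
            have "Suc i * (k choose Suc i) = (k - i) * (k choose i)"
              by (simp only: binomial_absorb_comp binomial_absorption)
            then have "of_nat (Suc i) * complex_of_nat (k choose Suc i) = of_nat (k - i) * of_nat (k choose i)"
              by (metis of_nat_mult)
            then show ?thesis using True by (simp add: of_nat_diff)
          qed (simp add: binomial_eq_0)
          then have "complex_of_nat (k choose Suc i) = (of_nat k - of_nat i) * of_nat (k choose i) / of_nat (Suc i)"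
            by (simp add: eq_divide_eq mult.commute del: of_nat_Suc)
          then show ?thesis by (simp add: U_def Suc m algebra_simps del: of_nat_Suc binomial_Suc_Suc)
        qed (simp add: U_def Suc)
        finally show ?thesis ..
      qed
    qed
    then show ?case using Suc by (simp only: scale diff X2_deriv X_mult)
  qed
  have "fps_X ^ (j - i) * U i =
      Abs_fps (\<lambda>n. if j \<le> n then of_nat ((n - j) choose i) * fps_nth f (n - j) else 0)"
    using \<open>i \<le> j\<close> by (intro fps_ext) (auto simp: fps_X_power_mult_nth U_def)
  then show ?thesis using X_power_mult[OF U, of "j - i"] by simp
qed

text \<open>By \<open>normalized_power_nth\<close> the powers of f contribute combinations of
  \<open>(n - j) choose i\<close> with i <= j, the constants depending on f only; the resulting
  series are those of \<open>choose_shift\<close>.\<close>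

lemma comp_top:
  assumes g: "g \<in> C" and f: "fps_nth f 0 = 0" "fps_nth f 1 = 1"
  shows "comp_top K f g \<in> C"
proof -
  define c where "c i j = fps_nth ((fps_shift 1 f - 1) ^ i) j" for i j
  define S where "S i j = Abs_fps (\<lambda>n. if j \<le> n then of_nat ((n - j) choose i) * fps_nth g (n - j) else 0)" for i j
  have "comp_top K f g = (\<Sum>j<K. \<Sum>i\<le>j. fps_const (c i j) * S i j)"
  proof (rule fps_ext)
    fix n
    have "(if j \<le> n then fps_nth g (n - j) * fps_nth (f ^ (n - j)) n else 0) =
      (\<Sum>i\<le>j. c i j * fps_nth (S i j) n)" for j
    proof (cases "j \<le> n")
      case True
      then have "n - (n - j) = j" by simp
      then show ?thesis unfolding normalized_power_nth[OF f] c_def S_def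
        using True by (simp add: sum_distrib_left mult_ac)
    qed (simp add: S_def)
    then show "fps_nth (comp_top K f g) n = fps_nth (\<Sum>j<K. \<Sum>i\<le>j. fps_const (c i j) * S i j) n"
      by (simp add: comp_top_def fps_sum_nth)
  qed
  also have "\<dots> \<in> C"
    unfolding S_def using g by (intro sum scale choose_shift) auto
  finally show ?thesis .
qed

lemma cutoff_compose:
  assumes "f \<in> C" "fps_nth f 0 = 0"
  shows "fps_cutoff K p oo f \<in> C"
  unfolding fps_cutoff_compose[OF assms(2)] using assms(1) by (intro sum scale power)

lemma compose:
  assumes f: "f \<in> C" "fps_nth f 0 = 0" "fps_nth f 1 = 1" and g: "g \<in> C"
  shows "g oo f \<in> C"
proof (rule complete)
  fix \<rho>
  obtain \<Gamma> where \<Gamma>: "f \<in> gevrey3 \<alpha> \<beta> \<Gamma>" "g \<in> gevrey3 \<alpha> \<beta> \<Gamma>"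
    using gevrey2_common[OF \<beta>] f g subset_gevrey2 by blast
  interpret G: gevrey_class \<alpha> \<beta> "gevrey3 \<alpha> \<beta> \<Gamma>" by (rule gevrey_class_gevrey3[OF \<alpha> \<beta>])
  obtain K where K: "\<forall>f\<in>gevrey3 \<alpha> \<beta> \<Gamma>. \<forall>g\<in>gevrey3 \<alpha> \<beta> \<Gamma>.
    fps_nth f 0 = 0 \<longrightarrow> fps_nth f 1 = 1 \<longrightarrow> (\<forall>i<K. fps_nth g i = 0) \<longrightarrow>
    (g oo f) - comp_top K f g \<in> gevrey3 \<alpha> \<beta> \<rho>"
    using gevrey3_compose_remainder[OF \<alpha> \<beta>, of \<Gamma> \<rho>] by auto
  \<comment> \<open>Removing \<open>p\<close> makes the outer series vanish below \<open>K\<close>,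
    as the remainder estimate requires; \<open>p oo f\<close> is a polynomial in f.\<close>
  define p where "p = fps_cutoff K g"
  have "((g - p) oo f) - comp_top K f (g - p) \<in> gevrey3 \<alpha> \<beta> \<rho>"
    using \<Gamma> f by (intro K[rule_format] G.diff) (auto simp: p_def intro: G.cutoff)
  moreover have "((g - p) oo f) - comp_top K f (g - p) = (g oo f) - ((p oo f) + comp_top K f (g - p))"
    by (simp add: fps_compose_sub_distrib)
  moreover have "(p oo f) + comp_top K f (g - p) \<in> C"
    unfolding p_def using f g by (intro add cutoff_compose comp_top diff cutoff)
  ultimately show "\<exists>v\<in>C. (g oo f) - v \<in> gevrey3 \<alpha> \<beta> \<rho>" by metis
qed

lemma binomial: "fps_binomial s \<in> C" and binomial_scaled: "fps_binomial s oo (fps_const c * fps_X) \<in> C"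
  using fps_binomial_in_gevrey3[OF \<alpha>_pos \<beta>] fps_binomial_scaled_in_gevrey3[OF \<alpha>_pos \<beta>] flat by auto

lemma cpow:
  assumes f: "f \<in> C" "fps_nth f 0 = 1"
  shows "fps_cpow f s \<in> C"
proof -
  have *: "fps_cpow f s \<in> C" if f: "f \<in> C" "fps_nth f 0 = 1" "fps_nth f 1 \<noteq> 0" for f
    unfolding fps_cpow_conv_normalized[OF f(2) refl f(3)]
    using f by (intro compose binomial_scaled scale diff one) auto
  show ?thesis
  proof (cases "fps_nth f 1 = 0")
    case True
    have "fps_cpow (f * (1 + fps_X)) s \<in> C"
    proof (rule *)
      show "f * (1 + fps_X) \<in> C" using f by (intro mult add one X)
    qed (use f True in \<open>auto simp: distrib_left\<close>)
    then show ?thesis unfolding fps_cpow_conv_mult_one_plus_X[OF f(2)] by (intro mult binomial)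
  qed (use * f in auto)
qed

text \<open>
  With a polynomial truncation \<open>p\<close> of \<open>f\<close> to high order and \<open>q\<close> its inverse, \<open>f oo q = fps_X + e\<close>
  for a small \<open>e\<close>, so that \<open>fps_inv f\<close> agrees with \<open>q = fps_inv f oo (fps_X + e)\<close> up to
  a negligible error and finitely many initial terms.
\<close>

lemma inverse:
  assumes f: "f \<in> C" "fps_nth f 0 = 0" "fps_nth f 1 = 1"
  shows "fps_inv f \<in> C"
proof (rule complete)
  fix \<rho>
  define y where "y = fps_inv f"
  have y: "y oo f = fps_X" unfolding y_def using f by (intro fps_inv) auto
  have f2: "f \<in> gevrey2 \<alpha> \<beta>" using f subset_gevrey2 by blast
  then obtain \<Gamma> where \<Gamma>: "f \<in> gevrey3 \<alpha> \<beta> \<Gamma>" "y \<in> gevrey3 \<alpha> \<beta> \<Gamma>"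
    using gevrey2_common[OF \<beta> f2 gevrey2_inverse[OF \<alpha>_ge \<beta> f2 f(2,3)]] unfolding y_def by blast
  interpret G: gevrey_class \<alpha> \<beta> "gevrey3 \<alpha> \<beta> \<Gamma>" by (rule gevrey_class_gevrey3[OF \<alpha> \<beta>])
  obtain K where K: "K > 0" "\<forall>f\<in>gevrey3 \<alpha> \<beta> \<Gamma>. \<forall>g\<in>gevrey3 \<alpha> \<beta> \<Gamma>.
    fps_nth f 0 = 0 \<longrightarrow> fps_nth f 1 = 1 \<longrightarrow> (\<forall>i<K. fps_nth g i = 0) \<longrightarrow>
    (g oo f) - comp_top K f g \<in> gevrey3 \<alpha> \<beta> \<rho>"
    using gevrey3_compose_remainder[OF \<alpha> \<beta>, of \<Gamma> \<rho>] by auto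
  \<comment> \<open>Above the \<open>Suc K\<close> coefficients compared in
    \<open>comp_top_cong\<close>, and at least 2, so that the truncation keeps the
    normalization.\<close>
  define N where "N = K + 2"
  define p where "p = fps_cutoff N f"
  define q where "q = fps_inv p"
  have p: "fps_nth p 0 = 0" "fps_nth p 1 = 1" using f by (simp_all add: p_def N_def)
  have q: "fps_nth q 0 = 0" "fps_nth q 1 = 1" "p oo q = fps_X"
  proof -
    show "fps_nth q 0 = 0" by (simp add: q_def fps_inv_def)
    show pq: "p oo q = fps_X" unfolding q_def using p by (intro fps_inv_right) auto
    have "fps_nth (p oo q) 1 = fps_nth q 1"
      using p by (simp add: fps_compose_nth)
    then show "fps_nth q 1 = 1" by (simp add: pq)
  qed
  \<comment> \<open>The polynomial \<open>p\<close> lies in a class whose factorial exponent is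
    strictly between 1 and \<alpha>. So does its inverse, and that class lies below every scale with
    exponent \<alpha>.\<close>
  have q_flat: "q \<in> gevrey3 \<alpha> \<beta> \<sigma>" for \<sigma>
  proof -
    define \<alpha>' where "\<alpha>' = (1 + \<alpha>) / 2"
    have \<alpha>': "\<alpha>' \<ge> 1" "\<alpha>' < \<alpha>" using \<alpha> by (auto simp: \<alpha>'_def)
    have "p \<in> gevrey3 \<alpha>' \<beta> 0" by (rule gevrey3I_finite[OF \<beta>, of N]) (simp add: p_def)
    then have "p \<in> gevrey2 \<alpha>' \<beta>" by (auto simp: gevrey2_def)
    then have "q \<in> gevrey2 \<alpha>' \<beta>" unfolding q_def using p by (intro gevrey2_inverse[OF \<alpha>'(1) \<beta>])
    then show ?thesis using gevrey3_smaller[OF \<alpha>'(2) \<beta> \<beta>] by (auto simp: gevrey2_def)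
  qed
  define \<phi> where "\<phi> = f oo q"
  have \<phi>_in: "\<phi> \<in> C" "\<phi> \<in> gevrey3 \<alpha> \<beta> \<Gamma>"
    unfolding \<phi>_def
    by (rule compose[OF flat[OF q_flat] q(1,2) f(1)], rule G.compose[OF q_flat q(1,2) \<Gamma>(1)])
  have "\<phi> = fps_X + ((f - p) oo q)" by (simp add: \<phi>_def fps_compose_sub_distrib q(3))
  moreover have "fps_nth ((f - p) oo q) i = 0" if "i < N" for i
    using q that by (intro compose_nth_eq_0[of q N]) (auto simp: p_def)
  ultimately have \<phi>: "same_initial (Suc K) \<phi> fps_X" "fps_nth \<phi> 0 = 0" "fps_nth \<phi> 1 = 1"
    by (auto simp: same_initial_def N_def simp del: fps_compose_nth_0)
  have "y oo \<phi> = (y oo f) oo q" unfolding \<phi>_def using f q by (simp add: fps_compose_assoc)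
  also have "\<dots> = q" using q by (simp add: y)
  finally have y\<phi>: "y oo \<phi> = q" .
  define r where "r = y - fps_cutoff K y"
  have "(r oo \<phi>) - comp_top K \<phi> r \<in> gevrey3 \<alpha> \<beta> \<rho>"
    unfolding r_def using \<Gamma> \<phi> \<phi>_in by (intro K(2)[rule_format] G.diff G.cutoff) auto
  \<comment> \<open>In the coefficients that \<open>comp_top\<close> sees, \<phi> agrees with x, so
    the main part of \<open>r oo \<phi>\<close> is \<open>r\<close> itself. This turns
    \<open>y oo \<phi> = q\<close> into a formula for \<open>r\<close> up to order \<rho>.\<close>
  moreover have "comp_top K \<phi> r = r"
    using \<phi> K(1) by (subst comp_top_cong[of K \<phi> fps_X]) (auto simp: comp_top_X)
  moreover have "r oo \<phi> = q - (fps_cutoff K y oo \<phi>)"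
    by (simp add: r_def fps_compose_sub_distrib y\<phi>)
  ultimately have "(q - (fps_cutoff K y oo \<phi>)) - r \<in> gevrey3 \<alpha> \<beta> \<rho>" by simp
  then have "fps_const (-1) * ((q - (fps_cutoff K y oo \<phi>)) - r) \<in> gevrey3 \<alpha> \<beta> \<rho>"
    by (rule gevrey_class.scale[OF gevrey_class_gevrey3[OF \<alpha> \<beta>]])
  also have "fps_const (-1) * ((q - (fps_cutoff K y oo \<phi>)) - r) = y - (q - (fps_cutoff K y oo \<phi>) + fps_cutoff K y)"
    by (simp add: r_def algebra_simps flip: fps_const_neg)
  finally have "y - (q - (fps_cutoff K y oo \<phi>) + fps_cutoff K y) \<in> gevrey3 \<alpha> \<beta> \<rho>" .
  moreover have "q - (fps_cutoff K y oo \<phi>) + fps_cutoff K y \<in> C"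
    using \<phi> \<phi>_in flat[OF q_flat] by (intro add diff cutoff cutoff_compose) auto
  ultimately show "\<exists>v\<in>C. fps_inv f - v \<in> gevrey3 \<alpha> \<beta> \<rho>" unfolding y_def by blast
qed

lemma closed_under_series_ops: "closed_under_series_ops C"
  unfolding closed_under_series_ops_def by (auto intro: add mult compose cpow inverse)

end

section \<open>Closure of the classes given by bounds alone\<close>

lemma closed_under_series_ops_gevrey3:
  assumes "\<alpha> > 1" "\<beta> > 0"
  shows "closed_under_series_ops (gevrey3 \<alpha> \<beta> \<gamma>)"
  using gevrey_class_gevrey3[OF assms] by (rule gevrey_class.closed_under_series_ops)

text \<open>No operation has more than two inputs, so it suffices that any two members share a
  closed subclass.\<close>

lemma closed_under_series_ops_directed:
  assumes "\<And>f g. f \<in> C \<Longrightarrow> g \<in> C \<Longrightarrow> \<exists>D. D \<subseteq> C \<and> f \<in> D \<and> g \<in> D \<and> closed_under_series_ops D"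
  shows "closed_under_series_ops C"
  unfolding closed_under_series_ops_def
proof (intro conjI ballI allI impI)
  fix f g assume "f \<in> C" "g \<in> C"
  then obtain D where D: "D \<subseteq> C" "f \<in> D" "g \<in> D" "closed_under_series_ops D" using assms by meson
  show "f + g \<in> C" "f * g \<in> C" using D unfolding closed_under_series_ops_def by blast+
  show "g oo f \<in> C" if "fps_nth f 0 = 0 \<and> fps_nth f 1 = 1"
    using D that unfolding closed_under_series_ops_def by blast
next
  fix f assume "f \<in> C"
  then obtain D where D: "D \<subseteq> C" "f \<in> D" "closed_under_series_ops D" using assms by meson
  show "fps_cpow f s \<in> C" if "fps_nth f 0 = 1" for s
    using D that unfolding closed_under_series_ops_def by blast
  show "fps_inv f \<in> C" if "fps_nth f 0 = 0 \<and> fps_nth f 1 = 1"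
    using D that unfolding closed_under_series_ops_def by blast
qed

lemma closed_under_series_ops_gevrey2:
  assumes "\<alpha> > 1" "\<beta> > 0"
  shows "closed_under_series_ops (gevrey2 \<alpha> \<beta>)"
proof (rule closed_under_series_ops_directed)
  fix f g assume "f \<in> gevrey2 \<alpha> \<beta>" "g \<in> gevrey2 \<alpha> \<beta>"
  then obtain \<Gamma> where "f \<in> gevrey3 \<alpha> \<beta> \<Gamma>" "g \<in> gevrey3 \<alpha> \<beta> \<Gamma>"
    by (rule gevrey2_common[OF assms(2)])
  then show "\<exists>D. D \<subseteq> gevrey2 \<alpha> \<beta> \<and> f \<in> D \<and> g \<in> D \<and> closed_under_series_ops D"
    using closed_under_series_ops_gevrey3[OF assms, of \<Gamma>]
    by (intro exI[of _ "gevrey3 \<alpha> \<beta> \<Gamma>"]) (auto simp: gevrey2_def)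
qed

lemma closed_under_series_ops_gevrey1:
  assumes "\<alpha> > 1"
  shows "closed_under_series_ops (gevrey1 \<alpha>)"
proof (rule closed_under_series_ops_directed)
  fix f g assume "f \<in> gevrey1 \<alpha>" "g \<in> gevrey1 \<alpha>"
  then obtain \<beta>1 \<beta>2 where \<beta>: "\<beta>1 > 0" "\<beta>2 > 0" "f \<in> gevrey2 \<alpha> \<beta>1" "g \<in> gevrey2 \<alpha> \<beta>2"
    by (auto simp: gevrey1_def)
  define \<beta> where "\<beta> = max \<beta>1 \<beta>2"
  have "f \<in> gevrey2 \<alpha> \<beta>" "g \<in> gevrey2 \<alpha> \<beta>" "\<beta> > 0"
    using gevrey2_mono[of \<beta>1 \<beta> \<alpha>] gevrey2_mono[of \<beta>2 \<beta> \<alpha>] \<beta> by (auto simp: \<beta>_def)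
  then show "\<exists>D. D \<subseteq> gevrey1 \<alpha> \<and> f \<in> D \<and> g \<in> D \<and> closed_under_series_ops D"
    using closed_under_series_ops_gevrey2[OF assms, of \<beta>]
    by (intro exI[of _ "gevrey2 \<alpha> \<beta>"]) (auto simp: gevrey1_def)
qed

section \<open>Dependence on the input modulo small series\<close>

text \<open>A nonzero early coefficient d_i would contribute d_i g_(n-i), of the size of g. Without
  such terms, the high part of g falls under the product remainder and the low part gives a
  polynomial multiple of d.\<close>

lemma gevrey3_mult_small:
  assumes "\<alpha> > 1" "\<beta> > 0"
  shows "\<exists>N. \<forall>d\<in>gevrey3 \<alpha> \<beta> \<rho>. \<forall>g\<in>gevrey3 \<alpha> \<beta> \<Gamma>.
    (\<forall>i<N. fps_nth d i = 0) \<longrightarrow> d * g \<in> gevrey3 \<alpha> \<beta> \<rho>"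
proof -
  \<comment> \<open>\<Gamma> and \<rho> come in no fixed order, and the remainder estimate takes one
    exponent for both factors.\<close>
  define M where "M = max \<Gamma> \<rho>"
  have sub: "gevrey3 \<alpha> \<beta> \<rho> \<subseteq> gevrey3 \<alpha> \<beta> M" "gevrey3 \<alpha> \<beta> \<Gamma> \<subseteq> gevrey3 \<alpha> \<beta> M"
    by (rule gevrey3_mono; use assms in \<open>simp add: M_def\<close>)+
  interpret M: gevrey_class \<alpha> \<beta> "gevrey3 \<alpha> \<beta> M" by (rule gevrey_class_gevrey3[OF assms])
  interpret R: gevrey_class \<alpha> \<beta> "gevrey3 \<alpha> \<beta> \<rho>" by (rule gevrey_class_gevrey3[OF assms])
  obtain K where K: "\<forall>f\<in>gevrey3 \<alpha> \<beta> M. \<forall>g\<in>gevrey3 \<alpha> \<beta> M.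
    (\<forall>i<K. fps_nth f i = 0) \<longrightarrow> (\<forall>i<K. fps_nth g i = 0) \<longrightarrow> f * g \<in> gevrey3 \<alpha> \<beta> \<rho>"
    using gevrey3_mult_remainder[OF M.\<alpha>_ge assms(2)] by blast
  show ?thesis
  proof (intro exI[of _ K] ballI impI)
    fix d g assume d: "d \<in> gevrey3 \<alpha> \<beta> \<rho>" and g: "g \<in> gevrey3 \<alpha> \<beta> \<Gamma>" and d0: "\<forall>i<K. fps_nth d i = 0"
    have "d * (g - fps_cutoff K g) \<in> gevrey3 \<alpha> \<beta> \<rho>"
      using d g d0 sub by (intro K[rule_format] M.diff M.cutoff) auto
    moreover have "fps_cutoff K g * d \<in> gevrey3 \<alpha> \<beta> \<rho>" by (rule R.cutoff_mult[OF d])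
    ultimately have "d * (g - fps_cutoff K g) + fps_cutoff K g * d \<in> gevrey3 \<alpha> \<beta> \<rho>" by (rule R.add)
    then show "d * g \<in> gevrey3 \<alpha> \<beta> \<rho>" by (simp add: algebra_simps)
  qed
qed

text \<open>The main part \<open>comp_top K f d\<close> is linear in d and stays at order \<rho>;
  the rest is the composition remainder.\<close>

lemma gevrey3_compose_small:
  assumes "\<alpha> > 1" "\<beta> > 0"
  shows "\<exists>N. \<forall>d\<in>gevrey3 \<alpha> \<beta> \<rho>. \<forall>f\<in>gevrey3 \<alpha> \<beta> \<Gamma>.
    fps_nth f 0 = 0 \<longrightarrow> fps_nth f 1 = 1 \<longrightarrow> (\<forall>i<N. fps_nth d i = 0) \<longrightarrow> d oo f \<in> gevrey3 \<alpha> \<beta> \<rho>"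
proof -
  define M where "M = max \<Gamma> \<rho>"
  have sub: "gevrey3 \<alpha> \<beta> \<rho> \<subseteq> gevrey3 \<alpha> \<beta> M" "gevrey3 \<alpha> \<beta> \<Gamma> \<subseteq> gevrey3 \<alpha> \<beta> M"
    by (rule gevrey3_mono; use assms in \<open>simp add: M_def\<close>)+
  interpret R: gevrey_class \<alpha> \<beta> "gevrey3 \<alpha> \<beta> \<rho>" by (rule gevrey_class_gevrey3[OF assms])
  obtain K where K: "\<forall>f\<in>gevrey3 \<alpha> \<beta> M. \<forall>g\<in>gevrey3 \<alpha> \<beta> M.
    fps_nth f 0 = 0 \<longrightarrow> fps_nth f 1 = 1 \<longrightarrow> (\<forall>i<K. fps_nth g i = 0) \<longrightarrow>
    (g oo f) - comp_top K f g \<in> gevrey3 \<alpha> \<beta> \<rho>"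
    using gevrey3_compose_remainder[OF assms] by blast
  show ?thesis
  proof (intro exI[of _ K] ballI impI)
    fix d f assume d: "d \<in> gevrey3 \<alpha> \<beta> \<rho>" and f: "f \<in> gevrey3 \<alpha> \<beta> \<Gamma>" "fps_nth f 0 = 0" "fps_nth f 1 = 1"
      and d0: "\<forall>i<K. fps_nth d i = 0"
    have "(d oo f) - comp_top K f d \<in> gevrey3 \<alpha> \<beta> \<rho>"
      using d f d0 sub by (intro K[rule_format]) auto
    then have "((d oo f) - comp_top K f d) + comp_top K f d \<in> gevrey3 \<alpha> \<beta> \<rho>"
      by (rule R.add[OF _ R.comp_top[OF d f(2,3)]])
    then show "d oo f \<in> gevrey3 \<alpha> \<beta> \<rho>" by simp
  qed
qed

text \<open>A cutoff of g contributes differences of powers, each a multiple of f - f'. For the rest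
  of g the main parts coincide by \<open>comp_top_cong\<close>, leaving two remainders.\<close>

lemma gevrey3_compose_diff_right:
  assumes "\<alpha> > 1" "\<beta> > 0"
  shows "\<exists>N. \<forall>g\<in>gevrey3 \<alpha> \<beta> \<Gamma>. \<forall>f\<in>gevrey3 \<alpha> \<beta> \<Gamma>. \<forall>f'\<in>gevrey3 \<alpha> \<beta> \<Gamma>.
    fps_nth f 0 = 0 \<longrightarrow> fps_nth f 1 = 1 \<longrightarrow> fps_nth f' 0 = 0 \<longrightarrow> fps_nth f' 1 = 1 \<longrightarrow>
    f - f' \<in> gevrey3 \<alpha> \<beta> \<rho> \<longrightarrow> same_initial N f f' \<longrightarrow> (g oo f) - (g oo f') \<in> gevrey3 \<alpha> \<beta> \<rho>"
proof -
  interpret G: gevrey_class \<alpha> \<beta> "gevrey3 \<alpha> \<beta> \<Gamma>" by (rule gevrey_class_gevrey3[OF assms])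
  interpret R: gevrey_class \<alpha> \<beta> "gevrey3 \<alpha> \<beta> \<rho>" by (rule gevrey_class_gevrey3[OF assms])
  obtain K where K: "\<forall>f\<in>gevrey3 \<alpha> \<beta> \<Gamma>. \<forall>g\<in>gevrey3 \<alpha> \<beta> \<Gamma>.
    fps_nth f 0 = 0 \<longrightarrow> fps_nth f 1 = 1 \<longrightarrow> (\<forall>i<K. fps_nth g i = 0) \<longrightarrow>
    (g oo f) - comp_top K f g \<in> gevrey3 \<alpha> \<beta> \<rho>"
    using gevrey3_compose_remainder[OF assms] by blast
  obtain L where L: "\<forall>d\<in>gevrey3 \<alpha> \<beta> \<rho>. \<forall>g\<in>gevrey3 \<alpha> \<beta> \<Gamma>.
    (\<forall>i<L. fps_nth d i = 0) \<longrightarrow> d * g \<in> gevrey3 \<alpha> \<beta> \<rho>"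
    using gevrey3_mult_small[OF assms] by blast
  show ?thesis
  proof (intro exI[of _ "max (Suc K) L"] ballI impI)
    fix g f f'
    assume g: "g \<in> gevrey3 \<alpha> \<beta> \<Gamma>" and f: "f \<in> gevrey3 \<alpha> \<beta> \<Gamma>" and f': "f' \<in> gevrey3 \<alpha> \<beta> \<Gamma>"
      and n: "fps_nth f 0 = 0" "fps_nth f 1 = 1" "fps_nth f' 0 = 0" "fps_nth f' 1 = 1"
      and d: "f - f' \<in> gevrey3 \<alpha> \<beta> \<rho>" and same: "same_initial (max (Suc K) L) f f'"
    define p where "p = fps_cutoff K g"
    define r where "r = g - p"
    have r: "r \<in> gevrey3 \<alpha> \<beta> \<Gamma>" "\<forall>i<K. fps_nth r i = 0"
      unfolding r_def p_def using g by (auto intro: G.diff G.cutoff)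
    have "comp_top K f r = comp_top K f' r"
      using same n by (intro comp_top_cong) (auto simp: same_initial_def)
    then have "(r oo f) - (r oo f') = ((r oo f) - comp_top K f r) - ((r oo f') - comp_top K f' r)" by simp
    also have "\<dots> \<in> gevrey3 \<alpha> \<beta> \<rho>"
    proof (rule R.diff)
      show "(r oo f) - comp_top K f r \<in> gevrey3 \<alpha> \<beta> \<rho>" using K r f n by blast
      show "(r oo f') - comp_top K f' r \<in> gevrey3 \<alpha> \<beta> \<rho>" using K r f' n by blast
    qed
    finally have 1: "(r oo f) - (r oo f') \<in> gevrey3 \<alpha> \<beta> \<rho>" .
    have "f ^ k - f' ^ k \<in> gevrey3 \<alpha> \<beta> \<rho>" for k
    proof -
      have "f ^ k - f' ^ k = (f - f') * (\<Sum>i<k. f' ^ (k - Suc i) * f ^ i)"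
        by (rule power_diff_sumr2)
      also have "\<dots> \<in> gevrey3 \<alpha> \<beta> \<rho>"
        using d f f' same by (intro L[rule_format] G.sum G.mult G.power) (auto simp: same_initial_def)
      finally show ?thesis .
    qed
    then have "(\<Sum>k<K. fps_const (fps_nth g k) * (f ^ k - f' ^ k)) \<in> gevrey3 \<alpha> \<beta> \<rho>"
      by (intro R.sum R.scale)
    also have "(\<Sum>k<K. fps_const (fps_nth g k) * (f ^ k - f' ^ k)) = (p oo f) - (p oo f')"
      unfolding p_def by (simp add: fps_cutoff_compose n right_diff_distrib sum_subtractf)
    finally have "((r oo f) - (r oo f')) + ((p oo f) - (p oo f')) \<in> gevrey3 \<alpha> \<beta> \<rho>"
      by (rule R.add[OF 1])
    then show "(g oo f) - (g oo f') \<in> gevrey3 \<alpha> \<beta> \<rho>"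
      by (simp add: r_def fps_compose_sub_distrib)
  qed
qed

text \<open>Both powers are compositions with the same outer series once the linear coefficients
  agree, so \<open>N\<close> is at least 2. A vanishing linear coefficient is removed by the factor
  1 + x.\<close>

lemma gevrey3_cpow_diff:
  assumes "\<alpha> > 1" "\<beta> > 0"
  shows "\<exists>N. \<forall>f\<in>gevrey3 \<alpha> \<beta> \<Gamma>. \<forall>f'\<in>gevrey3 \<alpha> \<beta> \<Gamma>. \<forall>s.
    fps_nth f 0 = 1 \<longrightarrow> fps_nth f' 0 = 1 \<longrightarrow> f - f' \<in> gevrey3 \<alpha> \<beta> \<rho> \<longrightarrow> same_initial N f f' \<longrightarrow>
    fps_cpow f s - fps_cpow f' s \<in> gevrey3 \<alpha> \<beta> \<rho>"
proof -
  interpret G: gevrey_class \<alpha> \<beta> "gevrey3 \<alpha> \<beta> \<Gamma>" by (rule gevrey_class_gevrey3[OF assms])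
  interpret R: gevrey_class \<alpha> \<beta> "gevrey3 \<alpha> \<beta> \<rho>" by (rule gevrey_class_gevrey3[OF assms])
  obtain L where L: "\<forall>g\<in>gevrey3 \<alpha> \<beta> \<Gamma>. \<forall>f\<in>gevrey3 \<alpha> \<beta> \<Gamma>. \<forall>f'\<in>gevrey3 \<alpha> \<beta> \<Gamma>.
    fps_nth f 0 = 0 \<longrightarrow> fps_nth f 1 = 1 \<longrightarrow> fps_nth f' 0 = 0 \<longrightarrow> fps_nth f' 1 = 1 \<longrightarrow>
    f - f' \<in> gevrey3 \<alpha> \<beta> \<rho> \<longrightarrow> same_initial L f f' \<longrightarrow> (g oo f) - (g oo f') \<in> gevrey3 \<alpha> \<beta> \<rho>"
    using gevrey3_compose_diff_right[OF assms, of \<Gamma> \<rho>] by (elim exE) rule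
  define N where "N = max 2 L"
  have *: "fps_cpow f s - fps_cpow f' s \<in> gevrey3 \<alpha> \<beta> \<rho>"
    if f: "f \<in> gevrey3 \<alpha> \<beta> \<Gamma>" "fps_nth f 0 = 1" and f': "f' \<in> gevrey3 \<alpha> \<beta> \<Gamma>" "fps_nth f' 0 = 1"
      and d: "f - f' \<in> gevrey3 \<alpha> \<beta> \<rho>" and same: "same_initial N f f'" and c: "fps_nth f 1 \<noteq> 0" for f f' s
  proof -
    define c where "c = fps_nth f 1"
    have c': "fps_nth f' 1 = c" using same by (simp add: c_def same_initial_def N_def)
    have c0: "c \<noteq> 0" using \<open>fps_nth f 1 \<noteq> 0\<close> by (simp add: c_def)
    define u u' where "u = fps_const (1 / c) * (f - 1)" and "u' = fps_const (1 / c) * (f' - 1)"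
    have "u - u' = fps_const (1 / c) * (f - f')" by (simp add: u_def u'_def algebra_simps)
    then have du: "u - u' \<in> gevrey3 \<alpha> \<beta> \<rho>" using d by (simp add: R.scale)
    have in_G: "u \<in> gevrey3 \<alpha> \<beta> \<Gamma>" "u' \<in> gevrey3 \<alpha> \<beta> \<Gamma>"
      unfolding u_def u'_def using f f' by (intro G.scale G.diff G.one; simp)+
    have init: "fps_nth u 0 = 0" "fps_nth u 1 = 1" "fps_nth u' 0 = 0" "fps_nth u' 1 = 1"
      using f(2) f'(2) c0 c' c_def[symmetric] by (simp_all add: u_def u'_def)
    have "same_initial L u u'"
      using same by (auto simp: u_def u'_def same_initial_def N_def)
    with in_G init du have "((fps_binomial s oo (fps_const c * fps_X)) oo u) -
        ((fps_binomial s oo (fps_const c * fps_X)) oo u') \<in> gevrey3 \<alpha> \<beta> \<rho>"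
      by (intro L[rule_format] G.binomial_scaled)
    then show ?thesis
      using fps_cpow_conv_normalized[OF f(2) c_def[symmetric] c0, of s] fps_cpow_conv_normalized[OF f'(2) c' c0, of s]
      by (simp only: u_def u'_def)
  qed
  show ?thesis
  proof (intro exI[of _ N] ballI allI impI)
    fix f f' s
    assume f: "f \<in> gevrey3 \<alpha> \<beta> \<Gamma>" and f': "f' \<in> gevrey3 \<alpha> \<beta> \<Gamma>"
      and n: "fps_nth f 0 = 1" "fps_nth f' 0 = 1"
      and d: "f - f' \<in> gevrey3 \<alpha> \<beta> \<rho>" and same: "same_initial N f f'"
    show "fps_cpow f s - fps_cpow f' s \<in> gevrey3 \<alpha> \<beta> \<rho>"
    proof (cases "fps_nth f 1 = 0")
      case False then show ?thesis using f f' n d same by (intro *)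
    next
      case True
      have "fps_cpow (f * (1 + fps_X)) s - fps_cpow (f' * (1 + fps_X)) s \<in> gevrey3 \<alpha> \<beta> \<rho>"
      proof (rule *)
        show "f * (1 + fps_X) - f' * (1 + fps_X) \<in> gevrey3 \<alpha> \<beta> \<rho>"
          using R.mult[OF d R.add[OF R.one R.X]] by (simp add: algebra_simps)
        show "same_initial N (f * (1 + fps_X)) (f' * (1 + fps_X))"
          using same by (rule same_initial_mult) (simp add: same_initial_def)
        show "fps_nth (f * (1 + fps_X)) 1 \<noteq> 0" using n True by (simp add: distrib_left)
        show "f * (1 + fps_X) \<in> gevrey3 \<alpha> \<beta> \<Gamma>" "f' * (1 + fps_X) \<in> gevrey3 \<alpha> \<beta> \<Gamma>"
          using f f' by (intro G.mult G.add G.one G.X; simp)+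
      qed (use n in auto)
      from R.mult[OF this R.binomial[of "- s"]] show ?thesis
        unfolding fps_cpow_conv_mult_one_plus_X[OF n(1)] fps_cpow_conv_mult_one_plus_X[OF n(2)]
        by (simp add: left_diff_distrib)
    qed
  qed
qed

text \<open>Write f' oo y = x + e with e = (f' - f) oo y, which is small. Then y = y' oo (x + e), so
  y - y' is the effect on y' of perturbing the inner series x by e.\<close>

lemma gevrey3_inverse_diff:
  assumes "\<alpha> > 1" "\<beta> > 0"
  shows "\<exists>N. \<forall>f\<in>gevrey3 \<alpha> \<beta> \<Gamma>. \<forall>f'\<in>gevrey3 \<alpha> \<beta> \<Gamma>.
    fps_nth f 0 = 0 \<longrightarrow> fps_nth f 1 = 1 \<longrightarrow> fps_nth f' 0 = 0 \<longrightarrow> fps_nth f' 1 = 1 \<longrightarrow>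
    f - f' \<in> gevrey3 \<alpha> \<beta> \<rho> \<longrightarrow> same_initial N f f' \<longrightarrow> fps_inv f - fps_inv f' \<in> gevrey3 \<alpha> \<beta> \<rho>"
proof -
  define M where "M = max \<Gamma> \<rho>"
  have sub: "gevrey3 \<alpha> \<beta> \<rho> \<subseteq> gevrey3 \<alpha> \<beta> M" "gevrey3 \<alpha> \<beta> \<Gamma> \<subseteq> gevrey3 \<alpha> \<beta> M"
    by (rule gevrey3_mono; use assms in \<open>simp add: M_def\<close>)+
  interpret M: gevrey_class \<alpha> \<beta> "gevrey3 \<alpha> \<beta> M" by (rule gevrey_class_gevrey3[OF assms])
  interpret G: gevrey_class \<alpha> \<beta> "gevrey3 \<alpha> \<beta> \<Gamma>" by (rule gevrey_class_gevrey3[OF assms])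
  interpret R: gevrey_class \<alpha> \<beta> "gevrey3 \<alpha> \<beta> \<rho>" by (rule gevrey_class_gevrey3[OF assms])
  obtain K where K: "\<forall>d\<in>gevrey3 \<alpha> \<beta> \<rho>. \<forall>f\<in>gevrey3 \<alpha> \<beta> \<Gamma>.
    fps_nth f 0 = 0 \<longrightarrow> fps_nth f 1 = 1 \<longrightarrow> (\<forall>i<K. fps_nth d i = 0) \<longrightarrow> d oo f \<in> gevrey3 \<alpha> \<beta> \<rho>"
    using gevrey3_compose_small[OF assms, of \<rho> \<Gamma>] by (elim exE) rule
  obtain L where L: "\<forall>g\<in>gevrey3 \<alpha> \<beta> M. \<forall>f\<in>gevrey3 \<alpha> \<beta> M. \<forall>f'\<in>gevrey3 \<alpha> \<beta> M.
    fps_nth f 0 = 0 \<longrightarrow> fps_nth f 1 = 1 \<longrightarrow> fps_nth f' 0 = 0 \<longrightarrow> fps_nth f' 1 = 1 \<longrightarrow>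
    f - f' \<in> gevrey3 \<alpha> \<beta> \<rho> \<longrightarrow> same_initial L f f' \<longrightarrow> (g oo f) - (g oo f') \<in> gevrey3 \<alpha> \<beta> \<rho>"
    using gevrey3_compose_diff_right[OF assms, of M \<rho>] by (elim exE) rule
  define N where "N = max 2 (max K L)"
  show ?thesis
  proof (intro exI[of _ N] ballI impI)
    fix f f'
    assume f: "f \<in> gevrey3 \<alpha> \<beta> \<Gamma>" and f': "f' \<in> gevrey3 \<alpha> \<beta> \<Gamma>"
      and n: "fps_nth f 0 = 0" "fps_nth f 1 = 1" and n': "fps_nth f' 0 = 0" "fps_nth f' 1 = 1"
      and d: "f - f' \<in> gevrey3 \<alpha> \<beta> \<rho>" and same: "same_initial N f f'"
    define y y' where "y = fps_inv f" and "y' = fps_inv f'"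
    have y: "y \<in> gevrey3 \<alpha> \<beta> \<Gamma>" "y' \<in> gevrey3 \<alpha> \<beta> \<Gamma>"
      unfolding y_def y'_def by (rule G.inverse[OF f n], rule G.inverse[OF f' n'])
    have fy: "f oo y = fps_X" unfolding y_def using n by (intro fps_inv_right) auto
    have y0: "fps_nth y 0 = 0" by (simp add: y_def fps_inv_def)
    have "fps_nth (f oo y) 1 = fps_nth y 1" using n by (simp add: fps_compose_nth)
    then have y1: "fps_nth y 1 = 1" by (simp add: fy)
    define e where "e = (f' - f) oo y"
    have e0: "fps_nth e i = 0" if "i < N" for i
      unfolding e_def using same y0 that by (intro compose_nth_eq_0[of y N]) (auto simp: same_initial_def)
    have "f' - f = fps_const (-1) * (f - f')" by (simp flip: fps_const_neg)
    then have "f' - f \<in> gevrey3 \<alpha> \<beta> \<rho>" using d by (simp only: R.scale)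
    then have e: "e \<in> gevrey3 \<alpha> \<beta> \<rho>"
      unfolding e_def using same y y0 y1 by (intro K[rule_format]) (auto simp: same_initial_def N_def)
    have f'y: "f' oo y = fps_X + e" by (simp add: e_def fps_compose_sub_distrib fy)
    have "y' oo (fps_X + e) = (y' oo f') oo y"
      unfolding f'y[symmetric] using n' y0 by (simp add: fps_compose_assoc)
    also have "y' oo f' = fps_X" unfolding y'_def using n' by (intro fps_inv) auto
    finally have y': "y' oo (fps_X + e) = y" using y0 by simp
    have "(y' oo (fps_X + e)) - (y' oo fps_X) \<in> gevrey3 \<alpha> \<beta> \<rho>"
    proof (intro L[rule_format])
      show "y' \<in> gevrey3 \<alpha> \<beta> M" "fps_X + e \<in> gevrey3 \<alpha> \<beta> M"
        using y e sub by (auto intro: M.add M.X)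
      show "same_initial L (fps_X + e) fps_X" using e0 by (simp add: same_initial_def N_def)
    qed (use e e0[of 0] e0[of 1] M.X in \<open>auto simp: N_def\<close>)
    then show "fps_inv f - fps_inv f' \<in> gevrey3 \<alpha> \<beta> \<rho>" unfolding y' by (simp add: y_def y'_def)
  qed
qed

lemma same_initial_le: "same_initial N f f' \<Longrightarrow> M \<le> N \<Longrightarrow> same_initial M f f'"
  by (simp add: same_initial_def)

text \<open>The product splits as (f - f') g + (g - g') f', the composition as (g - g') oo f plus
  (g' oo f) - (g' oo f'). Phrased through differences, the result serves both kinds of
  expansions.\<close>

theorem series_ops_respect_gevrey3:
  assumes "\<alpha> > 1" "\<beta> > 0"
  shows "\<exists>N. series_ops_respect
    (\<lambda>f f'. f \<in> gevrey3 \<alpha> \<beta> \<Gamma> \<and> f' \<in> gevrey3 \<alpha> \<beta> \<Gamma> \<and> f - f' \<in> gevrey3 \<alpha> \<beta> \<rho> \<and> same_initial N f f')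
    (\<lambda>f f'. f - f' \<in> gevrey3 \<alpha> \<beta> \<rho>)"
proof -
  interpret R: gevrey_class \<alpha> \<beta> "gevrey3 \<alpha> \<beta> \<rho>" by (rule gevrey_class_gevrey3[OF assms])
  obtain N1 where N1: "\<And>d g. d \<in> gevrey3 \<alpha> \<beta> \<rho> \<Longrightarrow> g \<in> gevrey3 \<alpha> \<beta> \<Gamma> \<Longrightarrow>
    (\<forall>i<N1. fps_nth d i = 0) \<Longrightarrow> d * g \<in> gevrey3 \<alpha> \<beta> \<rho>"
    using gevrey3_mult_small[OF assms, of \<rho> \<Gamma>] by metis
  obtain N2 where N2: "\<And>d f. d \<in> gevrey3 \<alpha> \<beta> \<rho> \<Longrightarrow> f \<in> gevrey3 \<alpha> \<beta> \<Gamma> \<Longrightarrow>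
    fps_nth f 0 = 0 \<Longrightarrow> fps_nth f 1 = 1 \<Longrightarrow> (\<forall>i<N2. fps_nth d i = 0) \<Longrightarrow> d oo f \<in> gevrey3 \<alpha> \<beta> \<rho>"
    using gevrey3_compose_small[OF assms, of \<rho> \<Gamma>] by metis
  obtain N3 where N3: "\<And>g f f'. g \<in> gevrey3 \<alpha> \<beta> \<Gamma> \<Longrightarrow> f \<in> gevrey3 \<alpha> \<beta> \<Gamma> \<Longrightarrow> f' \<in> gevrey3 \<alpha> \<beta> \<Gamma> \<Longrightarrow>
    fps_nth f 0 = 0 \<Longrightarrow> fps_nth f 1 = 1 \<Longrightarrow> fps_nth f' 0 = 0 \<Longrightarrow> fps_nth f' 1 = 1 \<Longrightarrow>
    f - f' \<in> gevrey3 \<alpha> \<beta> \<rho> \<Longrightarrow> same_initial N3 f f' \<Longrightarrow> (g oo f) - (g oo f') \<in> gevrey3 \<alpha> \<beta> \<rho>"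
    using gevrey3_compose_diff_right[OF assms, of \<Gamma> \<rho>] by metis
  obtain N4 where N4: "\<And>f f' s. f \<in> gevrey3 \<alpha> \<beta> \<Gamma> \<Longrightarrow> f' \<in> gevrey3 \<alpha> \<beta> \<Gamma> \<Longrightarrow>
    fps_nth f 0 = 1 \<Longrightarrow> fps_nth f' 0 = 1 \<Longrightarrow> f - f' \<in> gevrey3 \<alpha> \<beta> \<rho> \<Longrightarrow> same_initial N4 f f' \<Longrightarrow>
    fps_cpow f s - fps_cpow f' s \<in> gevrey3 \<alpha> \<beta> \<rho>"
    using gevrey3_cpow_diff[OF assms, of \<Gamma> \<rho>] by metis
  obtain N5 where N5: "\<And>f f'. f \<in> gevrey3 \<alpha> \<beta> \<Gamma> \<Longrightarrow> f' \<in> gevrey3 \<alpha> \<beta> \<Gamma> \<Longrightarrow>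
    fps_nth f 0 = 0 \<Longrightarrow> fps_nth f 1 = 1 \<Longrightarrow> fps_nth f' 0 = 0 \<Longrightarrow> fps_nth f' 1 = 1 \<Longrightarrow>
    f - f' \<in> gevrey3 \<alpha> \<beta> \<rho> \<Longrightarrow> same_initial N5 f f' \<Longrightarrow> fps_inv f - fps_inv f' \<in> gevrey3 \<alpha> \<beta> \<rho>"
    using gevrey3_inverse_diff[OF assms, of \<Gamma> \<rho>] by metis
  define N where "N = Max {N1, N2, N3, N4, N5}"
  have N: "N1 \<le> N" "N2 \<le> N" "N3 \<le> N" "N4 \<le> N" "N5 \<le> N" by (auto simp: N_def)
  define P where "P f f' \<longleftrightarrow> f \<in> gevrey3 \<alpha> \<beta> \<Gamma> \<and> f' \<in> gevrey3 \<alpha> \<beta> \<Gamma> \<and>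
    f - f' \<in> gevrey3 \<alpha> \<beta> \<rho> \<and> same_initial N f f'" for f f'
  have zero: "fps_nth (f - f') i = 0" if "P f f'" "i < N" for f f' i
    using that by (simp add: P_def same_initial_def)
  have "f + g - (f' + g') \<in> gevrey3 \<alpha> \<beta> \<rho>" if "P f f'" "P g g'" for f f' g g'
    using R.add[of "f - f'" "g - g'"] that by (simp add: P_def algebra_simps)
  moreover have "f * g - f' * g' \<in> gevrey3 \<alpha> \<beta> \<rho>" if "P f f'" "P g g'" for f f' g g'
  proof -
    have "(f - f') * g \<in> gevrey3 \<alpha> \<beta> \<rho>" "(g - g') * f' \<in> gevrey3 \<alpha> \<beta> \<rho>"
      using that zero[OF that(1)] zero[OF that(2)] N(1) by (auto simp: P_def intro!: N1)
    from R.add[OF this] show ?thesis by (simp add: algebra_simps)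
  qed
  moreover have "(g oo f) - (g' oo f') \<in> gevrey3 \<alpha> \<beta> \<rho>"
    if "P f f'" "P g g'" "fps_nth f 0 = 0" "fps_nth f 1 = 1" "fps_nth f' 0 = 0" "fps_nth f' 1 = 1" for f f' g g'
  proof -
    have "(g - g') oo f \<in> gevrey3 \<alpha> \<beta> \<rho>"
      using that zero[OF that(2)] N(2) by (auto simp: P_def intro!: N2)
    moreover have "(g' oo f) - (g' oo f') \<in> gevrey3 \<alpha> \<beta> \<rho>"
      using that same_initial_le[OF _ N(3)] by (intro N3) (auto simp: P_def)
    ultimately show ?thesis using R.add by (fastforce simp: fps_compose_sub_distrib)
  qed
  moreover have "fps_cpow f s - fps_cpow f' s \<in> gevrey3 \<alpha> \<beta> \<rho>"
    if "P f f'" "fps_nth f 0 = 1" "fps_nth f' 0 = 1" for f f' s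
    using that same_initial_le[OF _ N(4)] by (intro N4) (auto simp: P_def)
  moreover have "fps_inv f - fps_inv f' \<in> gevrey3 \<alpha> \<beta> \<rho>"
    if "P f f'" "fps_nth f 0 = 0" "fps_nth f 1 = 1" "fps_nth f' 0 = 0" "fps_nth f' 1 = 1" for f f'
    using that same_initial_le[OF _ N(5)] by (intro N5) (auto simp: P_def)
  ultimately have "series_ops_respect P (\<lambda>f f'. f - f' \<in> gevrey3 \<alpha> \<beta> \<rho>)"
    unfolding series_ops_respect_def by blast
  then show ?thesis unfolding P_def by blast
qed

section \<open>Expansions in real powers\<close>

definition npow :: "real \<Rightarrow> nat \<Rightarrow> complex" where
  "npow x n = of_real (real n powr x)"

lemma norm_npow: "cmod (npow x n) = real n powr x"
  by (simp add: npow_def)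

lemma npow_nonzero: "n > 0 \<Longrightarrow> npow x n \<noteq> 0"
  by (simp add: npow_def)

lemma npow_add: "npow (x + y) n = npow x n * npow y n"
  by (simp add: npow_def powr_add)

lemma npow_bigo:
  assumes "x \<le> y"
  shows "npow x \<in> O(npow y)"
proof (rule bigoI[of _ 1], rule eventually_mono[OF eventually_ge_at_top[of 1]])
  fix n :: nat assume "n \<ge> 1"
  then have "real n powr x \<le> real n powr y" using assms by (intro powr_mono) auto
  then show "cmod (npow x n) \<le> 1 * cmod (npow y n)" by (simp add: npow_def)
qed

lemma npow_smallo:
  assumes "x < y"
  shows "npow x \<in> o(npow y)"
proof -
  have "(\<lambda>n. real n powr x) \<in> o(\<lambda>n. real n powr y)" using assms by real_asymp
  then have "(\<lambda>n. norm (npow x n)) \<in> o(\<lambda>n. norm (npow y n))" by (simp add: npow_def)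
  then show ?thesis by simp
qed

lemma bigo_npow_mono: "h \<in> O(npow x) \<Longrightarrow> x \<le> y \<Longrightarrow> h \<in> O(npow y)"
  by (rule landau_o.big_trans[OF _ npow_bigo])

lemma sum_npow_bigo:
  assumes "\<And>x. x \<in> E \<Longrightarrow> x \<le> \<rho> \<or> c x = 0"
  shows "(\<lambda>n. \<Sum>x\<in>E. c x * npow x n) \<in> O(npow \<rho>)"
proof (rule big_sum_in_bigo)
  fix x assume "x \<in> E"
  then show "(\<lambda>n. c x * npow x n) \<in> O(npow \<rho>)"
    using assms[of x] npow_bigo[of x \<rho>] by (cases "c x = 0") auto
qed

text \<open>Otherwise the largest exponent above \<rho> with a nonzero coefficient would dominate,
  giving \<open>npow M \<in> o(npow M)\<close>.\<close>

lemma sum_npow_bigo_imp_zero: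
  assumes "finite E" "(\<lambda>n. \<Sum>x\<in>E. c x * npow x n) \<in> O(npow \<rho>)" "x \<in> E" "\<rho> < x"
  shows "c x = 0"
proof (rule ccontr)
  assume "c x \<noteq> 0"
  define E' where "E' = {x\<in>E. \<rho> < x \<and> c x \<noteq> 0}"
  have E': "finite E'" "E' \<noteq> {}" using assms \<open>c x \<noteq> 0\<close> by (auto simp: E'_def)
  define M where "M = Max E'"
  have M: "M \<in> E" "\<rho> < M" "c M \<noteq> 0" using Max_in[OF E'] by (auto simp: M_def E'_def)
  have "(\<lambda>n. \<Sum>x\<in>E - {M}. c x * npow x n) \<in> o(npow M)"
  proof (rule big_sum_in_smallo)
    fix x assume x: "x \<in> E - {M}"
    show "(\<lambda>n. c x * npow x n) \<in> o(npow M)"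
    proof (cases "c x = 0")
      case False
      have "x < M"
      proof (cases "\<rho> < x")
        case True
        then have "x \<le> M" unfolding M_def using x False E' by (intro Max_ge) (auto simp: E'_def)
        then show ?thesis using x by auto
      qed (use M in auto)
      then show ?thesis using npow_smallo by simp
    qed simp
  qed
  moreover have "(\<lambda>n. \<Sum>x\<in>E. c x * npow x n) \<in> o(npow M)"
    using landau_o.big_small_trans[OF assms(2) npow_smallo[OF M(2)]] .
  ultimately have "(\<lambda>n. (\<Sum>x\<in>E. c x * npow x n) - (\<Sum>x\<in>E - {M}. c x * npow x n)) \<in> o(npow M)"
    by (intro sum_in_smallo)
  also have "(\<lambda>n. (\<Sum>x\<in>E. c x * npow x n) - (\<Sum>x\<in>E - {M}. c x * npow x n)) = (\<lambda>n. c M * npow M n)"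
    using assms(1) M(1) by (simp add: sum.remove)
  finally have "npow M \<in> o(npow M)" using M(3) by simp
  then have "eventually (\<lambda>n. npow M n = 0) sequentially" by (simp add: landau_o.small_refl_iff)
  then have "eventually (\<lambda>n::nat. False) sequentially"
    using eventually_gt_at_top[of 0] by eventually_elim (use npow_nonzero in auto)
  then show False by simp
qed

text \<open>A coefficient function on all real exponents, with finite support above each bound. It
  is independent of the enumeration of exponents and of vanishing terms, hence unique, and covers
  both kinds of expansions.\<close>

definition expansion :: "(nat \<Rightarrow> complex) \<Rightarrow> (real \<Rightarrow> complex) \<Rightarrow> bool" where
  "expansion h c \<longleftrightarrow> (\<forall>\<rho>. finite {x. \<rho> < x \<and> c x \<noteq> 0} \<and>
     (\<lambda>n. h n - (\<Sum>x | \<rho> < x \<and> c x \<noteq> 0. c x * npow x n)) \<in> O(npow \<rho>))"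

lemma sum_above_eq:
  assumes "finite E" "\<And>x. \<rho> < x \<Longrightarrow> c x \<noteq> 0 \<Longrightarrow> x \<in> E" "\<And>x. x \<in> E \<Longrightarrow> c x \<noteq> 0 \<Longrightarrow> \<rho> < x"
  shows "(\<Sum>x | \<rho> < x \<and> c x \<noteq> 0. c x * npow x n) = (\<Sum>x\<in>E. c x * npow x n)"
  using assms by (intro sum.mono_neutral_left) auto

lemma expansionI:
  assumes "\<And>\<rho>. \<exists>E. finite E \<and> (\<forall>x. \<rho> < x \<and> c x \<noteq> 0 \<longrightarrow> x \<in> E) \<and>
    (\<lambda>n. h n - (\<Sum>x\<in>E. c x * npow x n)) \<in> O(npow \<rho>)"
  shows "expansion h c"
  unfolding expansion_def
proof (intro allI conjI)
  fix \<rho>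
  obtain E where E: "finite E" "\<And>x. \<rho> < x \<Longrightarrow> c x \<noteq> 0 \<Longrightarrow> x \<in> E"
    "(\<lambda>n. h n - (\<Sum>x\<in>E. c x * npow x n)) \<in> O(npow \<rho>)"
    using assms[of \<rho>] by (elim exE conjE) simp
  show "finite {x. \<rho> < x \<and> c x \<noteq> 0}" using E by (auto intro: finite_subset)
  have "(\<lambda>n. (h n - (\<Sum>x\<in>E. c x * npow x n)) + (\<Sum>x\<in>E - {x. \<rho> < x \<and> c x \<noteq> 0}. c x * npow x n)) \<in> O(npow \<rho>)"
    by (intro sum_in_bigo E(3) sum_npow_bigo) auto
  moreover have "(\<Sum>x\<in>E. c x * npow x n) = (\<Sum>x | \<rho> < x \<and> c x \<noteq> 0. c x * npow x n) +
      (\<Sum>x\<in>E - {x. \<rho> < x \<and> c x \<noteq> 0}. c x * npow x n)" for n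
    using E by (subst add.commute, intro sum.subset_diff) auto
  ultimately show "(\<lambda>n. h n - (\<Sum>x | \<rho> < x \<and> c x \<noteq> 0. c x * npow x n)) \<in> O(npow \<rho>)" by simp
qed

text \<open>Over the union of both supports the difference is one finite sum of powers, so
  \<open>sum_npow_bigo_imp_zero\<close> decides. This translates equality of coefficients into
  smallness of a difference; comparison with the zero expansion gives size bounds.\<close>

lemma expansion_diff_bigo_iff:
  assumes "expansion h c" "expansion h' c'"
  shows "(\<lambda>n. h n - h' n) \<in> O(npow \<rho>) \<longleftrightarrow> (\<forall>x>\<rho>. c x = c' x)"
proof -
  define S where "S c = {x. \<rho> < x \<and> c x \<noteq> 0}" for c :: "real \<Rightarrow> complex"
  have S: "finite (S c)" "finite (S c')"
    "(\<lambda>n. h n - (\<Sum>x\<in>S c. c x * npow x n)) \<in> O(npow \<rho>)"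
    "(\<lambda>n. h' n - (\<Sum>x\<in>S c'. c' x * npow x n)) \<in> O(npow \<rho>)"
    using assms by (auto simp: S_def expansion_def)
  define E where "E = S c \<union> S c'"
  have E: "finite E" using S by (simp add: E_def)
  have "(\<Sum>x\<in>S c. c x * npow x n) = (\<Sum>x\<in>E. c x * npow x n)"
    "(\<Sum>x\<in>S c'. c' x * npow x n) = (\<Sum>x\<in>E. c' x * npow x n)" for n
    using E by (auto simp: E_def S_def intro!: sum.mono_neutral_left)
  with S have 1: "(\<lambda>n. h n - (\<Sum>x\<in>E. c x * npow x n)) \<in> O(npow \<rho>)"
    "(\<lambda>n. h' n - (\<Sum>x\<in>E. c' x * npow x n)) \<in> O(npow \<rho>)" by simp_all
  define D where "D n = (\<Sum>x\<in>E. (c x - c' x) * npow x n)" for n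
  have D: "(h n - (\<Sum>x\<in>E. c x * npow x n)) - (h' n - (\<Sum>x\<in>E. c' x * npow x n)) = (h n - h' n) - D n" for n
    by (simp add: D_def left_diff_distrib sum_subtractf)
  have diff: "(\<lambda>n. (h n - h' n) - D n) \<in> O(npow \<rho>)"
    using sum_in_bigo(2)[OF 1] by (simp add: D)
  show ?thesis
  proof
    assume "(\<lambda>n. h n - h' n) \<in> O(npow \<rho>)"
    from sum_in_bigo(2)[OF this diff] have "D \<in> O(npow \<rho>)" by simp
    then have "c x - c' x = 0" if "x \<in> E" "\<rho> < x" for x
      using sum_npow_bigo_imp_zero[OF E, of "\<lambda>x. c x - c' x" \<rho> x] that by (simp add: D_def[abs_def])
    then show "\<forall>x>\<rho>. c x = c' x" by (fastforce simp: E_def S_def)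
  next
    assume eq: "\<forall>x>\<rho>. c x = c' x"
    have "D n = 0" for n
      unfolding D_def using eq by (intro sum.neutral) (auto simp: E_def S_def)
    with diff show "(\<lambda>n. h n - h' n) \<in> O(npow \<rho>)" by simp
  qed
qed

lemma expansion_zero: "expansion (\<lambda>n. 0) (\<lambda>x. 0)"
  by (simp add: expansion_def)


section \<open>Approximation by finite combinations of powers\<close>

text \<open>Exponents and coefficients may be chosen anew for each \<rho>, which makes closure
  properties easy to check; consistency between orders is recovered afterwards.\<close>

definition approximable :: "real set \<Rightarrow> real \<Rightarrow> (nat \<Rightarrow> complex) \<Rightarrow> bool" where
  "approximable S \<rho> h \<longleftrightarrow> (\<exists>E c. finite E \<and> E \<subseteq> S \<and> (\<lambda>n. h n - (\<Sum>x\<in>E. c x * npow x n)) \<in> O(npow \<rho>))"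

lemma approximable_add:
  assumes "approximable S \<rho> h" "approximable S \<rho> h'"
  shows "approximable S \<rho> (\<lambda>n. h n + h' n)"
proof -
  obtain E c where E: "finite E" "E \<subseteq> S" "(\<lambda>n. h n - (\<Sum>x\<in>E. c x * npow x n)) \<in> O(npow \<rho>)"
    using assms(1) by (auto simp: approximable_def)
  obtain F d where F: "finite F" "F \<subseteq> S" "(\<lambda>n. h' n - (\<Sum>x\<in>F. d x * npow x n)) \<in> O(npow \<rho>)"
    using assms(2) by (auto simp: approximable_def)
  define a where "a x = (if x \<in> E then c x else 0) + (if x \<in> F then d x else 0)" for x
  have "(\<Sum>x\<in>E \<union> F. a x * npow x n) = (\<Sum>x\<in>E. c x * npow x n) + (\<Sum>x\<in>F. d x * npow x n)" for n
  proof -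
    have "(\<Sum>x\<in>E \<union> F. a x * npow x n) =
        (\<Sum>x\<in>E \<union> F. if x \<in> E then c x * npow x n else 0) + (\<Sum>x\<in>E \<union> F. if x \<in> F then d x * npow x n else 0)"
      by (simp add: a_def distrib_right sum.distrib if_distrib[of "\<lambda>u. u * _"] cong: if_cong)
    also have "(\<Sum>x\<in>E \<union> F. if x \<in> E then c x * npow x n else 0) = (\<Sum>x\<in>E. c x * npow x n)"
      using E(1) F(1) by (intro sum.mono_neutral_cong_right) auto
    also have "(\<Sum>x\<in>E \<union> F. if x \<in> F then d x * npow x n else 0) = (\<Sum>x\<in>F. d x * npow x n)"
      using E(1) F(1) by (intro sum.mono_neutral_cong_right) auto
    finally show ?thesis .
  qed
  then have "(\<lambda>n. h n + h' n - (\<Sum>x\<in>E \<union> F. a x * npow x n)) \<in> O(npow \<rho>)"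
    using sum_in_bigo(1)[OF E(3) F(3)] by (simp add: algebra_simps)
  then show ?thesis using E F unfolding approximable_def
    by (intro exI[of _ "E \<union> F"] exI[of _ a]) auto
qed

lemma approximable_scale:
  assumes "approximable S \<rho> h"
  shows "approximable S \<rho> (\<lambda>n. a * h n)"
proof -
  obtain E c where E: "finite E" "E \<subseteq> S" "(\<lambda>n. h n - (\<Sum>x\<in>E. c x * npow x n)) \<in> O(npow \<rho>)"
    using assms by (auto simp: approximable_def)
  have "(\<lambda>n. a * (h n - (\<Sum>x\<in>E. c x * npow x n))) \<in> O(npow \<rho>)" using E(3) by (cases "a = 0") auto
  then have "(\<lambda>n. a * h n - (\<Sum>x\<in>E. a * c x * npow x n)) \<in> O(npow \<rho>)"
    by (simp add: right_diff_distrib sum_distrib_left mult.assoc)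
  then show ?thesis using E(1,2) unfolding approximable_def
    by (intro exI[of _ E] exI[of _ "\<lambda>x. a * c x"]) auto
qed

lemma approximable_bigo: "h \<in> O(npow \<rho>) \<Longrightarrow> approximable S \<rho> h"
  unfolding approximable_def by (intro exI[of _ "{}"]) auto

lemma approximable_npow: "x \<in> S \<Longrightarrow> approximable S \<rho> (npow x)"
  unfolding approximable_def by (intro exI[of _ "{x}"] exI[of _ "\<lambda>_. 1"]) simp

lemma approximable_sum:
  "(\<And>i. i \<in> A \<Longrightarrow> approximable S \<rho> (F i)) \<Longrightarrow> approximable S \<rho> (\<lambda>n. \<Sum>i\<in>A. F i n)"
  by (induction A rule: infinite_finite_induct) (auto intro: approximable_add approximable_bigo)

lemma approximable_cong:
  assumes "eventually (\<lambda>n. h n = h' n) sequentially" "approximable S \<rho> h"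
  shows "approximable S \<rho> h'"
proof -
  obtain E c where E: "finite E" "E \<subseteq> S" "(\<lambda>n. h n - (\<Sum>x\<in>E. c x * npow x n)) \<in> O(npow \<rho>)"
    using assms by (auto simp: approximable_def)
  have "eventually (\<lambda>n. h n - (\<Sum>x\<in>E. c x * npow x n) = h' n - (\<Sum>x\<in>E. c x * npow x n)) sequentially"
    using assms(1) by eventually_elim simp
  with E(3) have "(\<lambda>n. h' n - (\<Sum>x\<in>E. c x * npow x n)) \<in> O(npow \<rho>)"
    by (simp only: landau_o.big.in_cong)
  with E(1,2) show ?thesis unfolding approximable_def by (intro exI[of _ E] exI[of _ c] conjI)
qed

lemma expansion_imp_approximable:
  assumes "expansion h c" "\<And>x. c x \<noteq> 0 \<Longrightarrow> x \<in> S"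
  shows "approximable S \<rho> h"
proof -
  have "finite {x. \<rho> < x \<and> c x \<noteq> 0}"
    "(\<lambda>n. h n - (\<Sum>x | \<rho> < x \<and> c x \<noteq> 0. c x * npow x n)) \<in> O(npow \<rho>)"
    using assms(1) by (simp_all add: expansion_def)
  moreover have "{x. \<rho> < x \<and> c x \<noteq> 0} \<subseteq> S" using assms(2) by auto
  ultimately show ?thesis unfolding approximable_def by (intro exI conjI)
qed

text \<open>The coefficient at \<open>x\<close> is read off any approximation to an order below \<open>x\<close>.\<close>

lemma approximable_imp_expansion:
  assumes "\<And>\<rho>. approximable S \<rho> h"
  shows "\<exists>c. expansion h c \<and> (\<forall>x. c x \<noteq> 0 \<longrightarrow> x \<in> S)"
proof -
  define Q where "Q k E c \<longleftrightarrow> finite E \<and> E \<subseteq> S \<and>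
    (\<lambda>n. h n - (\<Sum>x\<in>E. c x * npow x n)) \<in> O(npow (- real k)) \<and> (\<forall>x. x \<notin> E \<longrightarrow> c x = 0)" for k :: nat and E c
  have "\<exists>E c. Q k E c" for k
  proof -
    obtain E c where E: "finite E" "E \<subseteq> S" "(\<lambda>n. h n - (\<Sum>x\<in>E. c x * npow x n)) \<in> O(npow (- real k))"
      using assms[of "- real k"] unfolding approximable_def by (elim exE conjE)
    have "(\<Sum>x\<in>E. (if x \<in> E then c x else 0) * npow x n) = (\<Sum>x\<in>E. c x * npow x n)" for n
      by (intro sum.cong) auto
    with E have "Q k E (\<lambda>x. if x \<in> E then c x else 0)" by (simp add: Q_def)
    then show ?thesis by (intro exI)
  qed
  then have "\<forall>k. \<exists>E. \<exists>c. Q k E c" by simp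
  from choice[OF this] obtain E where "\<forall>k. \<exists>c. Q k (E k) c" by (elim exE)
  from choice[OF this] obtain c where Q: "\<And>k. Q k (E k) (c k)" by auto
  have E: "finite (E k)" "E k \<subseteq> S" "x \<notin> E k \<Longrightarrow> c k x = 0"
    and O: "(\<lambda>n. h n - (\<Sum>x\<in>E k. c k x * npow x n)) \<in> O(npow (- real k))" for k x
    using Q[of k] by (simp_all add: Q_def)
  \<comment> \<open>The difference of two approximations is of the coarser order, so their
    coefficients above that order agree.\<close>
  have eq: "c k x = c l x" if "k \<le> l" "- real k < x" for k l x
  proof -
    define F where "F = insert x (E k \<union> E l)"
    have "(\<Sum>x\<in>E k. c k x * npow x n) = (\<Sum>x\<in>F. c k x * npow x n)"
      "(\<Sum>x\<in>E l. c l x * npow x n) = (\<Sum>x\<in>F. c l x * npow x n)" for n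
      using E by (auto simp: F_def intro!: sum.mono_neutral_left)
    then have "(\<lambda>n. h n - (\<Sum>x\<in>F. c k x * npow x n)) \<in> O(npow (- real k))"
      "(\<lambda>n. h n - (\<Sum>x\<in>F. c l x * npow x n)) \<in> O(npow (- real k))"
      using O[of k] bigo_npow_mono[OF O[of l], of "- real k"] that by simp_all
    from sum_in_bigo(2)[OF this(2,1)]
    have "(\<lambda>n. \<Sum>x\<in>F. (c k x - c l x) * npow x n) \<in> O(npow (- real k))"
      by (simp add: left_diff_distrib sum_subtractf)
    then have "c k x - c l x = 0"
      by (rule sum_npow_bigo_imp_zero[rotated]) (use E that in \<open>auto simp: F_def\<close>)
    then show ?thesis by simp
  qed
  \<comment> \<open>The order is taken just fine enough to lie strictly below
    \<open>x\<close>.\<close>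
  define d where "d x = c (nat \<lceil>- x\<rceil> + 1) x" for x
  have d: "d x = c k x" if "- real k < x" for k x
  proof -
    have "- real (nat \<lceil>- x\<rceil> + 1) < x" by linarith
    then show ?thesis
      unfolding d_def using eq[of k "nat \<lceil>- x\<rceil> + 1" x] eq[of "nat \<lceil>- x\<rceil> + 1" k x] that
      by (cases "k \<le> nat \<lceil>- x\<rceil> + 1") simp_all
  qed
  have "expansion h d"
  proof (rule expansionI)
    fix \<rho> :: real
    define k where "k = nat \<lceil>- \<rho>\<rceil>"
    have k: "- real k \<le> \<rho>" unfolding k_def by linarith
    define F where "F = {x \<in> E k. - real k < x}"
    have "(\<lambda>n. (h n - (\<Sum>x\<in>E k. c k x * npow x n)) + (\<Sum>x\<in>E k - F. c k x * npow x n)) \<in> O(npow (- real k))"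
      by (intro sum_in_bigo O sum_npow_bigo) (auto simp: F_def)
    moreover have "(\<Sum>x\<in>E k. c k x * npow x n) = (\<Sum>x\<in>E k - F. c k x * npow x n) + (\<Sum>x\<in>F. c k x * npow x n)" for n
      using E by (intro sum.subset_diff) (auto simp: F_def)
    ultimately have "(\<lambda>n. h n - (\<Sum>x\<in>F. c k x * npow x n)) \<in> O(npow (- real k))" by simp
    moreover have "(\<Sum>x\<in>F. c k x * npow x n) = (\<Sum>x\<in>F. d x * npow x n)" for n
      by (intro sum.cong) (auto simp: F_def d)
    ultimately have "(\<lambda>n. h n - (\<Sum>x\<in>F. d x * npow x n)) \<in> O(npow \<rho>)"
      using bigo_npow_mono k by simp
    moreover have "finite F" using E(1) by (simp add: F_def)
    moreover have "x \<in> F" if "\<rho> < x" "d x \<noteq> 0" for x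
    proof -
      have "- real k < x" using k that by simp
      then show ?thesis using that(2) d[of k x] E(3)[of x k] by (auto simp: F_def)
    qed
    ultimately show "\<exists>E. finite E \<and> (\<forall>x. \<rho> < x \<and> d x \<noteq> 0 \<longrightarrow> x \<in> E) \<and>
        (\<lambda>n. h n - (\<Sum>x\<in>E. d x * npow x n)) \<in> O(npow \<rho>)" by blast
  qed
  moreover have "x \<in> S" if "d x \<noteq> 0" for x using that E(2,3) by (auto simp: d_def)
  ultimately show ?thesis by blast
qed

text \<open>The tail of the binomial series is at most (2|z|)^J times its absolute tail at 1/2.
  Absolute convergence at 1/2 follows from convergence at the larger point 3/4.\<close>

lemma powr_one_plus_expansion:
  fixes y :: real
  shows "\<exists>B. \<forall>z. \<bar>z\<bar> \<le> 1 / 2 \<longrightarrow> \<bar>(1 + z) powr y - (\<Sum>j<J. (y gchoose j) * z ^ j)\<bar> \<le> B * \<bar>z\<bar> ^ J"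
proof -
  have "summable (\<lambda>j. (y gchoose j) * (3 / 4) ^ j)"
    using gen_binomial_real[of "3 / 4" y] by (simp add: sums_iff)
  then have "summable (\<lambda>j. norm ((y gchoose j) * (1 / 2) ^ j))"
    by (rule powser_insidea) simp
  then have sum_abs: "summable (\<lambda>i. \<bar>y gchoose (i + J)\<bar> * (1 / 2) ^ (i + J))"
    by (subst summable_iff_shift) (simp add: abs_mult)
  define B where "B = (\<Sum>i. \<bar>y gchoose (i + J)\<bar> * (1 / 2) ^ (i + J)) * 2 ^ J"
  have "\<bar>(1 + z) powr y - (\<Sum>j<J. (y gchoose j) * z ^ j)\<bar> \<le> B * \<bar>z\<bar> ^ J" if z: "\<bar>z\<bar> \<le> 1 / 2" for z
  proof -
    have sums: "(\<lambda>j. (y gchoose j) * z ^ j) sums (1 + z) powr y"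
      using z by (intro gen_binomial_real) simp
    then have "(1 + z) powr y - (\<Sum>j<J. (y gchoose j) * z ^ j) = (\<Sum>i. (y gchoose (i + J)) * z ^ (i + J))"
      using suminf_minus_initial_segment[of "\<lambda>j. (y gchoose j) * z ^ j" J] by (simp add: sums_iff)
    also have "\<bar>\<dots>\<bar> \<le> (\<Sum>i. \<bar>y gchoose (i + J)\<bar> * (1 / 2) ^ (i + J) * (2 ^ J * \<bar>z\<bar> ^ J))"
    proof -
      have le: "norm ((y gchoose (i + J)) * z ^ (i + J)) \<le> \<bar>y gchoose (i + J)\<bar> * (1 / 2) ^ (i + J) * (2 ^ J * \<bar>z\<bar> ^ J)" for i
      proof -
        have "\<bar>z\<bar> ^ i * \<bar>z\<bar> ^ J \<le> (1 / 2) ^ i * \<bar>z\<bar> ^ J"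
          using z by (intro mult_right_mono power_mono) auto
        also have "\<dots> = (1 / 2) ^ (i + J) * (2 ^ J * \<bar>z\<bar> ^ J)"
          by (simp add: power_add power_one_over)
        finally show ?thesis
          by (simp add: abs_mult power_abs power_add mult.assoc mult_left_mono)
      qed
      show ?thesis
        using norm_suminf_le[OF le summable_mult2[OF sum_abs]] by simp
    qed
    also have "\<dots> = B * \<bar>z\<bar> ^ J"
      using suminf_mult2[OF sum_abs, of "2 ^ J * \<bar>z\<bar> ^ J"] by (simp add: B_def)
    finally show ?thesis .
  qed
  then show ?thesis by blast
qed

text \<open>(n-1)^y n^(-a) = n^(y-a) (1 - 1/n)^y, and the binomial series lowers the exponent in
  integer steps.\<close>

lemma approximable_npow_pred:
  assumes "\<And>j::nat. y - a - real j \<in> S"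
  shows "approximable S \<rho> (\<lambda>n. npow y (n - 1) * npow (- a) n)"
proof -
  define J where "J = nat \<lceil>y - a - \<rho>\<rceil>"
  have J: "y - a - real J \<le> \<rho>" unfolding J_def by linarith
  define P where "P n = (\<Sum>j<J. complex_of_real ((y gchoose j) * (-1) ^ j) * npow (y - a - real j) n)" for n
  obtain B where B: "\<And>z. \<bar>z\<bar> \<le> 1 / 2 \<Longrightarrow> \<bar>(1 + z) powr y - (\<Sum>j<J. (y gchoose j) * z ^ j)\<bar> \<le> B * \<bar>z\<bar> ^ J"
    using powr_one_plus_expansion by blast
  have "cmod (npow y (n - 1) * npow (- a) n - P n) \<le> B * cmod (npow (y - a - real J) n)" if n: "n \<ge> 2" for n
  proof -
    define z where "z = - 1 / real n"
    have nz: "\<bar>z\<bar> = 1 / real n" "real (n - 1) = real n * (1 + z)" "1 + z \<ge> 0"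
      using n by (auto simp: z_def field_simps)
    have pj: "real n powr (y - a) * z ^ j = (-1) ^ j * real n powr (y - a - real j)" for j
      using n by (simp add: z_def powr_diff powr_realpow power_minus[of "1 / real n"] power_one_over)
    have "real (n - 1) powr y = real n powr y * (1 + z) powr y"
      unfolding nz(2) using nz(3) by (simp add: powr_mult)
    moreover have "real n powr (y - a) = real n powr y * real n powr (- a)"
      by (simp flip: powr_add)
    ultimately have "npow y (n - 1) * npow (- a) n = of_real (real n powr (y - a) * (1 + z) powr y)"
      by (simp add: npow_def)
    moreover have "P n = of_real (real n powr (y - a) * (\<Sum>j<J. (y gchoose j) * z ^ j))"
    proof -
      have "P n = of_real (\<Sum>j<J. (y gchoose j) * ((-1) ^ j * real n powr (y - a - real j)))"
        by (simp add: P_def npow_def mult.assoc)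
      also have "(\<Sum>j<J. (y gchoose j) * ((-1) ^ j * real n powr (y - a - real j))) =
          real n powr (y - a) * (\<Sum>j<J. (y gchoose j) * z ^ j)"
        unfolding pj[symmetric] by (simp add: sum_distrib_left mult_ac)
      finally show ?thesis .
    qed
    ultimately have "npow y (n - 1) * npow (- a) n - P n =
        of_real (real n powr (y - a) * ((1 + z) powr y - (\<Sum>j<J. (y gchoose j) * z ^ j)))"
      by (simp add: right_diff_distrib)
    then have "cmod (npow y (n - 1) * npow (- a) n - P n) =
        real n powr (y - a) * \<bar>(1 + z) powr y - (\<Sum>j<J. (y gchoose j) * z ^ j)\<bar>"
      by (simp only: norm_of_real abs_mult abs_of_nonneg powr_ge_zero)
    also have "\<dots> \<le> real n powr (y - a) * (B * \<bar>z\<bar> ^ J)"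
      using n by (intro mult_left_mono B) (auto simp: nz)
    also have "\<dots> = B * cmod (npow (y - a - real J) n)"
      using n by (simp add: nz norm_npow powr_diff powr_realpow power_one_over)
    finally show ?thesis .
  qed
  then have "(\<lambda>n. npow y (n - 1) * npow (- a) n - P n) \<in> O(npow (y - a - real J))"
    by (intro bigoI[of _ B] eventually_mono[OF eventually_ge_at_top[of 2]])
  then have "approximable S \<rho> (\<lambda>n. npow y (n - 1) * npow (- a) n - P n)"
    using bigo_npow_mono J by (intro approximable_bigo) blast
  moreover have "approximable S \<rho> P"
    unfolding P_def using assms by (intro approximable_sum approximable_scale approximable_npow) auto
  ultimately have "approximable S \<rho> (\<lambda>n. (npow y (n - 1) * npow (- a) n - P n) + P n)"
    by (rule approximable_add)
  then show ?thesis by simp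
qed

section \<open>The classes of series with asymptotic expansions\<close>

definition gevrey_ratio :: "real \<Rightarrow> real \<Rightarrow> complex fps \<Rightarrow> nat \<Rightarrow> complex" where
  "gevrey_ratio \<alpha> \<beta> f n = fps_nth f n / of_real (fact n powr \<alpha> * \<beta> ^ n)"

definition expandable :: "real \<Rightarrow> real \<Rightarrow> real set \<Rightarrow> complex fps set" where
  "expandable \<alpha> \<beta> S = {f. \<exists>c. expansion (gevrey_ratio \<alpha> \<beta> f) c \<and> (\<forall>x. c x \<noteq> 0 \<longrightarrow> x \<in> S)}"

lemma gevrey_ratio_diff: "gevrey_ratio \<alpha> \<beta> (f - g) = (\<lambda>n. gevrey_ratio \<alpha> \<beta> f n - gevrey_ratio \<alpha> \<beta> g n)"
  by (rule ext) (simp add: gevrey_ratio_def diff_divide_distrib)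

lemma gevrey3_iff_ratio:
  assumes "\<beta> > 0"
  shows "f \<in> gevrey3 \<alpha> \<beta> \<rho> \<longleftrightarrow> gevrey_ratio \<alpha> \<beta> f \<in> O(npow \<rho>)"
proof -
  define w where "w n = complex_of_real (fact n powr \<alpha> * \<beta> ^ n)" for n
  have w: "w n \<noteq> 0" for n using assms by (simp add: w_def)
  have "fps_nth f = (\<lambda>n. w n * gevrey_ratio \<alpha> \<beta> f n)"
    using w by (intro ext) (simp add: gevrey_ratio_def w_def)
  moreover have "(\<lambda>n. complex_of_real (gevrey_scale \<alpha> \<beta> \<rho> n)) = (\<lambda>n. w n * npow \<rho> n)"
    by (intro ext) (simp add: gevrey_scale_def w_def npow_def)
  moreover have "(\<lambda>n. w n * gevrey_ratio \<alpha> \<beta> f n) \<in> O(\<lambda>n. w n * npow \<rho> n) \<longleftrightarrow> gevrey_ratio \<alpha> \<beta> f \<in> O(npow \<rho>)"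
    by (rule landau_o.big.mult_cancel_left) (use w in auto)
  ultimately show ?thesis unfolding gevrey3_def by simp
qed

lemma expandable_iff: "f \<in> expandable \<alpha> \<beta> S \<longleftrightarrow> (\<forall>\<rho>. approximable S \<rho> (gevrey_ratio \<alpha> \<beta> f))"
proof
  assume "f \<in> expandable \<alpha> \<beta> S"
  then obtain c where c: "expansion (gevrey_ratio \<alpha> \<beta> f) c" "\<And>x. c x \<noteq> 0 \<Longrightarrow> x \<in> S"
    unfolding expandable_def by auto
  show "\<forall>\<rho>. approximable S \<rho> (gevrey_ratio \<alpha> \<beta> f)"
    by (rule allI, rule expansion_imp_approximable[OF c(1)]) (rule c(2))
next
  assume "\<forall>\<rho>. approximable S \<rho> (gevrey_ratio \<alpha> \<beta> f)"
  then have "\<And>\<rho>. approximable S \<rho> (gevrey_ratio \<alpha> \<beta> f)" by simp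
  from approximable_imp_expansion[OF this] show "f \<in> expandable \<alpha> \<beta> S"
    by (simp add: expandable_def)
qed

lemma bigo_pred_mult:
  assumes "R \<in> O(npow \<rho>)" "\<alpha> \<ge> 1"
  shows "(\<lambda>n. R (n - 1) * npow (- \<alpha>) n) \<in> O(npow \<rho>)"
    and "(\<lambda>n. npow 1 (n - 1) * R (n - 1) * npow (- \<alpha>) n) \<in> O(npow \<rho>)"
proof -
  have "filterlim (\<lambda>n::nat. n - 1) sequentially sequentially"
    by (rule filterlim_minus_const_nat_at_top)
  from landau_o.big.compose[OF assms(1) this]
  have R: "(\<lambda>n. R (n - 1)) \<in> O(\<lambda>n. npow \<rho> (n - 1))" .
  \<comment> \<open>With \<open>a = 0\<close> this compares (n-1)^\<rho> with n^\<rho>: all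
    exponents that occur are at most \<rho>.\<close>
  have "approximable {x. x \<le> \<rho>} \<rho> (\<lambda>n. npow \<rho> (n - 1) * npow (- 0) n)"
    by (rule approximable_npow_pred) simp
  then obtain E c where E: "E \<subseteq> {x. x \<le> \<rho>}" "(\<lambda>n. npow \<rho> (n - 1) * npow (- 0) n - (\<Sum>x\<in>E. c x * npow x n)) \<in> O(npow \<rho>)"
    unfolding approximable_def by (elim exE conjE)
  have "(\<lambda>n. \<Sum>x\<in>E. c x * npow x n) \<in> O(npow \<rho>)" using E(1) by (intro sum_npow_bigo) auto
  from sum_in_bigo(1)[OF E(2) this] have "(\<lambda>n. npow \<rho> (n - 1) * npow 0 n) \<in> O(npow \<rho>)" by simp
  moreover have "eventually (\<lambda>n. npow \<rho> (n - 1) * npow 0 n = npow \<rho> (n - 1)) sequentially"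
    by (rule eventually_mono[OF eventually_gt_at_top[of 0]]) (simp add: npow_def)
  ultimately have "(\<lambda>n. npow \<rho> (n - 1)) \<in> O(npow \<rho>)" by (simp only: landau_o.big.in_cong)
  with R have R': "(\<lambda>n. R (n - 1)) \<in> O(npow \<rho>)" by (rule landau_o.big_trans)
  have n1: "(\<lambda>n. npow 1 (n - 1)) \<in> O(npow 1)"
    by (rule bigoI[of _ 1]) (simp add: norm_npow)
  have "(\<lambda>n. R (n - 1) * npow (- \<alpha>) n) \<in> O(\<lambda>n. npow \<rho> n * npow (- \<alpha>) n)"
    by (intro landau_o.big.mult R') simp
  also have "(\<lambda>n. npow \<rho> n * npow (- \<alpha>) n) = npow (\<rho> - \<alpha>)" by (simp flip: npow_add)
  finally show "(\<lambda>n. R (n - 1) * npow (- \<alpha>) n) \<in> O(npow \<rho>)"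
    by (rule bigo_npow_mono) (use assms in simp)
  have "(\<lambda>n. npow 1 (n - 1) * R (n - 1) * npow (- \<alpha>) n) \<in> O(\<lambda>n. npow 1 n * npow \<rho> n * npow (- \<alpha>) n)"
    by (intro landau_o.big.mult R' n1) simp
  also have "(\<lambda>n. npow 1 n * npow \<rho> n * npow (- \<alpha>) n) = npow (1 + \<rho> - \<alpha>)" by (simp flip: npow_add)
  finally show "(\<lambda>n. npow 1 (n - 1) * R (n - 1) * npow (- \<alpha>) n) \<in> O(npow \<rho>)"
    by (rule bigo_npow_mono) (use assms in simp)
qed

text \<open>A term n^x of the ratio becomes (n-1)^x n^(-\<alpha>) under \<open>X_mult\<close> and
  (n-1)^(x+1) n^(-\<alpha>) under \<open>X2_deriv\<close>, up to 1/\<beta>. The new exponents are x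
  - \<alpha> - j and x + 1 - \<alpha> - j, which explains the two conditions on
  \<open>S\<close>.\<close>

lemma gevrey_class_expandable:
  assumes "\<alpha> > 1" "\<beta> > 0"
    and S: "\<And>x. x \<in> S \<Longrightarrow> x - 1 \<in> S" "\<And>x. x \<in> S \<Longrightarrow> x + 1 - \<alpha> \<in> S"
  shows "gevrey_class \<alpha> \<beta> (expandable \<alpha> \<beta> S)"
proof
  let ?r = "gevrey_ratio \<alpha> \<beta>"
  have S_diff: "x - real j \<in> S" if "x \<in> S" for x j
  proof (induction j)
    case (Suc j)
    from S(1)[OF this] show ?case by (simp add: algebra_simps)
  qed (use that in simp)
  have S_pred: "x + 1 - \<alpha> - real j \<in> S" "x - \<alpha> - real j \<in> S" if "x \<in> S" for x j
    using S_diff[OF S(2)[OF that], of j] S_diff[OF S(2)[OF that], of "Suc j"] by (simp_all add: algebra_simps)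
  show "expandable \<alpha> \<beta> S \<subseteq> gevrey2 \<alpha> \<beta>"
  proof
    fix f assume "f \<in> expandable \<alpha> \<beta> S"
    then have "approximable S 0 (?r f)" by (simp add: expandable_iff)
    then obtain E c where E: "finite E" "(\<lambda>n. ?r f n - (\<Sum>x\<in>E. c x * npow x n)) \<in> O(npow 0)"
      unfolding approximable_def by (elim exE conjE)
    define M where "M = Max (insert 0 E)"
    have M: "0 \<le> M" "\<And>x. x \<in> E \<Longrightarrow> x \<le> M" using E(1) by (auto simp: M_def)
    have "(\<lambda>n. \<Sum>x\<in>E. c x * npow x n) \<in> O(npow M)" using M by (intro sum_npow_bigo) auto
    from sum_in_bigo(1)[OF bigo_npow_mono[OF E(2) M(1)] this] have "?r f \<in> O(npow M)" by simp
    then have "f \<in> gevrey3 \<alpha> \<beta> M" by (simp add: gevrey3_iff_ratio[OF assms(2)])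
    then show "f \<in> gevrey2 \<alpha> \<beta>" by (auto simp: gevrey2_def)
  qed
  have "?r 0 = (\<lambda>n. 0)" by (rule ext) (simp add: gevrey_ratio_def)
  then show "0 \<in> expandable \<alpha> \<beta> S" by (simp add: expandable_iff approximable_bigo)
  fix f g :: "complex fps" and a :: complex
  show "f + g \<in> expandable \<alpha> \<beta> S" if "f \<in> expandable \<alpha> \<beta> S" "g \<in> expandable \<alpha> \<beta> S"
  proof -
    have "?r (f + g) = (\<lambda>n. ?r f n + ?r g n)" by (rule ext) (simp add: gevrey_ratio_def add_divide_distrib)
    with that show ?thesis by (simp add: expandable_iff approximable_add)
  qed
  show "fps_const a * f \<in> expandable \<alpha> \<beta> S" if "f \<in> expandable \<alpha> \<beta> S"
  proof -
    have "?r (fps_const a * f) = (\<lambda>n. a * ?r f n)" by (rule ext) (simp add: gevrey_ratio_def)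
    with that show ?thesis by (simp add: expandable_iff approximable_scale)
  qed
  have weight: "complex_of_real (fact (Suc m) powr \<alpha> * \<beta> ^ Suc m) =
      of_real (real (Suc m) powr \<alpha>) * \<beta> * of_real (fact m powr \<alpha> * \<beta> ^ m)" for m
    by (simp add: powr_mult del: of_nat_Suc)
  have ratio_pred: "fps_nth f m / complex_of_real (fact (Suc m) powr \<alpha> * \<beta> ^ Suc m) =
      1 / of_real \<beta> * (?r f m * npow (- \<alpha>) (Suc m))" for f m
    unfolding weight gevrey_ratio_def npow_def powr_minus by (simp add: field_simps)
  have approx: "approximable S \<rho> (\<lambda>n. ?r f (n - 1) * npow (- \<alpha>) n)"
      "approximable S \<rho> (\<lambda>n. npow 1 (n - 1) * ?r f (n - 1) * npow (- \<alpha>) n)"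
    if "f \<in> expandable \<alpha> \<beta> S" for f \<rho>
  proof -
    have "approximable S \<rho> (?r f)" using that by (simp add: expandable_iff)
    then obtain E c where E: "finite E" "E \<subseteq> S" "(\<lambda>n. ?r f n - (\<Sum>x\<in>E. c x * npow x n)) \<in> O(npow \<rho>)"
      unfolding approximable_def by (elim exE conjE)
    define R where "R n = ?r f n - (\<Sum>x\<in>E. c x * npow x n)" for n
    have R: "R \<in> O(npow \<rho>)" using E(3) by (simp add: R_def[abs_def])
    have r: "?r f n = R n + (\<Sum>x\<in>E. c x * npow x n)" for n by (simp add: R_def)
    have \<alpha>: "\<alpha> \<ge> 1" using assms(1) by simp
    have "approximable S \<rho> (\<lambda>n. R (n - 1) * npow (- \<alpha>) n + (\<Sum>x\<in>E. c x * (npow x (n - 1) * npow (- \<alpha>) n)))"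
      using E(2) S_pred(2)
      by (intro approximable_add approximable_bigo bigo_pred_mult R \<alpha> approximable_sum approximable_scale
          approximable_npow_pred) auto
    then show "approximable S \<rho> (\<lambda>n. ?r f (n - 1) * npow (- \<alpha>) n)"
      by (simp add: r distrib_right sum_distrib_right mult.assoc)
    have "approximable S \<rho> (\<lambda>n. npow 1 (n - 1) * R (n - 1) * npow (- \<alpha>) n + (\<Sum>x\<in>E. c x * (npow (x + 1) (n - 1) * npow (- \<alpha>) n)))"
      using E(2) S_pred(1)
      by (intro approximable_add approximable_bigo bigo_pred_mult R \<alpha> approximable_sum approximable_scale
          approximable_npow_pred) auto
    then show "approximable S \<rho> (\<lambda>n. npow 1 (n - 1) * ?r f (n - 1) * npow (- \<alpha>) n)"
      by (simp add: r npow_add distrib_left distrib_right sum_distrib_left sum_distrib_right mult_ac)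
  qed
  show "fps_X * f \<in> expandable \<alpha> \<beta> S" if f: "f \<in> expandable \<alpha> \<beta> S"
    unfolding expandable_iff
  proof
    fix \<rho>
    show "approximable S \<rho> (?r (fps_X * f))"
    proof (rule approximable_cong)
      show "approximable S \<rho> (\<lambda>n. 1 / of_real \<beta> * (?r f (n - 1) * npow (- \<alpha>) n))"
        by (intro approximable_scale approx f)
      show "eventually (\<lambda>n. 1 / of_real \<beta> * (?r f (n - 1) * npow (- \<alpha>) n) = ?r (fps_X * f) n) sequentially"
      proof (rule eventually_mono[OF eventually_gt_at_top[of 0]])
        fix n :: nat assume "n > 0"
        then obtain m where m: "n = Suc m" by (cases n) auto
        have "?r (fps_X * f) n = fps_nth f m / of_real (fact (Suc m) powr \<alpha> * \<beta> ^ Suc m)"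
          unfolding gevrey_ratio_def m by (simp add: fps_X_mult_nth del: fact_Suc power_Suc)
        then show "1 / of_real \<beta> * (?r f (n - 1) * npow (- \<alpha>) n) = ?r (fps_X * f) n"
          unfolding ratio_pred by (simp add: m)
      qed
    qed
  qed
  show "fps_X ^ 2 * fps_deriv f \<in> expandable \<alpha> \<beta> S" if f: "f \<in> expandable \<alpha> \<beta> S"
    unfolding expandable_iff
  proof
    fix \<rho>
    show "approximable S \<rho> (?r (fps_X ^ 2 * fps_deriv f))"
    proof (rule approximable_cong)
      show "approximable S \<rho> (\<lambda>n. 1 / of_real \<beta> * (npow 1 (n - 1) * ?r f (n - 1) * npow (- \<alpha>) n))"
        by (intro approximable_scale approx f)
      show "eventually (\<lambda>n. 1 / of_real \<beta> * (npow 1 (n - 1) * ?r f (n - 1) * npow (- \<alpha>) n) =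
        ?r (fps_X ^ 2 * fps_deriv f) n) sequentially"
      proof (rule eventually_mono[OF eventually_gt_at_top[of 1]])
        fix n :: nat assume "n > 1"
        then obtain l where l: "n = Suc (Suc l)" by (cases n; cases "n - 1") auto
        define m where "m = Suc l"
        have m: "n = Suc m" by (simp add: l m_def)
        have nth: "fps_nth (fps_X ^ 2 * fps_deriv f) n = of_nat m * fps_nth f m"
          by (simp add: fps_X_power_mult_nth l m_def)
        have "?r (fps_X ^ 2 * fps_deriv f) n = of_nat m * (fps_nth f m / of_real (fact (Suc m) powr \<alpha> * \<beta> ^ Suc m))"
          unfolding gevrey_ratio_def nth unfolding m by simp
        moreover have "npow 1 m = of_nat m" by (simp add: npow_def)
        ultimately show "1 / of_real \<beta> * (npow 1 (n - 1) * ?r f (n - 1) * npow (- \<alpha>) n) =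
            ?r (fps_X ^ 2 * fps_deriv f) n"
          unfolding ratio_pred by (simp add: m)
      qed
    qed
  qed
  show "f \<in> expandable \<alpha> \<beta> S" if *: "\<And>\<rho>. \<exists>v\<in>expandable \<alpha> \<beta> S. f - v \<in> gevrey3 \<alpha> \<beta> \<rho>"
    unfolding expandable_iff
  proof
    fix \<rho>
    obtain v where v: "v \<in> expandable \<alpha> \<beta> S" "f - v \<in> gevrey3 \<alpha> \<beta> \<rho>" using *[of \<rho>] by blast
    have "approximable S \<rho> (\<lambda>n. ?r (f - v) n + ?r v n)"
    proof (rule approximable_add)
      show "approximable S \<rho> (?r (f - v))"
        using v(2) by (intro approximable_bigo) (simp add: gevrey3_iff_ratio[OF assms(2)])
      show "approximable S \<rho> (?r v)" using v(1) by (simp add: expandable_iff)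
    qed
    then show "approximable S \<rho> (?r f)" by (simp add: gevrey_ratio_diff)
  qed
qed (use assms in auto)


subsection \<open>Expansions in powers of \<open>1/n\<close>\<close>

text \<open>The sequence as a function of the exponent; the floor merely recovers the index i from x
  = \<gamma> - i.\<close>

definition asy3_coeff :: "real \<Rightarrow> (nat \<Rightarrow> complex) \<Rightarrow> real \<Rightarrow> complex" where
  "asy3_coeff \<gamma> A x = (if \<exists>i::nat. x = \<gamma> - real i then A (nat \<lfloor>\<gamma> - x\<rfloor>) else 0)"

lemma asy3_coeff_eq [simp]: "asy3_coeff \<gamma> A (\<gamma> - real i) = A i"
  by (auto simp: asy3_coeff_def)

lemma has_asy3_iff_bigo:
  assumes "\<beta> > 0"
  shows "has_asy3 \<alpha> \<beta> \<gamma> f A \<longleftrightarrow>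
    (\<forall>r>0. (\<lambda>n. gevrey_ratio \<alpha> \<beta> f n - (\<Sum>i<r. A i * npow (\<gamma> - real i) n)) \<in> O(npow (\<gamma> - real r)))"
proof -
  have "(\<lambda>n. fps_nth f n / of_real (gevrey_scale \<alpha> \<beta> \<gamma> n) - (\<Sum>i<r. A i / of_nat n ^ i)) \<in> O(\<lambda>n. 1 / of_nat n ^ r) \<longleftrightarrow>
     (\<lambda>n. gevrey_ratio \<alpha> \<beta> f n - (\<Sum>i<r. A i * npow (\<gamma> - real i) n)) \<in> O(npow (\<gamma> - real r))" for r
  proof -
    let ?L = "\<lambda>n. fps_nth f n / of_real (gevrey_scale \<alpha> \<beta> \<gamma> n) - (\<Sum>i<r. A i / of_nat n ^ i)"
    have npow_i: "npow (\<gamma> - real i) n = npow \<gamma> n / of_nat n ^ i" if "n > 0" for n i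
      using that by (simp add: npow_def powr_diff powr_realpow)
    have "?L \<in> O(\<lambda>n. 1 / of_nat n ^ r) \<longleftrightarrow> (\<lambda>n. npow \<gamma> n * ?L n) \<in> O(\<lambda>n. npow \<gamma> n * (1 / of_nat n ^ r))"
      by (rule landau_o.big.mult_cancel_left[symmetric])
        (auto intro: eventually_mono[OF eventually_gt_at_top[of 0] npow_nonzero])
    also have "\<dots> \<longleftrightarrow> (\<lambda>n. gevrey_ratio \<alpha> \<beta> f n - (\<Sum>i<r. A i * npow (\<gamma> - real i) n)) \<in> O(\<lambda>n. npow \<gamma> n * (1 / of_nat n ^ r))"
    proof (rule landau_o.big.in_cong, rule eventually_mono[OF eventually_gt_at_top[of 0]])
      fix n :: nat assume n: "n > 0"
      have "npow \<gamma> n * (fps_nth f n / of_real (gevrey_scale \<alpha> \<beta> \<gamma> n)) = gevrey_ratio \<alpha> \<beta> f n"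
        using n by (simp add: npow_def gevrey_ratio_def gevrey_scale_def)
      then show "npow \<gamma> n * ?L n = gevrey_ratio \<alpha> \<beta> f n - (\<Sum>i<r. A i * npow (\<gamma> - real i) n)"
        using n by (simp add: right_diff_distrib sum_distrib_left npow_i mult_ac)
    qed
    also have "\<dots> \<longleftrightarrow> (\<lambda>n. gevrey_ratio \<alpha> \<beta> f n - (\<Sum>i<r. A i * npow (\<gamma> - real i) n)) \<in> O(npow (\<gamma> - real r))"
    proof -
      have "eventually (\<lambda>n. npow \<gamma> n * (1 / of_nat n ^ r) = npow (\<gamma> - real r) n) sequentially"
        by (rule eventually_mono[OF eventually_gt_at_top[of 0]]) (simp add: npow_i)
      from landau_o.big.cong[OF this] show ?thesis by simp
    qed
    finally show ?thesis .
  qed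
  then show ?thesis unfolding has_asy3_def by simp
qed

lemma sum_asy3_coeff:
  "(\<Sum>x\<in>(\<lambda>i. \<gamma> - real i) ` {..<r}. asy3_coeff \<gamma> A x * npow x n) = (\<Sum>i<r. A i * npow (\<gamma> - real i) n)"
  by (subst sum.reindex) (auto simp: inj_on_def)

lemma has_asy3_iff_expansion:
  assumes "\<beta> > 0"
  shows "has_asy3 \<alpha> \<beta> \<gamma> f A \<longleftrightarrow> expansion (gevrey_ratio \<alpha> \<beta> f) (asy3_coeff \<gamma> A)"
proof
  assume *: "has_asy3 \<alpha> \<beta> \<gamma> f A"
  show "expansion (gevrey_ratio \<alpha> \<beta> f) (asy3_coeff \<gamma> A)"
  proof (rule expansionI)
    fix \<rho> :: real
    \<comment> \<open>\<open>Suc\<close> keeps the order positive, as \<open>has_asy3\<close> speaks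
      of positive orders only.\<close>
    define r where "r = Suc (nat \<lceil>\<gamma> - \<rho>\<rceil>)"
    have r: "\<gamma> - real r \<le> \<rho>" "r > 0" unfolding r_def by linarith+
    define E where "E = (\<lambda>i. \<gamma> - real i) ` {..<r}"
    have "(\<lambda>n. gevrey_ratio \<alpha> \<beta> f n - (\<Sum>x\<in>E. asy3_coeff \<gamma> A x * npow x n)) \<in> O(npow (\<gamma> - real r))"
      using * r(2) unfolding E_def sum_asy3_coeff by (simp add: has_asy3_iff_bigo[OF assms])
    then have "(\<lambda>n. gevrey_ratio \<alpha> \<beta> f n - (\<Sum>x\<in>E. asy3_coeff \<gamma> A x * npow x n)) \<in> O(npow \<rho>)"
      by (rule bigo_npow_mono) (rule r(1))
    moreover have "x \<in> E" if "\<rho> < x" "asy3_coeff \<gamma> A x \<noteq> 0" for x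
      using that r(1) by (auto simp: E_def asy3_coeff_def split: if_splits)
    moreover have "finite E" by (simp add: E_def)
    ultimately show "\<exists>E. finite E \<and> (\<forall>x. \<rho> < x \<and> asy3_coeff \<gamma> A x \<noteq> 0 \<longrightarrow> x \<in> E) \<and>
        (\<lambda>n. gevrey_ratio \<alpha> \<beta> f n - (\<Sum>x\<in>E. asy3_coeff \<gamma> A x * npow x n)) \<in> O(npow \<rho>)"
      by (intro exI[of _ E] conjI) auto
  qed
next
  assume *: "expansion (gevrey_ratio \<alpha> \<beta> f) (asy3_coeff \<gamma> A)"
  show "has_asy3 \<alpha> \<beta> \<gamma> f A"
    unfolding has_asy3_iff_bigo[OF assms]
  proof (intro allI impI)
    fix r :: nat
    have "(\<Sum>x | \<gamma> - real r < x \<and> asy3_coeff \<gamma> A x \<noteq> 0. asy3_coeff \<gamma> A x * npow x n) =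
      (\<Sum>x\<in>(\<lambda>i. \<gamma> - real i) ` {..<r}. asy3_coeff \<gamma> A x * npow x n)" for n
      by (rule sum_above_eq) (auto simp: asy3_coeff_def split: if_splits)
    moreover have "(\<lambda>n. gevrey_ratio \<alpha> \<beta> f n - (\<Sum>x | \<gamma> - real r < x \<and> asy3_coeff \<gamma> A x \<noteq> 0. asy3_coeff \<gamma> A x * npow x n))
        \<in> O(npow (\<gamma> - real r))"
      using * by (simp add: expansion_def)
    ultimately show "(\<lambda>n. gevrey_ratio \<alpha> \<beta> f n - (\<Sum>i<r. A i * npow (\<gamma> - real i) n)) \<in> O(npow (\<gamma> - real r))"
      by (simp only: sum_asy3_coeff)
  qed
qed

lemma gevrey_asy3_eq_expandable:
  assumes "\<beta> > 0"
  shows "gevrey_asy3 \<alpha> \<beta> \<gamma> = expandable \<alpha> \<beta> (range (\<lambda>i. \<gamma> - real i))"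
proof (intro equalityI subsetI)
  fix f assume "f \<in> gevrey_asy3 \<alpha> \<beta> \<gamma>"
  then obtain A where A: "expansion (gevrey_ratio \<alpha> \<beta> f) (asy3_coeff \<gamma> A)"
    using has_asy3_iff_expansion[OF assms] by (auto simp: gevrey_asy3_def)
  have "x \<in> range (\<lambda>i. \<gamma> - real i)" if "asy3_coeff \<gamma> A x \<noteq> 0" for x
    using that by (auto simp: asy3_coeff_def split: if_splits)
  with A show "f \<in> expandable \<alpha> \<beta> (range (\<lambda>i. \<gamma> - real i))"
    unfolding expandable_def by (intro CollectI exI[of _ "asy3_coeff \<gamma> A"]) auto
next
  fix f assume "f \<in> expandable \<alpha> \<beta> (range (\<lambda>i. \<gamma> - real i))"
  then obtain c where c: "expansion (gevrey_ratio \<alpha> \<beta> f) c" "\<And>x. c x \<noteq> 0 \<Longrightarrow> x \<in> range (\<lambda>i. \<gamma> - real i)"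
    by (auto simp: expandable_def)
  define A where "A i = c (\<gamma> - real i)" for i
  have "c = asy3_coeff \<gamma> A"
  proof
    fix x show "c x = asy3_coeff \<gamma> A x"
      using c(2)[of x] by (auto simp: asy3_coeff_def A_def)
  qed
  with c(1) have "has_asy3 \<alpha> \<beta> \<gamma> f A" by (simp add: has_asy3_iff_expansion[OF assms])
  then show "f \<in> gevrey_asy3 \<alpha> \<beta> \<gamma>" by (auto simp: gevrey_asy3_def)
qed

lemma asy3_coeff_eq_above_iff:
  "(\<forall>x>\<gamma> - real r. asy3_coeff \<gamma> A x = asy3_coeff \<gamma> A' x) \<longleftrightarrow> (\<forall>i<r. A i = A' i)"
proof (intro iffI allI impI)
  fix i assume *: "\<forall>x>\<gamma> - real r. asy3_coeff \<gamma> A x = asy3_coeff \<gamma> A' x" and "i < r"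
  then show "A i = A' i" using *[rule_format, of "\<gamma> - real i"] by simp
next
  fix x assume "\<forall>i<r. A i = A' i" "\<gamma> - real r < x"
  then show "asy3_coeff \<gamma> A x = asy3_coeff \<gamma> A' x" by (auto simp: asy3_coeff_def)
qed

lemma same_asy3_iff:
  assumes "\<beta> > 0" "f \<in> gevrey_asy3 \<alpha> \<beta> \<gamma>" "f' \<in> gevrey_asy3 \<alpha> \<beta> \<gamma>"
  shows "same_asy3 \<alpha> \<beta> \<gamma> r f f' \<longleftrightarrow> f - f' \<in> gevrey3 \<alpha> \<beta> (\<gamma> - real r)"
proof -
  have eq: "f - f' \<in> gevrey3 \<alpha> \<beta> (\<gamma> - real r) \<longleftrightarrow> (\<forall>i<r. A i = A' i)"
    if "has_asy3 \<alpha> \<beta> \<gamma> f A" "has_asy3 \<alpha> \<beta> \<gamma> f' A'" for A A'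
    using that unfolding has_asy3_iff_expansion[OF assms(1)]
    by (simp add: gevrey3_iff_ratio[OF assms(1)] gevrey_ratio_diff expansion_diff_bigo_iff asy3_coeff_eq_above_iff)
  obtain A A' where "has_asy3 \<alpha> \<beta> \<gamma> f A" "has_asy3 \<alpha> \<beta> \<gamma> f' A'"
    using assms by (auto simp: gevrey_asy3_def)
  with eq show ?thesis unfolding same_asy3_def by blast
qed

text \<open>When one of the series has no expansion, \<open>same_asy3\<close> holds vacuously. This
  covers results of operations that leave the class.\<close>

lemma same_asy3I:
  assumes "\<beta> > 0" "f - f' \<in> gevrey3 \<alpha> \<beta> (\<gamma> - real r)"
  shows "same_asy3 \<alpha> \<beta> \<gamma> r f f'"
proof (cases "f \<in> gevrey_asy3 \<alpha> \<beta> \<gamma> \<and> f' \<in> gevrey_asy3 \<alpha> \<beta> \<gamma>")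
  case True then show ?thesis using same_asy3_iff assms by blast
qed (auto simp: same_asy3_def gevrey_asy3_def)

lemma gevrey_asy3_subset_gevrey3:
  assumes "\<beta> > 0"
  shows "gevrey_asy3 \<alpha> \<beta> \<gamma> \<subseteq> gevrey3 \<alpha> \<beta> \<gamma>"
proof
  fix f assume "f \<in> gevrey_asy3 \<alpha> \<beta> \<gamma>"
  then obtain A where A: "expansion (gevrey_ratio \<alpha> \<beta> f) (asy3_coeff \<gamma> A)"
    using has_asy3_iff_expansion[OF assms] by (auto simp: gevrey_asy3_def)
  have "asy3_coeff \<gamma> A x = 0" if "\<gamma> < x" for x using that by (auto simp: asy3_coeff_def)
  then show "f \<in> gevrey3 \<alpha> \<beta> \<gamma>"
    using expansion_diff_bigo_iff[OF A expansion_zero, of \<gamma>] by (simp add: gevrey3_iff_ratio[OF assms])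
qed


subsection \<open>Expansions in arbitrary real powers\<close>

lemma strict_decreasing_imp_less:
  fixes e :: "nat \<Rightarrow> real"
  assumes "\<And>i. e (Suc i) < e i" "i < j"
  shows "e j < e i"
  using assms(2)
proof (induction j)
  case (Suc j)
  then show ?case using assms(1)[of j] by (cases "i = j") auto
qed simp

text \<open>The exponents are strictly decreasing, so \<open>inv e\<close> recovers the unique index
  of an exponent.\<close>

definition asy2_coeff :: "(nat \<Rightarrow> real) \<Rightarrow> (nat \<Rightarrow> complex) \<Rightarrow> real \<Rightarrow> complex" where
  "asy2_coeff e A x = (if x \<in> range e then A (inv e x) else 0)"

lemma has_asy2_imp_expansion:
  assumes "has_asy2 \<alpha> \<beta> f e A"
  shows "expansion (gevrey_ratio \<alpha> \<beta> f) (asy2_coeff e A)"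
    and "terms_above \<rho> e A = {(x, asy2_coeff e A x) | x. \<rho> < x \<and> asy2_coeff e A x \<noteq> 0}"
proof -
  have dec: "\<And>i. e (Suc i) < e i" and lim: "filterlim e at_bot sequentially"
    and O: "\<And>r. r > 0 \<Longrightarrow> (\<lambda>n. gevrey_ratio \<alpha> \<beta> f n - (\<Sum>i<r. A i * npow (e i) n)) \<in> O(npow (e r))"
    using assms by (auto simp: has_asy2_def gevrey_ratio_def npow_def[abs_def])
  have less: "i < j \<Longrightarrow> e j < e i" for i j by (rule strict_decreasing_imp_less[of e, OF dec])
  have inj: "inj e" by (rule injI) (metis less less_irrefl nat_neq_iff)
  have coeff: "asy2_coeff e A (e i) = A i" for i using inj by (simp add: asy2_coeff_def)
  show "expansion (gevrey_ratio \<alpha> \<beta> f) (asy2_coeff e A)"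
  proof (rule expansionI)
    fix \<rho> :: real
    have "eventually (\<lambda>r. e r \<le> \<rho>) sequentially" using lim by (simp add: filterlim_at_bot)
    then have "eventually (\<lambda>r. e r \<le> \<rho> \<and> r > 0) sequentially"
      using eventually_gt_at_top[of 0] by (rule eventually_conj)
    then obtain r where r: "e r \<le> \<rho>" "r > 0" by (auto dest: eventually_happens)
    define E where "E = e ` {..<r}"
    have "(\<Sum>x\<in>E. asy2_coeff e A x * npow x n) = (\<Sum>i<r. A i * npow (e i) n)" for n
      unfolding E_def using inj by (subst sum.reindex) (auto simp: coeff intro: inj_on_subset)
    then have "(\<lambda>n. gevrey_ratio \<alpha> \<beta> f n - (\<Sum>x\<in>E. asy2_coeff e A x * npow x n)) \<in> O(npow (e r))"
      using O[OF r(2)] by simp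
    then have "(\<lambda>n. gevrey_ratio \<alpha> \<beta> f n - (\<Sum>x\<in>E. asy2_coeff e A x * npow x n)) \<in> O(npow \<rho>)"
      by (rule bigo_npow_mono) (rule r(1))
    moreover have "x \<in> E" if x: "\<rho> < x" "asy2_coeff e A x \<noteq> 0" for x
    proof -
      obtain i where i: "x = e i" using x(2) by (auto simp: asy2_coeff_def split: if_splits)
      have "\<not> r \<le> i" using less[of r i] r(1) x(1) i by (cases "r = i") auto
      then show ?thesis by (simp add: E_def i)
    qed
    moreover have "finite E" by (simp add: E_def)
    ultimately show "\<exists>E. finite E \<and> (\<forall>x. \<rho> < x \<and> asy2_coeff e A x \<noteq> 0 \<longrightarrow> x \<in> E) \<and>
        (\<lambda>n. gevrey_ratio \<alpha> \<beta> f n - (\<Sum>x\<in>E. asy2_coeff e A x * npow x n)) \<in> O(npow \<rho>)"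
      by (intro exI[of _ E] conjI) auto
  qed
  have "x \<in> range e" if "asy2_coeff e A x \<noteq> 0" for x
    using that by (auto simp: asy2_coeff_def split: if_splits)
  then show "terms_above \<rho> e A = {(x, asy2_coeff e A x) | x. \<rho> < x \<and> asy2_coeff e A x \<noteq> 0}"
    unfolding terms_above_def by (auto simp: coeff) (metis coeff rangeE)
qed

text \<open>Starting above T, each value is the largest element of T below the previous one. By
  finiteness the infinitely many values cannot stay above any bound. The first value not exceeding a
  given element of T must equal it.\<close>

lemma enumerate_decreasing:
  fixes T :: "real set"
  assumes fin: "\<And>\<rho>. finite {x \<in> T. \<rho> < x}" and unbounded: "\<And>\<rho>. \<exists>x\<in>T. x < \<rho>"
  obtains e where "\<And>i::nat. e (Suc i) < e i" "filterlim e at_bot sequentially" "range e = T"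
proof -
  define P where "P y x \<longleftrightarrow> x \<in> T \<and> x < y \<and> (\<forall>z\<in>T. z < y \<longrightarrow> z \<le> x)" for y x
  have "\<exists>x. P y x" for y
  proof -
    obtain t where t: "t \<in> T" "t < y" using unbounded by blast
    define F where "F = {z \<in> T. t \<le> z \<and> z < y}"
    \<comment> \<open>The margin 1 fits the closed condition \<open>t \<le> z\<close> into the
      strict one of \<open>fin\<close>.\<close>
    have "F \<subseteq> {x \<in> T. t - 1 < x}" by (auto simp: F_def)
    then have F: "finite F" "F \<noteq> {}"
      using t finite_subset[OF _ fin] by (blast, auto simp: F_def)
    have "P y (Max F)"
      unfolding P_def
    proof (intro conjI ballI impI)
      show "Max F \<in> T" "Max F < y" using Max_in[OF F] by (auto simp: F_def)
      fix z assume z: "z \<in> T" "z < y"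
      show "z \<le> Max F"
      proof (cases "t \<le> z")
        case True then show ?thesis using z F by (intro Max_ge) (auto simp: F_def)
      next
        case False
        have "t \<le> Max F" using t F by (intro Max_ge) (auto simp: F_def)
        with False show ?thesis by simp
      qed
    qed
    then show ?thesis ..
  qed
  then obtain next_below where nb: "\<And>y. P y (next_below y)" by metis
  obtain M where M: "\<And>x. x \<in> T \<Longrightarrow> x < M"
  proof -
    define F where "F = insert 0 {x \<in> T. 0 < x}"
    have F: "finite F" using fin by (simp add: F_def)
    show ?thesis
    proof (rule that[of "Max F + 1"])
      fix x assume x: "x \<in> T"
      show "x < Max F + 1"
      proof (cases "0 < x")
        case True
        then have "x \<le> Max F" using x F by (intro Max_ge) (auto simp: F_def)
        then show ?thesis by simp
      next
        case False
        have "0 \<le> Max F" using F by (intro Max_ge) (auto simp: F_def)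
        with False show ?thesis by simp
      qed
    qed
  qed
  define e where "e = rec_nat (next_below M) (\<lambda>_. next_below)"
  have e0: "e 0 = next_below M" and eS: "e (Suc i) = next_below (e i)" for i
    by (simp_all add: e_def)
  have e_T: "e i \<in> T" for i using nb by (cases i) (auto simp: e0 eS P_def)
  have dec: "e (Suc i) < e i" for i using nb by (auto simp: eS P_def)
  have less: "i < j \<Longrightarrow> e j < e i" for i j by (rule strict_decreasing_imp_less[of e, OF dec])
  have inj: "inj e" by (rule injI) (metis less less_irrefl nat_neq_iff)
  have ex: "\<exists>i. e i \<le> \<rho>" for \<rho>
  proof (rule ccontr)
    assume "\<not> (\<exists>i. e i \<le> \<rho>)"
    then have "range e \<subseteq> {x \<in> T. \<rho> < x}" using e_T by (auto simp: not_le)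
    then have "finite (range e)" using fin finite_subset by blast
    then show False using inj finite_imageD infinite_UNIV_nat by blast
  qed
  have lim: "filterlim e at_bot sequentially"
    unfolding filterlim_at_bot
  proof
    fix Z
    obtain i where i: "e i \<le> Z" using ex by blast
    show "eventually (\<lambda>j. e j \<le> Z) sequentially"
    proof (rule eventually_mono[OF eventually_ge_at_top[of i]])
      fix j assume "i \<le> j"
      then show "e j \<le> Z" using less[of i j] i by (cases "i = j") auto
    qed
  qed
  have "T \<subseteq> range e"
  proof
    fix t assume t: "t \<in> T"
    define i where "i = (LEAST i. e i \<le> t)"
    have i: "e i \<le> t" unfolding i_def using ex by (rule LeastI_ex)
    have "t \<le> e i"
    proof (cases i)
      case 0
      then show ?thesis using nb[of M] M t by (auto simp: e0 P_def)
    next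
      case (Suc j)
      have "\<not> e j \<le> t" using not_less_Least[of j "\<lambda>i. e i \<le> t"] Suc by (simp add: i_def)
      then show ?thesis using nb[of "e j"] t by (auto simp: Suc eS P_def)
    qed
    with i show "t \<in> range e" by (metis order_antisym rangeI)
  qed
  then show ?thesis using that[OF dec lim] e_T by blast
qed

text \<open>
  Adding the exponents \<open>0, -1, -2, \<dots>\<close> with zero coefficients makes the sequence of exponents
  infinite.
\<close>

lemma expansion_imp_has_asy2:
  assumes c: "expansion (gevrey_ratio \<alpha> \<beta> f) c"
  shows "\<exists>e A. has_asy2 \<alpha> \<beta> f e A"
proof -
  define T where "T = {x. c x \<noteq> 0} \<union> range (\<lambda>n. - real n)"
  have fin: "finite {x \<in> T. \<rho> < x}" for \<rho>
  proof -
    have "{x \<in> T. \<rho> < x} \<subseteq> {x. \<rho> < x \<and> c x \<noteq> 0} \<union> (\<lambda>n. - real n) ` {..<nat \<lceil>- \<rho>\<rceil>}"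
    proof
      fix x assume x: "x \<in> {x \<in> T. \<rho> < x}"
      then consider "c x \<noteq> 0" | n where "x = - real n" by (auto simp: T_def)
      then show "x \<in> {x. \<rho> < x \<and> c x \<noteq> 0} \<union> (\<lambda>n. - real n) ` {..<nat \<lceil>- \<rho>\<rceil>}"
      proof cases
        case 2
        then have "n < nat \<lceil>- \<rho>\<rceil>" using x by simp linarith
        then show ?thesis using 2 by auto
      qed (use x in auto)
    qed
    moreover have "finite {x. \<rho> < x \<and> c x \<noteq> 0}" using c by (simp add: expansion_def)
    ultimately show ?thesis by (auto intro: finite_subset)
  qed
  have unbounded: "\<exists>x\<in>T. x < \<rho>" for \<rho>
  proof -
    obtain n :: nat where "- \<rho> < real n" using reals_Archimedean2 by blast
    then show ?thesis by (intro bexI[of _ "- real n"]) (auto simp: T_def)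
  qed
  obtain e where e: "\<And>i::nat. e (Suc i) < e i" "filterlim e at_bot sequentially" "range e = T"
    using enumerate_decreasing[OF fin unbounded] by blast
  have less: "i < j \<Longrightarrow> e j < e i" for i j by (rule strict_decreasing_imp_less[of e, OF e(1)])
  have inj: "inj e" by (rule injI) (metis less less_irrefl nat_neq_iff)
  have "(\<lambda>n. gevrey_ratio \<alpha> \<beta> f n - (\<Sum>i<r. c (e i) * npow (e i) n)) \<in> O(npow (e r))" for r
  proof -
    have "(\<Sum>x | e r < x \<and> c x \<noteq> 0. c x * npow x n) = (\<Sum>x\<in>e ` {..<r}. c x * npow x n)" for n
    proof (rule sum_above_eq)
      fix x assume x: "e r < x" "c x \<noteq> 0"
      then have "x \<in> range e" unfolding e(3) by (simp add: T_def)
      then obtain i where i: "x = e i" by auto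
      have "\<not> r \<le> i" using less[of r i] x(1) i by (cases "r = i") auto
      then show "x \<in> e ` {..<r}" by (simp add: i)
    qed (use less in auto)
    also have "(\<Sum>x\<in>e ` {..<r}. c x * npow x n) = (\<Sum>i<r. c (e i) * npow (e i) n)" for n
      using inj by (subst sum.reindex) (auto intro: inj_on_subset)
    finally have "(\<Sum>x | e r < x \<and> c x \<noteq> 0. c x * npow x n) = (\<Sum>i<r. c (e i) * npow (e i) n)" for n .
    moreover have "(\<lambda>n. gevrey_ratio \<alpha> \<beta> f n - (\<Sum>x | e r < x \<and> c x \<noteq> 0. c x * npow x n)) \<in> O(npow (e r))"
      using c by (simp add: expansion_def)
    ultimately show ?thesis by simp
  qed
  with e(1,2) have "has_asy2 \<alpha> \<beta> f e (\<lambda>i. c (e i))"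
    by (simp add: has_asy2_def gevrey_ratio_def npow_def[abs_def])
  then show ?thesis by blast
qed

lemma gevrey_asy2_eq_expandable: "gevrey_asy2 \<alpha> \<beta> = expandable \<alpha> \<beta> UNIV"
  unfolding gevrey_asy2_def expandable_def
  using has_asy2_imp_expansion(1) expansion_imp_has_asy2 by (intro Collect_cong) (auto, blast)

lemma same_asy2_iff:
  assumes "\<beta> > 0" "f \<in> gevrey_asy2 \<alpha> \<beta>" "f' \<in> gevrey_asy2 \<alpha> \<beta>"
  shows "same_asy2 \<alpha> \<beta> \<rho> f f' \<longleftrightarrow> f - f' \<in> gevrey3 \<alpha> \<beta> \<rho>"
proof -
  have eq: "f - f' \<in> gevrey3 \<alpha> \<beta> \<rho> \<longleftrightarrow> terms_above \<rho> e A = terms_above \<rho> e' A'"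
    if "has_asy2 \<alpha> \<beta> f e A" "has_asy2 \<alpha> \<beta> f' e' A'" for e A e' A'
  proof -
    define c c' where "c = asy2_coeff e A" and "c' = asy2_coeff e' A'"
    have "f - f' \<in> gevrey3 \<alpha> \<beta> \<rho> \<longleftrightarrow> (\<forall>x>\<rho>. c x = c' x)"
      unfolding c_def c'_def gevrey3_iff_ratio[OF assms(1)] gevrey_ratio_diff
      by (rule expansion_diff_bigo_iff[OF has_asy2_imp_expansion(1)[OF that(1)] has_asy2_imp_expansion(1)[OF that(2)]])
    also have "\<dots> \<longleftrightarrow> {(x, c x) | x. \<rho> < x \<and> c x \<noteq> 0} = {(x, c' x) | x. \<rho> < x \<and> c' x \<noteq> 0}"
    proof
      assume eq: "{(x, c x) | x. \<rho> < x \<and> c x \<noteq> 0} = {(x, c' x) | x. \<rho> < x \<and> c' x \<noteq> 0}"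
      show "\<forall>x>\<rho>. c x = c' x"
      proof (intro allI impI)
        fix x assume x: "\<rho> < x"
        have "(x, a) \<in> {(x, c x) | x. \<rho> < x \<and> c x \<noteq> 0} \<longleftrightarrow> (x, a) \<in> {(x, c' x) | x. \<rho> < x \<and> c' x \<noteq> 0}" for a
          by (simp only: eq)
        then have "(a = c x \<and> c x \<noteq> 0) \<longleftrightarrow> (a = c' x \<and> c' x \<noteq> 0)" for a using x by auto
        from this[of "c x"] this[of "c' x"] show "c x = c' x" by auto
      qed
    qed auto
    also have "\<dots> \<longleftrightarrow> terms_above \<rho> e A = terms_above \<rho> e' A'"
      unfolding has_asy2_imp_expansion(2)[OF that(1)] has_asy2_imp_expansion(2)[OF that(2)] c_def c'_def ..
    finally show ?thesis .
  qed
  obtain e A e' A' where "has_asy2 \<alpha> \<beta> f e A" "has_asy2 \<alpha> \<beta> f' e' A'"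
    using assms by (auto simp: gevrey_asy2_def)
  with eq show ?thesis unfolding same_asy2_def by blast
qed

lemma same_asy2I:
  assumes "\<beta> > 0" "f - f' \<in> gevrey3 \<alpha> \<beta> \<rho>"
  shows "same_asy2 \<alpha> \<beta> \<rho> f f'"
proof (cases "f \<in> gevrey_asy2 \<alpha> \<beta> \<and> f' \<in> gevrey_asy2 \<alpha> \<beta>")
  case True then show ?thesis using same_asy2_iff assms by blast
qed (auto simp: same_asy2_def gevrey_asy2_def)


section \<open>Dependence and closure for the classes with expansions\<close>

lemma series_ops_respect_mono:
  assumes "series_ops_respect P Q" "\<And>f f'. P' f f' \<Longrightarrow> P f f'" "\<And>f f'. Q f f' \<Longrightarrow> Q' f f'"
  shows "series_ops_respect P' Q'"
  using assms unfolding series_ops_respect_def by meson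

lemma asy3_determined:
  assumes "\<alpha> > 1" "\<beta> > 0"
  shows "asy3_determined \<alpha> \<beta> \<gamma>"
  unfolding asy3_determined_def
proof
  fix r :: nat
  obtain N where N: "series_ops_respect
    (\<lambda>f f'. f \<in> gevrey3 \<alpha> \<beta> \<gamma> \<and> f' \<in> gevrey3 \<alpha> \<beta> \<gamma> \<and> f - f' \<in> gevrey3 \<alpha> \<beta> (\<gamma> - real r) \<and> same_initial N f f')
    (\<lambda>f f'. f - f' \<in> gevrey3 \<alpha> \<beta> (\<gamma> - real r))"
    using series_ops_respect_gevrey3[OF assms] by blast
  show "\<exists>N. series_ops_respect
        (\<lambda>f f'. f \<in> gevrey_asy3 \<alpha> \<beta> \<gamma> \<and> f' \<in> gevrey_asy3 \<alpha> \<beta> \<gamma> \<and>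
                same_asy3 \<alpha> \<beta> \<gamma> r f f' \<and> same_initial N f f')
        (same_asy3 \<alpha> \<beta> \<gamma> r)"
    using gevrey_asy3_subset_gevrey3[OF assms(2), of \<alpha> \<gamma>] same_asy3I[OF assms(2)]
    by (intro exI[of _ N] series_ops_respect_mono[OF N]) (auto simp: same_asy3_iff[OF assms(2)])
qed

lemma asy2_determined:
  assumes "\<alpha> > 1" "\<beta> > 0"
  shows "asy2_determined \<alpha> \<beta>"
  unfolding asy2_determined_def
proof (intro allI)
  fix \<Gamma> \<rho> :: real
  obtain N where N: "series_ops_respect
    (\<lambda>f f'. f \<in> gevrey3 \<alpha> \<beta> \<Gamma> \<and> f' \<in> gevrey3 \<alpha> \<beta> \<Gamma> \<and> f - f' \<in> gevrey3 \<alpha> \<beta> \<rho> \<and> same_initial N f f')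
    (\<lambda>f f'. f - f' \<in> gevrey3 \<alpha> \<beta> \<rho>)"
    using series_ops_respect_gevrey3[OF assms] by blast
  show "\<exists>N. series_ops_respect
        (\<lambda>f f'. f \<in> gevrey_asy2 \<alpha> \<beta> \<inter> gevrey3 \<alpha> \<beta> \<Gamma> \<and> f' \<in> gevrey_asy2 \<alpha> \<beta> \<inter> gevrey3 \<alpha> \<beta> \<Gamma> \<and>
                same_asy2 \<alpha> \<beta> \<rho> f f' \<and> same_initial N f f')
        (same_asy2 \<alpha> \<beta> \<rho>)"
    using same_asy2I[OF assms(2)]
    by (intro exI[of _ N] series_ops_respect_mono[OF N]) (auto simp: same_asy2_iff[OF assms(2)])
qed

text \<open>Addition does not move exponents, so this holds for every real \<alpha>.\<close>

lemma gevrey_asy3_add: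
  assumes "\<beta> > 0" "f \<in> gevrey_asy3 \<alpha> \<beta> \<gamma>" "g \<in> gevrey_asy3 \<alpha> \<beta> \<gamma>"
  shows "f + g \<in> gevrey_asy3 \<alpha> \<beta> \<gamma>"
proof -
  have "gevrey_ratio \<alpha> \<beta> (f + g) = (\<lambda>n. gevrey_ratio \<alpha> \<beta> f n + gevrey_ratio \<alpha> \<beta> g n)"
    by (rule ext) (simp add: gevrey_ratio_def add_divide_distrib)
  with assms show ?thesis
    by (simp add: gevrey_asy3_eq_expandable expandable_iff approximable_add)
qed

text \<open>For \<alpha> = k + 1, the step from x to x + 1 - \<alpha> = x - k stays among the
  exponents \<gamma> - i; this is where integrality enters.\<close>

lemma closed_under_series_ops_gevrey_asy3:
  assumes "\<alpha> > 1" "\<beta> > 0" "\<alpha> \<in> \<int>"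
  shows "closed_under_series_ops (gevrey_asy3 \<alpha> \<beta> \<gamma>)"
  unfolding gevrey_asy3_eq_expandable[OF assms(2)]
proof (rule gevrey_class.closed_under_series_ops[OF gevrey_class_expandable[OF assms(1,2)]])
  obtain k :: nat where k: "\<alpha> = real (Suc k)"
  proof -
    obtain z :: int where z: "\<alpha> = of_int z" using assms(3) by (auto elim: Ints_cases)
    then have "\<alpha> = real (Suc (nat (z - 1)))" using assms(1) by simp
    then show ?thesis by (rule that)
  qed
  fix x assume "x \<in> range (\<lambda>i. \<gamma> - real i)"
  then obtain i where i: "x = \<gamma> - real i" by auto
  have "x - 1 = \<gamma> - real (Suc i)" "x + 1 - \<alpha> = \<gamma> - real (i + k)" by (simp_all add: i k)
  then show "x - 1 \<in> range (\<lambda>i. \<gamma> - real i)" "x + 1 - \<alpha> \<in> range (\<lambda>i. \<gamma> - real i)" by blast+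
qed

lemma closed_under_series_ops_gevrey_asy2:
  assumes "\<alpha> > 1" "\<beta> > 0"
  shows "closed_under_series_ops (gevrey_asy2 \<alpha> \<beta>)"
  unfolding gevrey_asy2_eq_expandable
  by (rule gevrey_class.closed_under_series_ops[OF gevrey_class_expandable[OF assms]]) auto


text \<open>Products lead out of \<open>gevrey_asy3\<close> for nonintegral \<alpha>, by
  \<open>gevrey_asy3_not_closed\<close>; closure of that class is therefore asserted for addition in
  general and for all operations when \<alpha> is an integer. The dependence statements cover all
  \<alpha> > 1, since they compare results only when both have expansions.\<close>

theorem theoremA1:
  fixes \<alpha> \<beta> \<gamma> :: real
  assumes "\<alpha> > 1" and "\<beta> > 0"
  shows "closed_under_series_ops (gevrey1 \<alpha>) \<and>
    closed_under_series_ops (gevrey2 \<alpha> \<beta>) \<and>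
    closed_under_series_ops (gevrey3 \<alpha> \<beta> \<gamma>) \<and>
    (\<forall>f\<in>gevrey_asy3 \<alpha> \<beta> \<gamma>. \<forall>g\<in>gevrey_asy3 \<alpha> \<beta> \<gamma>. f + g \<in> gevrey_asy3 \<alpha> \<beta> \<gamma>) \<and>
    (\<alpha> \<in> \<int> \<longrightarrow> closed_under_series_ops (gevrey_asy3 \<alpha> \<beta> \<gamma>)) \<and>
    closed_under_series_ops (gevrey_asy2 \<alpha> \<beta>) \<and>
    asy3_determined \<alpha> \<beta> \<gamma> \<and>
    asy2_determined \<alpha> \<beta>"
  using assms
  by (intro conjI impI ballI closed_under_series_ops_gevrey1 closed_under_series_ops_gevrey2
      closed_under_series_ops_gevrey3 gevrey_asy3_add closed_under_series_ops_gevrey_asy3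
      closed_under_series_ops_gevrey_asy2 asy3_determined asy2_determined)

end
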